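(* Let $\{G^N\}_N$ be an $f$-sequence satisfying the standing assumptions (a)–(d) of the context and in the $(\mathbf w,\mathbf v,\mathbf p)$-subcritical regime. Assume that for all $N\ge1$ the system $G^N$ starts from the all-empty state. Then under the $\mathbf p$-based JIQ policy, for any $T\ge0$ and every $m\in[M]$, $$\lim_{N\to\infty}\mathbb P\Big(\sup_{t\in[0,T]}\bar X^N_m(t)\le\sum_{k\in[K]}x^{\mathbf p}_{m,k}\Big)=1,$$ where $\bar X^N_m(t)$ is $1/N$ times the number of busy servers in $\mathcal V^N_m$ at time $t$. Consequently, with the all-empty initial state, on any finite time interval, the probability that an arriving task is assigned to a busy server converges to $0$ as $N\to\infty$.
   Context: Notation: $[n]=\{1,\dots,n\}$; $|\cdot|$ of a subset of $[0,1)$ is Lebesgue measure. Model. $G^N=(\mathcal W^N,\mathcal V^N,\boldsymbol\lambda^N,\mathcal U^N)$ is a load balancing system with dispatchers $\mathcal W^N=\{1,\dots,W(N)\}$ (each dispatcher handles exactly one type of task, so dispatcher = task type) and servers $\mathcal V^N=\{1,\dots,N\}$. Each server has its own infinite-buffer queue served First-Come-First-Served. Tasks arrive at dispatcher $i$ as a Poisson process of rate $\lambda_i^N$, independently of everything else, and must be assigned immediately and irrevocably to a server. The service time of a type-$i$ task at server $j$ is exponential with mean $1/\mu^N_{i,j}$ if $\mu^N_{i,j}>0$ (all service times independent); if $\mu^N_{i,j}=0$ server $j$ cannot process type-$i$ tasks. $\mathcal U^N=(\mu^N_{i,j})$. A server is busy if its queue (including the task in service) is non-empty and idle otherwise. $f$-sequence.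 There are fixed maps $\phi_1,\phi_2:\mathbb N\to[0,1)$ (for dispatchers and servers), and $f:[0,1)^2\to\mathbb R_+$; the sets $\mathcal W^N,\mathcal V^N$ are increasing in $N$, and $\mu^N_{i,j}=f(\phi_1(i),\phi_2(j))$ for all $(i,j)\in\mathcal W^N\times\mathcal V^N$. Standing assumptions. (a) There is a Riemann integrable $\lambda:[0,1)\to\mathbb R_+$ with $\int_0^1\lambda(x)dx>0$ and $\lambda^N_i=\lambda(\phi_1(i))$ for all $i\in\mathcal W^N$, $N\in\mathbb N$. (b) $f$ is Riemann integrable, and there is $\mu^o>0$ such that $|\{y\in[0,1):f(x,y)\ge\mu^o\}|>0$ for all $x\in[0,1)$. (c) For every subinterval $E\subseteq[0,1)$, $\lim_N\frac1{W(N)}\sum_{i\in\mathcal W^N}\mathbf 1_{(\phi_1(i)\in E)}=\lim_N\frac1N\sum_{j\in\mathcal V^N}\mathbf 1_{(\phi_2(j)\in E)}=|E|$. (d) $\lim_NW(N)/N=\xi>0$ for a constant $\xi$. $(\mathbf w,\mathbf v,\mathbf p)$-subcritical regime. $\mathbf w=(0=w_0<\dots<w_H=1)$ and $\mathbf v=(0=v_0<\dots<v_M=1)$ are partitions of $[0,1)$ and $\mathbf p=(p_{h,m})\in[0,1]^{H\times M}$ has unit row sums, such that $\sum_{h\in[H]}\frac{p_{h,m}\lambda_h}{(v_m-v_{m-1})\mu^*_{h,m}}<1$ for all $m\in[M]$, where $\lambda_h=\xi\int_{w_{h-1}}^{w_h}\lambda(x)dx$, assumed positive for each $h$, and $\mu^*_{h,m}=\inf_{(x,y)\in[w_{h-1},w_h)\times[v_{m-1},v_m)}f(x,y)$.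 Convention: a quotient with numerator $0$ is $0$, and one with positive numerator and zero denominator is $+\infty$ (so $p_{h,m}>0$ forces $\mu^*_{h,m}>0$). Put $\mathcal W^N_h=\{i\in\mathcal W^N:\phi_1(i)\in[w_{h-1},w_h)\}$ and $\mathcal V^N_m=\{j\in\mathcal V^N:\phi_2(j)\in[v_{m-1},v_m)\}$. $\mathbf p$-based JIQ policy. When a task arrives at a dispatcher $i\in\mathcal W^N_h$, the dispatcher first selects a target type $m^*\in[M]$ at random with distribution $(p_{h,m})_{m\in[M]}$ (independently of everything else); the task is then sent to a uniformly random idle server in $\mathcal V^N_{m^*}$ if there is one, and otherwise to a uniformly random server in $\mathcal V^N_{m^*}$. Let $\mu^*_1,\dots,\mu^*_K$ be the distinct values of $\mu^*_{h,m}$, $h\in[H],m\in[M]$, and put $\lambda^{\mathbf p}_{m,k}=\sum_{h\in[H]}p_{h,m}\lambda_h\mathbf 1_{(\mu^*_{h,m}=\mu^*_k)}$, $x^{\mathbf p}_{m,k}=\lambda^{\mathbf p}_{m,k}/\mu^*_k$ (with the same convention on quotients). *)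

theory Defs
  imports "HOL-Probability.Probability"
begin

section \<open>Riemann integrability\<close>

text \<open>
  HOL-Analysis provides the gauge (Henstock-Kurzweil) and Lebesgue integrals, for which
  equidistribution arguments fail.  Riemann integrability on a compact box is the gauge
  condition with constant gauges, i.e. with a uniform bound on the mesh of the tagged division.
\<close>

definition riemann_integrable :: "('a::euclidean_space \<Rightarrow> real) \<Rightarrow> 'a \<Rightarrow> 'a \<Rightarrow> bool" where
  "riemann_integrable g a b \<longleftrightarrow>
     (\<exists>I. \<forall>e>0. \<exists>d>0. \<forall>D. D tagged_division_of cbox a b \<and> (\<lambda>x. ball x d) fine D \<longrightarrow>
        \<bar>(\<Sum>(x,B)\<in>D. measure lborel B * g x) - I\<bar> < e)"

section \<open>The load balancing model\<close>

text \<open>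
  The data of an \<open>f\<close>-sequence.  The servers of the \<open>N\<close>-th system are \<open>{1..N}\<close> and its
  dispatchers are \<open>{1..num_disp N}\<close>.  Functions on \<open>[0,1)\<close> and \<open>[0,1)\<^sup>2\<close> are
  only constrained on these sets.
\<close>

record load_model =
  num_disp :: "nat \<Rightarrow> nat"
  disp_pos :: "nat \<Rightarrow> real"               \<comment> \<open>\<open>\<phi>\<^sub>1\<close>\<close>
  serv_pos :: "nat \<Rightarrow> real"               \<comment> \<open>\<open>\<phi>\<^sub>2\<close>\<close>
  serv_fun :: "real \<times> real \<Rightarrow> real"       \<comment> \<open>\<open>f\<close>\<close>
  arr_fun :: "real \<Rightarrow> real"               \<comment> \<open>\<open>\<lambda>\<close>\<close>
  disp_ratio :: real                      \<comment> \<open>\<open>\<xi>\<close>\<close>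

definition arr_rate :: "load_model \<Rightarrow> nat \<Rightarrow> real" where
  "arr_rate Q i = arr_fun Q (disp_pos Q i)"

definition serv_rate :: "load_model \<Rightarrow> nat \<Rightarrow> nat \<Rightarrow> real" where
  "serv_rate Q i j = serv_fun Q (disp_pos Q i, serv_pos Q j)"

definition f_sequence :: "load_model \<Rightarrow> bool" where
  "f_sequence Q \<longleftrightarrow>
     (\<forall>N\<ge>1. \<forall>N'\<ge>N. num_disp Q N \<le> num_disp Q N') \<and>
     (\<forall>i\<ge>1. disp_pos Q i \<in> {0..<1}) \<and>
     (\<forall>j\<ge>1. serv_pos Q j \<in> {0..<1}) \<and>
     (\<forall>x\<in>{0..<1}. \<forall>y\<in>{0..<1}. 0 \<le> serv_fun Q (x, y))"

definition standing_assumptions :: "load_model \<Rightarrow> bool" where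
  "standing_assumptions Q \<longleftrightarrow>
     \<comment> \<open>(a)\<close>
     (\<forall>x\<in>{0..<1}. 0 \<le> arr_fun Q x) \<and>
     riemann_integrable (\<lambda>x. if x \<in> {0..<1} then arr_fun Q x else 0) 0 1 \<and>
     0 < integral {0..<1} (arr_fun Q) \<and>
     \<comment> \<open>(b)\<close>
     riemann_integrable (\<lambda>z. if z \<in> {0..<1} \<times> {0..<1} then serv_fun Q z else 0) (0, 0) (1, 1) \<and>
     (\<exists>\<mu>>0. \<forall>x\<in>{0..<1}. 0 < measure lebesgue {y\<in>{0..<1}. \<mu> \<le> serv_fun Q (x, y)}) \<and>
     \<comment> \<open>(c)\<close>
     (\<forall>E. is_interval E \<and> E \<subseteq> {0..<1} \<longrightarrow>
        (\<lambda>N. real (card {i\<in>{1..num_disp Q N}. disp_pos Q i \<in> E}) / real (num_disp Q N))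
          \<longlonglongrightarrow> measure lebesgue E \<and>
        (\<lambda>N. real (card {j\<in>{1..N}. serv_pos Q j \<in> E}) / real N)
          \<longlonglongrightarrow> measure lebesgue E) \<and>
     \<comment> \<open>(d)\<close>
     0 < disp_ratio Q \<and>
     (\<lambda>N. real (num_disp Q N) / real N) \<longlonglongrightarrow> disp_ratio Q"

section \<open>The subcritical regime\<close>

record regime =
  numH :: nat
  numM :: nat
  wpart :: "nat \<Rightarrow> real"                  \<comment> \<open>\<open>w\<^sub>0, \<dots>, w\<^sub>H\<close>\<close>
  vpart :: "nat \<Rightarrow> real"                  \<comment> \<open>\<open>v\<^sub>0, \<dots>, v\<^sub>M\<close>\<close>
  pmat :: "nat \<Rightarrow> nat \<Rightarrow> real"            \<comment> \<open>\<open>p\<^sub>h\<^sub>,\<^sub>m\<close>, for \<open>h \<in> {1..H}\<close> and \<open>m \<in> {1..M}\<close>\<close>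

definition wcell :: "regime \<Rightarrow> nat \<Rightarrow> real set" where
  "wcell R h = {wpart R (h - 1)..<wpart R h}"

definition vcell :: "regime \<Rightarrow> nat \<Rightarrow> real set" where
  "vcell R m = {vpart R (m - 1)..<vpart R m}"

definition lam_cell :: "load_model \<Rightarrow> regime \<Rightarrow> nat \<Rightarrow> real" where
  "lam_cell Q R h = disp_ratio Q * integral (wcell R h) (arr_fun Q)"

definition mu_star :: "load_model \<Rightarrow> regime \<Rightarrow> nat \<Rightarrow> nat \<Rightarrow> real" where
  "mu_star Q R h m = Inf (serv_fun Q ` (wcell R h \<times> vcell R m))"

text \<open>
  Quotients are taken in \<^typ>\<open>ennreal\<close>, where \<open>0 / 0 = 0\<close> and \<open>a / 0 = \<infinity>\<close> for \<open>a > 0\<close>.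
\<close>

definition subcritical :: "load_model \<Rightarrow> regime \<Rightarrow> bool" where
  "subcritical Q R \<longleftrightarrow>
     wpart R 0 = 0 \<and> wpart R (numH R) = 1 \<and> (\<forall>h<numH R. wpart R h < wpart R (Suc h)) \<and>
     vpart R 0 = 0 \<and> vpart R (numM R) = 1 \<and> (\<forall>m<numM R. vpart R m < vpart R (Suc m)) \<and>
     (\<forall>h\<in>{1..numH R}. \<forall>m\<in>{1..numM R}. pmat R h m \<in> {0..1}) \<and>
     (\<forall>h\<in>{1..numH R}. (\<Sum>m\<in>{1..numM R}. pmat R h m) = 1) \<and>
     (\<forall>h\<in>{1..numH R}. 0 < lam_cell Q R h) \<and>
     (\<forall>m\<in>{1..numM R}.
        (\<Sum>h\<in>{1..numH R}. ennreal (pmat R h m * lam_cell Q R h) /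
           ennreal ((vpart R m - vpart R (m - 1)) * mu_star Q R h m)) < 1)"

text \<open>
  In the next two definitions \<open>c\<close> stands for one of the distinct values of \<^const>\<open>mu_star\<close>.
\<close>

definition lam_p :: "load_model \<Rightarrow> regime \<Rightarrow> nat \<Rightarrow> real \<Rightarrow> real" where
  "lam_p Q R m c =
     (\<Sum>h\<in>{1..numH R}. pmat R h m * lam_cell Q R h * of_bool (mu_star Q R h m = c))"

definition x_p :: "load_model \<Rightarrow> regime \<Rightarrow> nat \<Rightarrow> real \<Rightarrow> ennreal" where
  "x_p Q R m c = ennreal (lam_p Q R m c) / ennreal c"

definition serv_class :: "load_model \<Rightarrow> regime \<Rightarrow> nat \<Rightarrow> nat \<Rightarrow> nat set" where
  "serv_class Q R N m = {j\<in>{1..N}. serv_pos Q j \<in> vcell R m}"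

section \<open>The stochastic system\<close>

text \<open>
  The task \<open>(i, n)\<close> is the \<open>n\<close>-th task (counted from \<open>0\<close>) of dispatcher \<open>i\<close>.
\<close>

type_synonym task = "nat \<times> nat"

text \<open>
  A realisation of one system on a probability space: the random primitives, together with the
  two processes which they drive.  \<open>service S k j\<close> is the service time of task \<open>k\<close> if
  it is processed by server \<open>j\<close>, and \<open>pick S k B\<close> is the server which the dispatcher
  chooses for task \<open>k\<close> when it has to choose uniformly at random in the set \<open>B\<close>.
\<close>

record 'a lb_system =
  pspace :: "'a measure"
  interarrival :: "task \<Rightarrow> 'a \<Rightarrow> real"
  target :: "task \<Rightarrow> 'a \<Rightarrow> nat"
  service :: "task \<Rightarrow> nat \<Rightarrow> 'a \<Rightarrow> real"
  pick :: "task \<Rightarrow> nat set \<Rightarrow> 'a \<Rightarrow> nat"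
  assigned :: "task \<Rightarrow> 'a \<Rightarrow> nat"         \<comment> \<open>the server to which the task is sent\<close>
  departure :: "task \<Rightarrow> 'a \<Rightarrow> real"       \<comment> \<open>the time at which its service is completed\<close>

text \<open>
  Poisson arrivals are given by i.i.d. exponential interarrival times; a dispatcher with arrival
  rate \<open>0\<close> receives no tasks.
\<close>

definition tasks :: "load_model \<Rightarrow> nat \<Rightarrow> task set" where
  "tasks Q N = {i\<in>{1..num_disp Q N}. 0 < arr_rate Q i} \<times> UNIV"

definition arrival :: "'a lb_system \<Rightarrow> task \<Rightarrow> 'a \<Rightarrow> real" where
  "arrival S k \<omega> = (\<Sum>l\<le>snd k. interarrival S (fst k, l) \<omega>)"

text \<open>
  The tasks in the queue of server \<open>j\<close> (the one in service included) at time \<open>t\<close>.  The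
  system is initially empty, so that every task in it has arrived after time \<open>0\<close>.
\<close>

definition queue :: "load_model \<Rightarrow> nat \<Rightarrow> 'a lb_system \<Rightarrow> nat \<Rightarrow> real \<Rightarrow> 'a \<Rightarrow> task set" where
  "queue Q N S j t \<omega> =
     {k\<in>tasks Q N. assigned S k \<omega> = j \<and> arrival S k \<omega> \<le> t \<and> t < departure S k \<omega>}"

text \<open>
  The tasks which task \<open>k\<close> finds in the queue of server \<open>j\<close> upon its arrival.
\<close>

definition ahead :: "load_model \<Rightarrow> nat \<Rightarrow> 'a lb_system \<Rightarrow> nat \<Rightarrow> task \<Rightarrow> 'a \<Rightarrow> task set" where
  "ahead Q N S j k \<omega> =
     {l\<in>tasks Q N. assigned S l \<omega> = j \<and> arrival S l \<omega> < arrival S k \<omega> \<and>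
        arrival S k \<omega> < departure S l \<omega>}"

text \<open>
  Independence of random variables in HOL-Probability requires a common value type, so the
  \<^typ>\<open>nat\<close>-valued primitives are embedded into the reals.
\<close>

datatype primitive =
  Interarrival task | Target task | Service task nat | Pick task "nat set"

fun prim_var :: "'a lb_system \<Rightarrow> primitive \<Rightarrow> 'a \<Rightarrow> real" where
  "prim_var S (Interarrival k) = interarrival S k"
| "prim_var S (Target k) = (\<lambda>\<omega>. real (target S k \<omega>))"
| "prim_var S (Service k j) = service S k j"
| "prim_var S (Pick k B) = (\<lambda>\<omega>. real (pick S k B \<omega>))"

definition primitives :: "load_model \<Rightarrow> nat \<Rightarrow> primitive set" where
  "primitives Q N =
     Interarrival ` tasks Q N \<union>
     Target ` tasks Q N \<union>
     {Service k j | k j. k \<in> tasks Q N \<and> j \<in> {1..N} \<and> 0 < serv_rate Q (fst k) j} \<union>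
     {Pick k B | k B. k \<in> tasks Q N \<and> B \<subseteq> {1..N} \<and> B \<noteq> {}}"

definition primitive_laws :: "load_model \<Rightarrow> regime \<Rightarrow> nat \<Rightarrow> 'a lb_system \<Rightarrow> bool" where
  "primitive_laws Q R N S \<longleftrightarrow>
     prob_space.indep_vars (pspace S) (\<lambda>_. borel) (prim_var S) (primitives Q N) \<and>
     (\<forall>k\<in>tasks Q N.
        distributed (pspace S) lborel (interarrival S k)
          (exponential_density (arr_rate Q (fst k))) \<and>
        (\<forall>h\<in>{1..numH R}. disp_pos Q (fst k) \<in> wcell R h \<longrightarrow>
          (\<forall>m\<in>{1..numM R}. \<P>(\<omega> in pspace S. target S k \<omega> = m) = pmat R h m)) \<and>
        (\<forall>j\<in>{1..N}. 0 < serv_rate Q (fst k) j \<longrightarrow>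
          distributed (pspace S) lborel (service S k j)
            (exponential_density (serv_rate Q (fst k) j))) \<and>
        (\<forall>B. B \<subseteq> {1..N} \<and> B \<noteq> {} \<longrightarrow>
          (\<forall>j\<in>B. \<P>(\<omega> in pspace S. pick S k B \<omega> = j) = 1 / real (card B))))"

definition jiq_assignment ::
  "load_model \<Rightarrow> regime \<Rightarrow> nat \<Rightarrow> 'a lb_system \<Rightarrow> task \<Rightarrow> 'a \<Rightarrow> bool" where
  "jiq_assignment Q R N S k \<omega> \<longleftrightarrow>
     (let V = serv_class Q R N (target S k \<omega>);
          I = {j\<in>V. ahead Q N S j k \<omega> = {}}
      in assigned S k \<omega> = pick S k (if I \<noteq> {} then I else V) \<omega>)"

text \<open>
  First-Come-First-Served: the service starts upon arrival if the server is idle, and otherwise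
  when all the tasks which are ahead in the queue have left.  Almost surely the set is finite.
\<close>

definition fcfs_departure :: "load_model \<Rightarrow> nat \<Rightarrow> 'a lb_system \<Rightarrow> task \<Rightarrow> 'a \<Rightarrow> bool" where
  "fcfs_departure Q N S k \<omega> \<longleftrightarrow>
     departure S k \<omega> =
       Max (insert (arrival S k \<omega>)
              ((\<lambda>l. departure S l \<omega>) ` ahead Q N S (assigned S k \<omega>) k \<omega>)) +
       service S k (assigned S k \<omega>) \<omega>"

text \<open>
  The \<open>N\<close>-th system under the \<open>p\<close>-based JIQ policy, started from the empty state.
  Arrival times are almost surely distinct, so that the two recursive equations determine
  \<^const>\<open>assigned\<close> and \<^const>\<open>departure\<close> almost surely.  Nothing is prescribed for a
  task whose target class contains no server at all, which can only happen for finitely many \<open>N\<close>.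
\<close>

definition jiq_system :: "load_model \<Rightarrow> regime \<Rightarrow> nat \<Rightarrow> 'a lb_system \<Rightarrow> bool" where
  "jiq_system Q R N S \<longleftrightarrow>
     prob_space (pspace S) \<and>
     primitive_laws Q R N S \<and>
     (\<forall>k\<in>tasks Q N.
        assigned S k \<in> measurable (pspace S) (count_space UNIV) \<and>
        departure S k \<in> borel_measurable (pspace S)) \<and>
     (AE \<omega> in pspace S. \<forall>k\<in>tasks Q N.
        jiq_assignment Q R N S k \<omega> \<and> fcfs_departure Q N S k \<omega>)"

definition busy_fraction ::
  "load_model \<Rightarrow> regime \<Rightarrow> nat \<Rightarrow> 'a lb_system \<Rightarrow> nat \<Rightarrow> real \<Rightarrow> 'a \<Rightarrow> real" where
  "busy_fraction Q R N S m t \<omega> =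
     real (card {j\<in>serv_class Q R N m. queue Q N S j t \<omega> \<noteq> {}}) / real N"

definition assigned_to_busy :: "load_model \<Rightarrow> nat \<Rightarrow> 'a lb_system \<Rightarrow> task \<Rightarrow> 'a \<Rightarrow> bool" where
  "assigned_to_busy Q N S k \<omega> \<longleftrightarrow> ahead Q N S (assigned S k \<omega>) k \<omega> \<noteq> {}"

end

theory Submission
  imports Defs
begin

text \<open>
  As long as no task has been sent to a busy server, every task is served from its arrival on, so
  the busy servers of class \<open>m\<close> at time \<open>t\<close> correspond to tasks with target \<open>m\<close>,
  arrival at most \<open>t\<close> and arrival plus service time beyond \<open>t\<close>.  The service time of a
  task is independent of everything which determines its server, because that depends only on
  arrivals, targets and picks and on the service times of earlier tasks.  Hence the number of such
  tasks is dominated by an infinite server queue started empty.  Its mean at time \<open>t \<le> T\<close>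
  lies strictly below the stationary value \<open>\<Sum>\<^sub>h p\<^sub>h\<^sub>,\<^sub>m \<lambda>\<^sub>h / \<mu>\<^sup>*\<^sub>h\<^sub>,\<^sub>m\<close>, by a
  margin of order \<open>N\<close>, and its fluctuations are handled by second moments: the deviations
  from the conditional means given the past are pairwise orthogonal over tasks, and the conditional
  means, functions of arrivals and targets alone, are independent over dispatchers.  A
  finite mesh of \<open>[0, T]\<close> makes this uniform in time.  As the stationary value is smaller than
  the class size, the first task sent to a busy server would contradict the bound.
\<close>

section \<open>Riemann integrability and equidistribution\<close>

text \<open>The service times that actually occur do not form an independent family, because the
  server of a task is decided by earlier service times. Therefore the service time at every possible
  server is kept as a primitive, and \<open>jiq_iter\<close> presents the assignment as an explicit
  function of the primitives of finitely many tasks. In this form it is visible that changing the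
  service times of one task affects neither its own server nor the servers of earlier tasks. The
  truncation to \<open>L\<close> tasks per dispatcher keeps all sums finite; the moment bounds are
  uniform in \<open>L\<close>, so \<open>L\<close> may be chosen last, separately for each
  \<open>N\<close>. The claimed bound is the stationary mean itself, with no \<epsilon> added. The
  room for fluctuations comes from the empty start: up to time \<open>T\<close> the infinite server
  queue still misses a portion proportional to \<open>exp (- \<mu> * T)\<close>, which is positive
  once some task may be directed to the class. A class that no task is directed to has no such
  margin, but it stays empty. Equidistribution controls sums of \<lambda> over dispatcher positions
  because a uniform mesh allows tags anywhere in a cell, in particular near the supremum.\<close>

lemma riemann_integrable_Henstock:
  fixes g :: "real \<Rightarrow> real"
  assumes "riemann_integrable g a b"
  shows "g integrable_on {a..b}"
    and "e > 0 \<Longrightarrow> \<exists>d>0. \<forall>p. p tagged_partial_division_of {a..b} \<and> (\<lambda>x. ball x d) fine p \<longrightarrow>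
           \<bar>\<Sum>(x,K)\<in>p. measure lborel K * g x - integral K g\<bar> \<le> e"
proof -
  obtain I where I: "\<forall>e>0. \<exists>d>0. \<forall>D. D tagged_division_of cbox a b \<and> (\<lambda>x. ball x d) fine D \<longrightarrow>
      \<bar>(\<Sum>(x,B)\<in>D. measure lborel B * g x) - I\<bar> < e"
    using assms unfolding riemann_integrable_def by blast
  have hi: "(g has_integral I) (cbox a b)"
    unfolding has_integral
  proof (intro allI impI)
    fix e :: real assume "e > 0"
    with I obtain d where d: "d > 0" "\<forall>D. D tagged_division_of cbox a b \<and> (\<lambda>x. ball x d) fine D \<longrightarrow>
        \<bar>(\<Sum>(x,B)\<in>D. measure lborel B * g x) - I\<bar> < e" by blast
    then show "\<exists>\<gamma>. gauge \<gamma> \<and> (\<forall>\<D>. \<D> tagged_division_of cbox a b \<and> \<gamma> fine \<D> \<longrightarrow>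
        norm ((\<Sum>(x, k)\<in>\<D>. measure lborel k *\<^sub>R g x) - I) < e)"
      by (intro exI[of _ "\<lambda>x. ball x d"] conjI gauge_ball) auto
  qed
  then show int: "g integrable_on {a..b}" by (auto simp: integrable_on_def)
  assume "e > 0"
  with I obtain d where d: "d > 0" "\<forall>D. D tagged_division_of cbox a b \<and> (\<lambda>x. ball x d) fine D \<longrightarrow>
      \<bar>(\<Sum>(x,B)\<in>D. measure lborel B * g x) - I\<bar> < e" by blast
  have "norm (\<Sum>(x,K)\<in>p. measure lborel K *\<^sub>R g x - integral K g) \<le> e"
    if "p tagged_partial_division_of {a..b}" "(\<lambda>x. ball x d) fine p" for p
    using that int \<open>e > 0\<close> d integral_unique[OF hi]
    by (intro Henstock_lemma_part1[where a=a and b=b and d="\<lambda>x. ball x d"]) (auto intro: gauge_ball)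
  then show "\<exists>d>0. \<forall>p. p tagged_partial_division_of {a..b} \<and> (\<lambda>x. ball x d) fine p \<longrightarrow>
      \<bar>\<Sum>(x,K)\<in>p. measure lborel K * g x - integral K g\<bar> \<le> e"
    using d(1) by (intro exI[of _ d]) auto
qed

lemma uniform_cell:
  fixes a b x :: real
  assumes "a \<le> x" "x < b" "0 < n"
  obtains j where "j < n" "x \<in> {a + real j * ((b - a) / real n)..<a + real (Suc j) * ((b - a) / real n)}"
proof -
  define l where "l = (b - a) / real n"
  have l: "l > 0" using assms by (simp add: l_def)
  define j where "j = nat \<lfloor>(x - a) / l\<rfloor>"
  have "0 \<le> (x - a) / l" using assms l by simp
  then have 1: "real j \<le> (x - a) / l" "(x - a) / l < real j + 1"
    unfolding j_def by linarith+
  then have 2: "real j * l \<le> x - a" "x - a < (real j + 1) * l"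
    using l by (simp_all add: field_simps)
  have "(x - a) / l < real n" using assms l by (simp add: l_def field_simps)
  with 1 have "j < n" by linarith
  with 2 show ?thesis using that[of j] unfolding l_def by (auto simp: algebra_simps)
qed

text \<open>A single tagged cell already obeys the Henstock estimate. Since the mesh bound does not
  depend on the tag, every point of the cell may be its tag, so \<open>g x / n\<close> differs from
  the fixed cell integral by at most 1.\<close>

lemma riemann_integrable_bounded:
  fixes g :: "real \<Rightarrow> real"
  assumes "riemann_integrable g 0 1"
  shows "\<exists>B>0. \<forall>x\<in>{0..<1}. \<bar>g x\<bar> \<le> B"
proof -
  obtain d where d: "d > 0" and H: "\<And>p. p tagged_partial_division_of {0..1} \<Longrightarrow> (\<lambda>x. ball x d) fine p \<Longrightarrow>
      \<bar>\<Sum>(x,K)\<in>p. measure lborel K * g x - integral K g\<bar> \<le> 1"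
    using riemann_integrable_Henstock(2)[OF assms, of 1] by auto
  obtain n :: nat where n: "n > 0" "1 / real n < d" using d by (metis nat_approx_posE zero_less_Suc)
  define J where "J j = {0 + real j * ((1 - 0) / real n)..0 + real (Suc j) * ((1 - 0) / real n)}" for j
  define B where "B = 1 + (\<Sum>j<n. real n * (1 + \<bar>integral (J j) g\<bar>))"
  have "\<bar>g x\<bar> \<le> B" if x: "x \<in> {0..<1}" for x
  proof -
    obtain j where j: "j < n" "x \<in> {0 + real j * ((1 - 0) / real n)..<0 + real (Suc j) * ((1 - 0) / real n)}"
      using uniform_cell[of 0 x 1 n] x n by auto
    have xJ: "x \<in> J j" using j by (auto simp: J_def)
    have cJ: "measure lborel (J j) = 1 / real n" using n by (simp add: J_def field_simps)
    have "J j \<subseteq> {0..1}"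
      using n j by (auto simp: J_def field_simps intro: order_trans)
    then have p: "{(x, J j)} tagged_partial_division_of {0..1}"
      using xJ by (auto simp: tagged_partial_division_of_def J_def)
    have "J j \<subseteq> ball x d"
    proof
      fix y assume "y \<in> J j"
      moreover have "real (Suc j) * (1 / real n) = real j * (1 / real n) + 1 / real n" by (simp add: add_divide_distrib)
      ultimately have "\<bar>x - y\<bar> \<le> 1 / real n" using xJ by (simp add: J_def abs_le_iff)
      then show "y \<in> ball x d" using n(2) by (simp add: dist_real_def)
    qed
    then have "(\<lambda>x. ball x d) fine {(x, J j)}" by (auto simp: fine_def)
    from H[OF p this] have "\<bar>g x / real n - integral (J j) g\<bar> \<le> 1" by (simp add: cJ)
    then have "\<bar>g x\<bar> / real n \<le> 1 + \<bar>integral (J j) g\<bar>" using n by (auto simp: abs_if split: if_splits)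
    then have "\<bar>g x\<bar> \<le> real n * (1 + \<bar>integral (J j) g\<bar>)" using n by (simp add: field_simps)
    also have "\<dots> \<le> (\<Sum>j<n. real n * (1 + \<bar>integral (J j) g\<bar>))"
      using j by (intro member_le_sum) auto
    finally show ?thesis by (simp add: B_def)
  qed
  moreover have "B > 0" unfolding B_def by (intro add_pos_nonneg sum_nonneg) auto
  ultimately show ?thesis by blast
qed

text \<open>Each cell is tagged where \<open>g\<close> nearly attains its supremum; for a constant
  gauge fineness concerns only the cell length, so such tags are admissible. The cells of [a, b] are
  used as a partial division of [0, 1], which spares a proof of Riemann integrability on the
  subinterval.\<close>

lemma riemann_upper_sum:
  fixes g :: "real \<Rightarrow> real"
  assumes g: "riemann_integrable g 0 1" and ab: "0 \<le> a" "a < b" "b \<le> 1" and e: "e > 0"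
    and bdd: "\<And>x. x \<in> {0..<1} \<Longrightarrow> g x \<le> B"
  shows "\<exists>n G. 0 < n \<and>
    (\<forall>j<n. \<forall>x\<in>{a + real j * ((b - a) / real n)..<a + real (Suc j) * ((b - a) / real n)}. g x \<le> G j) \<and>
    (\<Sum>j<n. G j * ((b - a) / real n)) \<le> integral {a..b} g + e"
proof -
  obtain d where d: "d > 0" and H: "\<And>p. p tagged_partial_division_of {0..1} \<Longrightarrow> (\<lambda>x. ball x d) fine p \<Longrightarrow>
      \<bar>\<Sum>(x,K)\<in>p. measure lborel K * g x - integral K g\<bar> \<le> e / 2"
    using riemann_integrable_Henstock(2)[OF g, of "e / 2"] e by auto
  obtain n :: nat where n: "n > 0" "1 / real n < d" using d by (metis nat_approx_posE zero_less_Suc)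
  define l where "l = (b - a) / real n"
  have l: "l > 0" "l < d" "real n * l = b - a"
  proof -
    have "(b - a) / real n \<le> 1 / real n" using ab n by (intro divide_right_mono) auto
    then show "l > 0" "l < d" "real n * l = b - a" using ab n by (auto simp: l_def)
  qed
  define u where "u j = a + real j * l" for j :: nat
  have umono: "u i \<le> u j" if "i \<le> j" for i j using that l by (simp add: u_def mult_right_mono)
  have uS: "u (Suc j) = u j + l" for j by (simp add: u_def algebra_simps)
  have un: "u n = b" "u 0 = a" using l by (simp_all add: u_def)
  define G where "G j = (SUP x\<in>{u j..<u (Suc j)}. g x)" for j
  have sub: "{u j..<u (Suc j)} \<subseteq> {0..<1}" "{u j..u (Suc j)} \<subseteq> {a..b}" if "j < n" for j
    using umono[of 0 j] umono[of "Suc j" n] un ab that by (auto simp: Suc_le_eq)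
  have bd: "bdd_above (g ` {u j..<u (Suc j)})" if "j < n" for j
    using sub[OF that] bdd by (auto intro!: bdd_aboveI[of _ B])
  have "\<exists>x\<in>{u j..<u (Suc j)}. G j - e / 2 < g x" if "j < n" for j
    unfolding G_def using less_cSUP_iff[OF _ bd[OF that], of "G j - e / 2"] l uS[of j] e
    by (auto simp: G_def)
  \<comment> \<open>Half of \<open>e\<close> pays for missing the suprema, over a total length of at
    most 1; the other half is the Henstock error.\<close>
  then obtain \<tau> where \<tau>: "\<And>j. j < n \<Longrightarrow> \<tau> j \<in> {u j..<u (Suc j)} \<and> G j - e / 2 < g (\<tau> j)" by metis
  define K where "K j = {u j..u (Suc j)}" for j
  have inj: "inj_on (\<lambda>j. (\<tau> j, K j)) {..<n}"
  proof (rule inj_onI)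
    fix i j assume "(\<tau> i, K i) = (\<tau> j, K j)"
    then have "u i = u j" using uS[of i] uS[of j] l by (auto simp: K_def Icc_eq_Icc)
    then show "i = j" using l by (simp add: u_def)
  qed
  have p: "(\<lambda>j. (\<tau> j, K j)) ` {..<n} tagged_partial_division_of {0..1}"
    unfolding tagged_partial_division_of_def
  proof (intro conjI allI impI)
    fix x M assume *: "(x, M) \<in> (\<lambda>j. (\<tau> j, K j)) ` {..<n}"
    then show "x \<in> M" "M \<subseteq> {0..1}" using \<tau> sub(2) ab by (force simp: K_def)+
    show "\<exists>a b. M = cbox a b" using * by (auto simp: K_def)
  next
    fix x1 K1 x2 K2 assume "(x1, K1) \<in> (\<lambda>j. (\<tau> j, K j)) ` {..<n} \<and> (x2, K2) \<in> (\<lambda>j. (\<tau> j, K j)) ` {..<n} \<and>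
      (x1, K1) \<noteq> (x2, K2)"
    then obtain i j where ij: "K1 = K i" "K2 = K j" "i \<noteq> j" by blast
    have "u (Suc i) \<le> u j \<or> u (Suc j) \<le> u i" using ij(3) umono[of "Suc i" j] umono[of "Suc j" i] by linarith
    then show "interior K1 \<inter> interior K2 = {}" by (auto simp: ij K_def)
  qed simp
  have f: "(\<lambda>x. ball x d) fine (\<lambda>j. (\<tau> j, K j)) ` {..<n}"
  proof -
    have "K j \<subseteq> ball (\<tau> j) d" if "j < n" for j
      using \<tau>[OF that] l uS[of j] by (auto simp: K_def dist_real_def abs_if)
    then show ?thesis by (auto simp: fine_def)
  qed
  have gi: "g integrable_on {a..b}"
    using riemann_integrable_Henstock(1)[OF g] ab by (elim integrable_on_subinterval) auto
  have int: "(\<Sum>j<k. integral (K j) g) = integral {a..u k} g" if "k \<le> n" for k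
    using that
  proof (induction k)
    case (Suc k)
    have "integral {a..u k} g + integral {u k..u (Suc k)} g = integral {a..u (Suc k)} g"
    proof (rule Henstock_Kurzweil_Integration.integral_combine)
      show "a \<le> u k" "u k \<le> u (Suc k)" using umono[of 0 k] umono[of k "Suc k"] un by auto
      show "g integrable_on {a..u (Suc k)}"
        using gi umono[of "Suc k" n] un Suc.prems by (elim integrable_on_subinterval) auto
    qed
    then show ?case using Suc by (simp add: K_def)
  qed (simp add: un)
  have "(\<Sum>(x,K)\<in>(\<lambda>j. (\<tau> j, K j)) ` {..<n}. measure lborel K * g x - integral K g)
      = (\<Sum>j<n. l * g (\<tau> j)) - integral {a..b} g"
    using l uS int[of n] un by (subst sum.reindex[OF inj]) (simp add: sum_subtractf K_def)
  with H[OF p f] have 1: "(\<Sum>j<n. l * g (\<tau> j)) \<le> integral {a..b} g + e / 2" by linarith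
  have "(\<Sum>j<n. G j * l) \<le> (\<Sum>j<n. l * g (\<tau> j) + l * (e / 2))"
  proof (rule sum_mono)
    fix j assume "j \<in> {..<n}"
    then have "G j \<le> g (\<tau> j) + e / 2" using \<tau>[of j] by auto
    then show "G j * l \<le> l * g (\<tau> j) + l * (e / 2)"
      using l(1) by (metis distrib_left mult.commute mult_left_mono less_imp_le)
  qed
  also have "\<dots> = (\<Sum>j<n. l * g (\<tau> j)) + (b - a) * (e / 2)"
    using l(3) by (simp add: sum.distrib)
  also have "\<dots> \<le> (\<Sum>j<n. l * g (\<tau> j)) + 1 * (e / 2)"
    using ab e by (intro add_left_mono mult_right_mono) auto
  finally have "(\<Sum>j<n. G j * l) \<le> integral {a..b} g + e" using 1 by simp
  moreover have "\<forall>j<n. \<forall>x\<in>{u j..<u (Suc j)}. g x \<le> G j"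
    unfolding G_def using bd by (auto intro!: cSUP_upper)
  ultimately show ?thesis using n(1) by (intro exI[of _ n] exI[of _ G]) (simp add: u_def l_def)
qed

lemma sum_UN_le:
  fixes f :: "'b \<Rightarrow> real"
  assumes "finite I" "\<And>i. i \<in> I \<Longrightarrow> finite (A i)" "\<And>x. 0 \<le> f x"
  shows "sum f (\<Union>i\<in>I. A i) \<le> (\<Sum>i\<in>I. sum f (A i))"
  using assms(1,2)
proof (induction I rule: finite_induct)
  case (insert i I)
  have "sum f (A i \<union> (\<Union>i\<in>I. A i)) \<le> sum f (A i) + sum f (\<Union>i\<in>I. A i)"
    using insert assms(3) by (subst sum.union_inter[symmetric]) (auto intro: sum_nonneg)
  then show ?case using insert by auto
qed simp

text \<open>The sum is dominated cell by cell by an upper sum, and the share of points in each of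
  the finitely many cells converges. An upper bound suffices because arrival intensities only have
  to be bounded from above.\<close>

lemma equidistributed_sum_le:
  fixes g :: "real \<Rightarrow> real" and \<phi> :: "nat \<Rightarrow> real" and W :: "nat \<Rightarrow> nat"
  assumes g: "riemann_integrable g 0 1" and g0: "\<And>x. 0 \<le> g x"
    and ab: "0 \<le> a" "a < b" "b \<le> 1" and e: "e > 0"
    and equi: "\<And>E. is_interval E \<Longrightarrow> E \<subseteq> {0..<1} \<Longrightarrow>
        (\<lambda>N. real (card {i\<in>{1..W N}. \<phi> i \<in> E}) / real (W N)) \<longlonglongrightarrow> measure lebesgue E"
    and W: "(\<lambda>N. real (W N) / real N) \<longlonglongrightarrow> \<xi>" and \<xi>: "\<xi> > 0"
  shows "eventually (\<lambda>N. (\<Sum>i | i \<in> {1..W N} \<and> \<phi> i \<in> {a..<b}. g (\<phi> i)) / real N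
            \<le> \<xi> * integral {a..b} g + e) sequentially"
proof -
  obtain B where B: "\<forall>x\<in>{0..<1}. \<bar>g x\<bar> \<le> B" using riemann_integrable_bounded[OF g] by blast
  \<comment> \<open>The upper sum gets multiplied by \<xi>, so this choice leaves a strict gap of
    \<open>e / 2\<close> for the limit in \<open>N\<close>.\<close>
  have e': "e / (2 * \<xi>) > 0" using e \<xi> by simp
  obtain n G where n: "0 < n" and G: "\<And>j x. j < n \<Longrightarrow>
       x \<in> {a + real j * ((b - a) / real n)..<a + real (Suc j) * ((b - a) / real n)} \<Longrightarrow> g x \<le> G j"
     and Gs: "(\<Sum>j<n. G j * ((b - a) / real n)) \<le> integral {a..b} g + e / (2 * \<xi>)"
    using riemann_upper_sum[OF g ab e', of B] B by (metis abs_le_D1)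
  define J where "J j = {a + real j * ((b - a) / real n)..<a + real (Suc j) * ((b - a) / real n)}" for j
  have J: "J j \<subseteq> {a..<b}" if "j < n" for j
  proof -
    have "real (Suc j) * ((b - a) / real n) \<le> real n * ((b - a) / real n)"
      using that ab by (intro mult_right_mono) auto
    then show ?thesis using ab n by (auto simp: J_def)
  qed
  have mJ: "measure lebesgue (J j) = (b - a) / real n" for j
  proof -
    have "a + real j * ((b - a) / real n) \<le> a + real (Suc j) * ((b - a) / real n)"
      using ab by (intro add_left_mono mult_right_mono) auto
    moreover have "measure lebesgue {p..<q} = q - p" if "p \<le> q" for p q :: real using that by simp
    moreover have "a + real (Suc j) * l - (a + real j * l) = l" for l
      by (simp add: algebra_simps)
    ultimately show ?thesis by (simp only: J_def)
  qed
  define c where "c N j = real (card {i\<in>{1..W N}. \<phi> i \<in> J j}) / real N" for N j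
  have c: "(\<lambda>N. c N j) \<longlonglongrightarrow> (b - a) / real n * \<xi>" if "j < n" for j
  proof -
    have "(\<lambda>N. real (card {i\<in>{1..W N}. \<phi> i \<in> J j}) / real (W N) * (real (W N) / real N))
        \<longlonglongrightarrow> measure lebesgue (J j) * \<xi>"
      using equi[of "J j"] J[OF that] ab W by (intro tendsto_mult) (auto simp: J_def is_interval_co)
    moreover have "real (card {i\<in>{1..W N}. \<phi> i \<in> J j}) / real (W N) * (real (W N) / real N) = c N j" for N
      by (cases "W N = 0") (auto simp: c_def)
    ultimately show ?thesis by (simp add: mJ)
  qed
  have "(\<lambda>N. \<Sum>j<n. G j * c N j) \<longlonglongrightarrow> (\<Sum>j<n. G j * ((b - a) / real n * \<xi>))"
    using c by (intro tendsto_sum tendsto_mult) auto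
  moreover have "(\<Sum>j<n. G j * ((b - a) / real n * \<xi>)) < \<xi> * integral {a..b} g + e"
  proof -
    have "(\<Sum>j<n. G j * ((b - a) / real n * \<xi>)) = \<xi> * (\<Sum>j<n. G j * ((b - a) / real n))"
      by (simp add: sum_distrib_left mult_ac)
    also have "\<dots> \<le> \<xi> * (integral {a..b} g + e / (2 * \<xi>))" using Gs \<xi> by simp
    also have "\<dots> < \<xi> * integral {a..b} g + e" using \<xi> e by (simp add: field_simps)
    finally show ?thesis .
  qed
  ultimately have ev: "eventually (\<lambda>N. (\<Sum>j<n. G j * c N j) < \<xi> * integral {a..b} g + e) sequentially"
    by (rule order_tendstoD)
  have "(\<Sum>i | i \<in> {1..W N} \<and> \<phi> i \<in> {a..<b}. g (\<phi> i)) / real N \<le> (\<Sum>j<n. G j * c N j)" for N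
  proof -
    have sub: "{i. i \<in> {1..W N} \<and> \<phi> i \<in> {a..<b}} \<subseteq> (\<Union>j<n. {i\<in>{1..W N}. \<phi> i \<in> J j})"
    proof
      fix i assume "i \<in> {i. i \<in> {1..W N} \<and> \<phi> i \<in> {a..<b}}"
      then show "i \<in> (\<Union>j<n. {i\<in>{1..W N}. \<phi> i \<in> J j})"
        using uniform_cell[of a "\<phi> i" b n] n by (auto simp: J_def)
    qed
    have "(\<Sum>i | i \<in> {1..W N} \<and> \<phi> i \<in> {a..<b}. g (\<phi> i))
        \<le> (\<Sum>i\<in>(\<Union>j<n. {i\<in>{1..W N}. \<phi> i \<in> J j}). g (\<phi> i))"
      using sub g0 by (intro sum_mono2) auto
    also have "\<dots> \<le> (\<Sum>j<n. \<Sum>i\<in>{i\<in>{1..W N}. \<phi> i \<in> J j}. g (\<phi> i))"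
      using g0 by (intro sum_UN_le) auto
    also have "\<dots> \<le> (\<Sum>j<n. \<Sum>i\<in>{i\<in>{1..W N}. \<phi> i \<in> J j}. G j)"
      using G by (intro sum_mono) (auto simp: J_def)
    finally show ?thesis
      by (auto simp: c_def sum_divide_distrib[symmetric] mult.commute dest!: divide_right_mono[where c="real N"])
  qed
  then show ?thesis using ev by (auto elim!: eventually_mono intro: less_imp_le order_trans)
qed

section \<open>Independence and second moments\<close>

text \<open>Coordinates outside \<open>J\<close> are filled with 0, so that restrictions to
  different families are points of one space and the same functionals (arrival times, assignment,
  noise) can be evaluated on all of them.\<close>

definition config :: "'a lb_system \<Rightarrow> primitive set \<Rightarrow> 'a \<Rightarrow> primitive \<Rightarrow> real" where
  "config S J \<omega> = (\<lambda>p. if p \<in> J then prim_var S p \<omega> else 0)"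

abbreviation configs :: "(primitive \<Rightarrow> real) measure" where
  "configs \<equiv> PiM UNIV (\<lambda>_. borel)"

lemma measurable_config_extend:
  "(\<lambda>x p. if p \<in> J then x p else 0) \<in> PiM J (\<lambda>_. borel) \<rightarrow>\<^sub>M configs"
proof (rule measurable_PiM_single')
  show "(\<lambda>x. if p \<in> J then x p else 0) \<in> borel_measurable (PiM J (\<lambda>_. borel))" for p
    by (cases "p \<in> J") auto
qed auto

lemma config_eq_extend:
  "config S J = (\<lambda>x p. if p \<in> J then x p else 0) \<circ> (\<lambda>\<omega>. restrict (\<lambda>p. prim_var S p \<omega>) J)"
  by (auto simp: config_def fun_eq_iff)

lemma (in prob_space) indep_config:
  assumes "indep_vars (\<lambda>_. borel) (prim_var S) J" "A \<inter> B = {}" "A \<subseteq> J" "B \<subseteq> J"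
  shows "indep_var configs (config S A) configs (config S B)"
  unfolding config_eq_extend
  by (intro indep_var_compose[OF indep_var_restrict[OF assms]] measurable_config_extend)

text \<open>Fubini with the past \<open>X\<close> frozen: the threshold \<open>g\<close> becomes a
  constant, and the exponential tail is the mean of the indicator. Thresholds may be negative,
  whence \<open>max 0\<close>; a positive variable exceeds them almost surely.\<close>

lemma (in prob_space) expectation_exponential_centred:
  assumes ind: "indep_var L Z N X" and U: "distributed M lborel (\<lambda>\<omega>. u (Z \<omega>)) (exponential_density r)" and r: "0 < r"
    and [measurable]: "u \<in> borel_measurable L" "w \<in> borel_measurable N" "g \<in> borel_measurable N" and w: "\<And>x. \<bar>w x\<bar> \<le> c"
  shows "expectation (\<lambda>\<omega>. w (X \<omega>) * (of_bool (g (X \<omega>) < u (Z \<omega>)) - exp (- r * max 0 (g (X \<omega>))))) = 0"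
proof -
  have Z[measurable]: "Z \<in> M \<rightarrow>\<^sub>M L" and [measurable]: "X \<in> M \<rightarrow>\<^sub>M N"
    using indep_var_rv1[OF ind] indep_var_rv2[OF ind] by auto
  interpret DU: prob_space "distr M L Z" by (rule prob_space_distr) simp
  interpret DX: prob_space "distr M N X" by (rule prob_space_distr) simp
  interpret P: pair_prob_space "distr M L Z" "distr M N X" ..
  define F where "F z = w (snd z) * (of_bool (g (snd z) < u (fst z)) - exp (- r * max 0 (g (snd z))))" for z
  have [measurable]: "F \<in> borel_measurable (L \<Otimes>\<^sub>M N)" unfolding F_def by measurable
  have F': "\<bar>F z\<bar> \<le> c" for z
  proof -
    have "\<bar>of_bool (g (snd z) < u (fst z)) - exp (- r * max 0 (g (snd z)))\<bar> \<le> 1"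
    proof -
      have "0 \<le> exp (- r * max 0 (g (snd z)))" "exp (- r * max 0 (g (snd z))) \<le> 1" using r by auto
      then show ?thesis by (auto simp: abs_le_iff simp del: exp_le_one_iff intro: order_trans[of _ 0])
    qed
    then show ?thesis unfolding F_def abs_mult
      using mult_mono[OF w[of "snd z"], of _ 1] order_trans[OF abs_ge_zero w] by simp
  qed
  have tail: "measure (distr M L Z) {z\<in>space L. t < u z} = exp (- r * max 0 t)" for t
  proof -
    have "measure (distr M L Z) {z\<in>space L. t < u z} = \<P>(\<omega> in M. t < u (Z \<omega>))"
      by (subst measure_distr) (auto intro!: arg_cong[where f=prob] intro: measurable_space[OF Z])
    also have "\<dots> = exp (- r * max 0 t)"
    proof (cases "t \<ge> 0")
      case True then show ?thesis using exponential_distributedD_gt[OF U True r] by (simp add: mult.commute)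
    next
      case False
      have "\<P>(\<omega> in M. 0 < u (Z \<omega>)) = 1" using exponential_distributedD_gt[OF U _ r, of 0] by simp
      moreover have "\<P>(\<omega> in M. 0 < u (Z \<omega>)) \<le> \<P>(\<omega> in M. t < u (Z \<omega>))"
        using False by (intro finite_measure_mono) auto
      ultimately have "\<P>(\<omega> in M. t < u (Z \<omega>)) = 1" using prob_le_1 by (simp add: antisym)
      then show ?thesis using False by simp
    qed
    finally show ?thesis .
  qed
  have "expectation (\<lambda>\<omega>. F (Z \<omega>, X \<omega>)) = integral\<^sup>L (distr M (L \<Otimes>\<^sub>M N) (\<lambda>\<omega>. (Z \<omega>, X \<omega>))) F"
    by (subst integral_distr) auto
  also have "distr M (L \<Otimes>\<^sub>M N) (\<lambda>\<omega>. (Z \<omega>, X \<omega>)) = distr M L Z \<Otimes>\<^sub>M distr M N X"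
    using ind unfolding indep_var_distribution_eq by simp
  also have "integral\<^sup>L \<dots> F = (\<integral>x. \<integral>z. F (z, x) \<partial>distr M L Z \<partial>distr M N X)"
  proof -
    have "integrable (distr M L Z \<Otimes>\<^sub>M distr M N X) F"
      using F' by (intro P.P.integrable_const_bound[where B=c]) auto
    then have "integrable (distr M L Z \<Otimes>\<^sub>M distr M N X) (case_prod (\<lambda>z x. F (z, x)))" by simp
    from P.integral_snd[OF this] show ?thesis by simp
  qed
  also have "\<dots> = (\<integral>x. 0 \<partial>distr M N X)"
  proof (intro Bochner_Integration.integral_cong refl)
    fix x
    have "(\<integral>z. F (z, x) \<partial>distr M L Z)
        = (\<integral>z. w x * (indicator {z\<in>space L. g x < u z} z - exp (- r * max 0 (g x))) \<partial>distr M L Z)"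
      by (intro Bochner_Integration.integral_cong refl) (auto simp: F_def indicator_def)
    also have "\<dots> = w x * (measure (distr M L Z) {z\<in>space L. g x < u z} - exp (- r * max 0 (g x)))"
    proof -
      have "integrable (distr M L Z) (indicator {z\<in>space L. g x < u z} :: _ \<Rightarrow> real)"
        by (intro integrable_real_indicator) (auto simp: DU.emeasure_eq_measure)
      then show ?thesis by (subst integral_mult_right_zero, subst Bochner_Integration.integral_diff) (auto simp: DU.prob_space[simplified])
    qed
    finally show "(\<integral>z. F (z, x) \<partial>distr M L Z) = 0" by (simp add: tail)
  qed
  finally show ?thesis by (simp add: F_def)
qed

lemma (in prob_space) expectation_square_sum_orthogonal:
  fixes Y :: "'i \<Rightarrow> 'a \<Rightarrow> real"
  assumes "finite I" and int: "\<And>i j. i \<in> I \<Longrightarrow> j \<in> I \<Longrightarrow> integrable M (\<lambda>\<omega>. Y i \<omega> * Y j \<omega>)"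
    and orth: "\<And>i j. i \<in> I \<Longrightarrow> j \<in> I \<Longrightarrow> i \<noteq> j \<Longrightarrow> expectation (\<lambda>\<omega>. Y i \<omega> * Y j \<omega>) = 0"
  shows "integrable M (\<lambda>\<omega>. (\<Sum>i\<in>I. Y i \<omega>)\<^sup>2)"
    and "expectation (\<lambda>\<omega>. (\<Sum>i\<in>I. Y i \<omega>)\<^sup>2) = (\<Sum>i\<in>I. expectation (\<lambda>\<omega>. (Y i \<omega>)\<^sup>2))"
proof -
  have eq: "(\<Sum>i\<in>I. Y i \<omega>)\<^sup>2 = (\<Sum>i\<in>I. \<Sum>j\<in>I. Y i \<omega> * Y j \<omega>)" for \<omega>
    by (simp add: power2_eq_square sum_product)
  show "integrable M (\<lambda>\<omega>. (\<Sum>i\<in>I. Y i \<omega>)\<^sup>2)"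
    unfolding eq using int by (intro Bochner_Integration.integrable_sum) auto
  have "expectation (\<lambda>\<omega>. (\<Sum>i\<in>I. Y i \<omega>)\<^sup>2) = (\<Sum>i\<in>I. \<Sum>j\<in>I. expectation (\<lambda>\<omega>. Y i \<omega> * Y j \<omega>))"
    unfolding eq using int by (simp add: Bochner_Integration.integral_sum)
  also have "\<dots> = (\<Sum>i\<in>I. \<Sum>j\<in>I. if i = j then expectation (\<lambda>\<omega>. (Y i \<omega>)\<^sup>2) else 0)"
    using orth by (intro sum.cong) (auto simp: power2_eq_square)
  also have "\<dots> = (\<Sum>i\<in>I. expectation (\<lambda>\<omega>. (Y i \<omega>)\<^sup>2))"
    using assms(1) by simp
  finally show "expectation (\<lambda>\<omega>. (\<Sum>i\<in>I. Y i \<omega>)\<^sup>2) = (\<Sum>i\<in>I. expectation (\<lambda>\<omega>. (Y i \<omega>)\<^sup>2))" .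
qed

lemma (in prob_space) prob_gt_le_second_moment:
  assumes "integrable M (\<lambda>\<omega>. (f \<omega>)\<^sup>2)" "f \<in> borel_measurable M" "0 < d"
    and "expectation (\<lambda>\<omega>. (f \<omega>)\<^sup>2) \<le> v"
  shows "\<P>(\<omega> in M. d \<le> f \<omega>) \<le> v / d\<^sup>2"
proof -
  have "\<P>(\<omega> in M. d \<le> f \<omega>) \<le> \<P>(\<omega> in M. d\<^sup>2 \<le> (f \<omega>)\<^sup>2)"
    using assms by (intro finite_measure_mono) (auto intro: power_mono)
  also have "\<dots> \<le> expectation (\<lambda>\<omega>. (f \<omega>)\<^sup>2) / d\<^sup>2"
    using assms by (intro integral_Markov_inequality_measure[where A="{}"]) auto
  also have "\<dots> \<le> v / d\<^sup>2" using assms by (intro divide_right_mono) auto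
  finally show ?thesis .
qed

text \<open>The weights \<open>2 * n + 1\<close> are the increments of the squares. Applied to
  indicators of successive arrivals, this bounds the second moment of an arrival count by a weighted
  sum of single arrival probabilities.\<close>

lemma square_sum_le_weighted:
  fixes a :: "nat \<Rightarrow> real"
  assumes "\<And>n. 0 \<le> a n" "\<And>n. a n \<le> 1"
  shows "(\<Sum>n<L. a n)\<^sup>2 \<le> (\<Sum>n<L. (2 * real n + 1) * a n)"
proof (induction L)
  case (Suc L)
  have "(\<Sum>n<L. a n) \<le> real L" using sum_bounded_above[of "{..<L}" a 1] assms by simp
  then have "2 * (\<Sum>n<L. a n) * a L \<le> 2 * real L * a L" using assms(1)[of L] by (intro mult_right_mono) auto
  moreover have "(a L)\<^sup>2 \<le> a L" using assms by (simp add: power2_eq_square mult_left_le)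
  ultimately show ?case using Suc by (simp add: power2_sum algebra_simps)
qed simp

section \<open>The assignment as a function of the primitives\<close>

definition arr :: "(primitive \<Rightarrow> real) \<Rightarrow> task \<Rightarrow> real" where
  "arr x k = (\<Sum>l\<le>snd k. x (Interarrival (fst k, l)))"

text \<open>Here \<open>c\<close> is a tentative solution of the recursion, giving each task its
  server and its departure time. At the true solution this is \<open>ahead\<close>, restricted to
  \<open>F\<close>.\<close>

definition earlier_at ::
  "task set \<Rightarrow> (primitive \<Rightarrow> real) \<Rightarrow> (task \<Rightarrow> nat \<times> real) \<Rightarrow> nat \<Rightarrow> task \<Rightarrow> task set" where
  "earlier_at F x c j k = {l\<in>F. fst (c l) = j \<and> arr x l < arr x k \<and> arr x k < snd (c l)}"

text \<open>The floor recovers the natural number which \<open>prim_var\<close> embeds into the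
  reals.\<close>

definition candidates ::
  "load_model \<Rightarrow> regime \<Rightarrow> nat \<Rightarrow> task set \<Rightarrow> (primitive \<Rightarrow> real) \<Rightarrow> (task \<Rightarrow> nat \<times> real) \<Rightarrow> task \<Rightarrow> nat set" where
  "candidates Q R N F x c k =
     (let V = serv_class Q R N (nat \<lfloor>x (Target k)\<rfloor>); I = {j\<in>V. earlier_at F x c j k = {}}
      in if I \<noteq> {} then I else V)"

definition jiq_step ::
  "load_model \<Rightarrow> regime \<Rightarrow> nat \<Rightarrow> task set \<Rightarrow> (primitive \<Rightarrow> real) \<Rightarrow> (task \<Rightarrow> nat \<times> real) \<Rightarrow> task \<Rightarrow> nat \<times> real" where
  "jiq_step Q R N F x c k =
     (let j = nat \<lfloor>x (Pick k (candidates Q R N F x c k))\<rfloor>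
      in (j, Max (insert (arr x k) ((\<lambda>l. snd (c l)) ` earlier_at F x c j k)) + x (Service k j)))"

text \<open>
  Only strictly earlier tasks enter the two recursive equations, so iterating them once more than
  there are tasks in \<open>F\<close> reaches their solution from any start.  Unlike the solution itself, the
  iterates are visibly measurable in the primitives.
\<close>

primrec jiq_iter ::
  "load_model \<Rightarrow> regime \<Rightarrow> nat \<Rightarrow> task set \<Rightarrow> (primitive \<Rightarrow> real) \<Rightarrow> nat \<Rightarrow> task \<Rightarrow> nat \<times> real" where
  "jiq_iter Q R N F x 0 = (\<lambda>_. (0, 0))"
| "jiq_iter Q R N F x (Suc n) = jiq_step Q R N F x (jiq_iter Q R N F x n)"

definition jiq_assign ::
  "load_model \<Rightarrow> regime \<Rightarrow> nat \<Rightarrow> task set \<Rightarrow> (primitive \<Rightarrow> real) \<Rightarrow> task \<Rightarrow> nat" where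
  "jiq_assign Q R N F x k = fst (jiq_iter Q R N F x (Suc (card F)) k)"

lemma serv_class_subset: "serv_class Q R N m \<subseteq> {1..N}"
  by (auto simp: serv_class_def)

lemma candidates_subset: "candidates Q R N F x c k \<subseteq> {1..N}"
  using serv_class_subset[of Q R N] unfolding candidates_def Let_def by auto

text \<open>The configurations may differ only in the service times of task \<open>l\<close>. A task
  looks only at strictly earlier ones, so its server is unaffected even if it is \<open>l\<close>
  itself or arrives at the same time. Its departure contains its own service time, and strict
  precedence rules out \<open>l\<close>. Both claims go through one induction, since servers depend
  on the departures of earlier tasks.\<close>

lemma jiq_iter_local:
  assumes "\<And>p. (\<forall>j. p \<noteq> Service l j) \<Longrightarrow> x p = y p"
  shows "arr x k = arr y k"
    and "(arr x k \<le> arr x l \<longrightarrow> fst (jiq_iter Q R N F x n k) = fst (jiq_iter Q R N F y n k)) \<and>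
         (arr x k < arr x l \<longrightarrow> jiq_iter Q R N F x n k = jiq_iter Q R N F y n k)"
proof -
  show arr: "arr x k = arr y k" for k unfolding arr_def using assms by simp
  show "(arr x k \<le> arr x l \<longrightarrow> fst (jiq_iter Q R N F x n k) = fst (jiq_iter Q R N F y n k)) \<and>
        (arr x k < arr x l \<longrightarrow> jiq_iter Q R N F x n k = jiq_iter Q R N F y n k)"
  proof (induction n arbitrary: k)
    case (Suc n)
    let ?c = "jiq_iter Q R N F x n" and ?d = "jiq_iter Q R N F y n"
    have e: "earlier_at F x ?c j k = earlier_at F y ?d j k" if "arr x k \<le> arr x l" for j
      using that Suc.IH arr unfolding earlier_at_def by (auto simp: less_le_trans)
    have cand: "candidates Q R N F x ?c k = candidates Q R N F y ?d k" if "arr x k \<le> arr x l"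
      using e[OF that] assms unfolding candidates_def by simp
    have pick: "x (Pick k B) = y (Pick k B)" for B using assms by simp
    have "jiq_iter Q R N F x (Suc n) k = jiq_iter Q R N F y (Suc n) k" if "arr x k < arr x l"
    proof -
      have "k \<noteq> l" using that by auto
      then have s: "x (Service k j) = y (Service k j)" for j using assms by simp
      have m: "(\<lambda>i. snd (?c i)) ` earlier_at F x ?c j k = (\<lambda>i. snd (?d i)) ` earlier_at F x ?c j k" for j
        using Suc.IH that by (intro image_cong refl) (auto simp: earlier_at_def intro: less_trans)
      show ?thesis
        unfolding jiq_iter.simps jiq_step_def Let_def m
        using e cand pick s arr that by simp
    qed
    then show ?case using cand pick by (auto simp: jiq_step_def Let_def)
  qed simp
qed

lemma jiq_assign_local:
  assumes "\<And>p. (\<forall>j. p \<noteq> Service l j) \<Longrightarrow> x p = y p" "arr x k \<le> arr x l"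
  shows "jiq_assign Q R N F x k = jiq_assign Q R N F y k"
  using jiq_iter_local(2)[of l x y k Q R N F "Suc (card F)"] assms unfolding jiq_assign_def by blast

lemma tasks_prefix: "(i, n) \<in> tasks Q N \<Longrightarrow> (i, l) \<in> tasks Q N"
  by (auto simp: tasks_def)

lemma arr_config:
  assumes "k \<in> tasks Q N" "Interarrival ` tasks Q N \<subseteq> J"
  shows "arr (config S J \<omega>) k = arrival S k \<omega>"
  unfolding arr_def arrival_def
  using assms tasks_prefix[of "fst k" "snd k" Q N] by (intro sum.cong) (auto simp: config_def)

text \<open>After \<open>n\<close> rounds the iterate is right for every task with fewer than
  \<open>n\<close> predecessors in \<open>F\<close>, because its predecessors have fewer still and
  were right one round before. \<open>F\<close> has to contain every task up to \<open>T\<close>, or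
  a busy server could look idle. The rate and class hypotheses ensure that the consulted picks and
  service times are primitives; \<open>config\<close> returns 0 elsewhere.\<close>

lemma jiq_iter_correct:
  assumes "finite F" "F \<subseteq> tasks Q N"
    and rec: "\<And>k. k \<in> tasks Q N \<Longrightarrow> jiq_assignment Q R N S k \<omega> \<and> fcfs_departure Q N S k \<omega>"
    and pick: "\<And>k B. k \<in> tasks Q N \<Longrightarrow> B \<subseteq> {1..N} \<Longrightarrow> B \<noteq> {} \<Longrightarrow> pick S k B \<omega> \<in> B"
    and V: "\<And>k. k \<in> tasks Q N \<Longrightarrow> serv_class Q R N (target S k \<omega>) \<noteq> {}"
    and rate: "\<And>k j. k \<in> tasks Q N \<Longrightarrow> j \<in> serv_class Q R N (target S k \<omega>) \<Longrightarrow> 0 < serv_rate Q (fst k) j"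
    and F: "\<And>k. k \<in> tasks Q N \<Longrightarrow> arrival S k \<omega> \<le> T \<Longrightarrow> k \<in> F"
    and k: "k \<in> tasks Q N" "arrival S k \<omega> \<le> T"
  shows "jiq_assign Q R N F (config S (primitives Q N) \<omega>) k = assigned S k \<omega>"
proof -
  define x where "x = config S (primitives Q N) \<omega>"
  have arr: "arr x k = arrival S k \<omega>" if "k \<in> tasks Q N" for k
    unfolding x_def using that by (intro arr_config) (auto simp: primitives_def)
  have "jiq_iter Q R N F x n k = (assigned S k \<omega>, departure S k \<omega>)"
    if "k \<in> tasks Q N" "arrival S k \<omega> \<le> T" "card {l\<in>F. arr x l < arr x k} < n" for n k
    using that
  proof (induction n arbitrary: k)
    case (Suc n)
    let ?c = "jiq_iter Q R N F x n"
    have c: "?c l = (assigned S l \<omega>, departure S l \<omega>)" if l: "l \<in> F" "arr x l < arr x k" for l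
    proof (rule Suc.IH)
      show "l \<in> tasks Q N" using l assms(2) by auto
      then show "arrival S l \<omega> \<le> T" using arr[of l] arr[OF Suc.prems(1)] l Suc.prems(2) by simp
      have "card {l'\<in>F. arr x l' < arr x l} < card {l'\<in>F. arr x l' < arr x k}"
        using l assms(1) by (intro psubset_card_mono) auto
      then show "card {l'\<in>F. arr x l' < arr x l} < n" using Suc.prems(3) by simp
    qed
    have e: "earlier_at F x ?c j k = ahead Q N S j k \<omega>" for j
    proof (intro set_eqI iffI)
      fix l assume "l \<in> earlier_at F x ?c j k"
      then show "l \<in> ahead Q N S j k \<omega>"
        using c[of l] arr[of l] arr[OF Suc.prems(1)] assms(2) by (auto simp: earlier_at_def ahead_def)
    next
      fix l assume l: "l \<in> ahead Q N S j k \<omega>"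
      then have "l \<in> F" using F[of l] Suc.prems(2) by (auto simp: ahead_def)
      then show "l \<in> earlier_at F x ?c j k"
        using l c[of l] arr[of l] arr[OF Suc.prems(1)] by (auto simp: earlier_at_def ahead_def)
    qed
    have target: "nat \<lfloor>x (Target k)\<rfloor> = target S k \<omega>"
      using Suc.prems(1) by (auto simp: x_def config_def primitives_def)
    define B where "B = candidates Q R N F x ?c k"
    have B: "B = (let V = serv_class Q R N (target S k \<omega>); I = {j\<in>V. ahead Q N S j k \<omega> = {}}
      in if I \<noteq> {} then I else V)"
      by (simp add: B_def candidates_def e target)
    have BV: "B \<noteq> {}" "B \<subseteq> serv_class Q R N (target S k \<omega>)"
      using V[OF Suc.prems(1)] by (auto simp: B Let_def split: if_splits)
    have BN: "B \<subseteq> {1..N}" using BV(2) serv_class_subset by blast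
    have j: "assigned S k \<omega> = pick S k B \<omega>"
      using rec[OF Suc.prems(1)] by (simp add: jiq_assignment_def B Let_def)
    have jB: "assigned S k \<omega> \<in> B" using pick[OF Suc.prems(1) BN BV(1)] j by simp
    have xpick: "nat \<lfloor>x (Pick k B)\<rfloor> = assigned S k \<omega>"
    proof -
      have "Pick k B \<in> primitives Q N" unfolding primitives_def using Suc.prems(1) BV(1) BN by blast
      then show ?thesis by (simp add: x_def config_def j)
    qed
    have "x (Service k (assigned S k \<omega>)) = service S k (assigned S k \<omega>) \<omega>"
    proof -
      have "Service k (assigned S k \<omega>) \<in> primitives Q N"
        unfolding primitives_def using Suc.prems(1) jB BN BV(2) rate[OF Suc.prems(1)] by blast
      then show ?thesis by (simp add: x_def config_def)
    qed
    moreover have "(\<lambda>l. snd (?c l)) ` ahead Q N S i k \<omega> = (\<lambda>l. departure S l \<omega>) ` ahead Q N S i k \<omega>" for i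
      unfolding e[symmetric] using c by (intro image_cong refl) (auto simp: earlier_at_def)
    ultimately show ?case
      using rec[OF Suc.prems(1)] arr[OF Suc.prems(1)]
      by (simp add: jiq_step_def Let_def B_def[symmetric] xpick e fcfs_departure_def)
  qed simp
  moreover have "card {l\<in>F. arr x l < arr x k} \<le> card F" using assms(1) by (intro card_mono) auto
  ultimately show ?thesis using k unfolding jiq_assign_def x_def[symmetric] by (simp del: jiq_iter.simps)
qed

section \<open>Measurability of the iterated assignment\<close>

lemma measurable_config_component: "(\<lambda>x. x p) \<in> borel_measurable configs"
  by (rule measurable_component_singleton) simp

lemma measurable_arr: "(\<lambda>x. arr x k) \<in> borel_measurable configs"
  unfolding arr_def using measurable_config_component by (intro borel_measurable_sum) auto

text \<open>The server is read from the coordinate \<open>Pick k B\<close> with \<open>B\<close>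
  itself random. As \<open>B\<close> ranges over the finitely many subsets of the server set,
  measurable maps are patched along a finite partition.\<close>

lemma measurable_jiq_step:
  fixes c :: "(primitive \<Rightarrow> real) \<Rightarrow> task \<Rightarrow> nat \<times> real"
  assumes F: "finite F"
    and [measurable]: "\<And>k. (\<lambda>x. fst (c x k)) \<in> configs \<rightarrow>\<^sub>M count_space UNIV"
      "\<And>k. (\<lambda>x. snd (c x k)) \<in> borel_measurable configs"
  shows "(\<lambda>x. fst (jiq_step Q R N F x (c x) k)) \<in> configs \<rightarrow>\<^sub>M count_space UNIV"
    and "(\<lambda>x. snd (jiq_step Q R N F x (c x) k)) \<in> borel_measurable configs"
proof -
  note [measurable] = measurable_config_component measurable_arr
  have e[measurable]: "Measurable.pred configs (\<lambda>x. l \<in> earlier_at F x (c x) j k)" for l j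
    unfolding earlier_at_def mem_Collect_eq by measurable
  have t: "(\<lambda>x. nat \<lfloor>x (Target k)\<rfloor>) \<in> configs \<rightarrow>\<^sub>M count_space UNIV"
    by measurable
  have V[measurable]: "Measurable.pred configs (\<lambda>x. j \<in> serv_class Q R N (nat \<lfloor>x (Target k)\<rfloor>))" for j
    by (rule measurable_compose[OF t]) simp
  have I[measurable]: "Measurable.pred configs (\<lambda>x. earlier_at F x (c x) j k = {})" for j
  proof -
    have "(earlier_at F x (c x) j k = {}) = (\<forall>l\<in>F. l \<notin> earlier_at F x (c x) j k)" for x
      by (auto simp: earlier_at_def)
    then show ?thesis using F by (simp add: countable_finite) measurable
  qed
  have cand: "(\<lambda>x. candidates Q R N F x (c x) k) \<in> configs \<rightarrow>\<^sub>M count_space (Pow {1..N})"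
  proof (subst measurable_count_space_eq2, simp, intro conjI ballI)
    show "(\<lambda>x. candidates Q R N F x (c x) k) \<in> space configs \<rightarrow> Pow {1..N}"
      using candidates_subset by blast
    fix B
    \<comment> \<open>A server of the target class is a candidate iff it is idle or no server of the
      class is; this turns membership into a finite Boolean combination of measurable
      events.\<close>
    have 1: "j \<in> candidates Q R N F x (c x) k \<longleftrightarrow> j \<in> serv_class Q R N (nat \<lfloor>x (Target k)\<rfloor>) \<and>
        (earlier_at F x (c x) j k = {} \<or>
         (\<forall>i\<in>{1..N}. i \<in> serv_class Q R N (nat \<lfloor>x (Target k)\<rfloor>) \<longrightarrow> earlier_at F x (c x) i k \<noteq> {}))" for x j
      using serv_class_subset[of Q R N] unfolding candidates_def Let_def by auto
    have [measurable]: "Measurable.pred configs (\<lambda>x. j \<in> candidates Q R N F x (c x) k)" for j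
      unfolding 1 by measurable
    assume B: "B \<in> Pow {1..N}"
    have eq: "C = B \<longleftrightarrow> (\<forall>j\<in>{1..N}. j \<in> C \<longleftrightarrow> j \<in> B)" if "C \<subseteq> {1..N}" for C
      using that B by blast
    have "(\<lambda>x. candidates Q R N F x (c x) k) -` {B} \<inter> space configs
        = {x\<in>space configs. \<forall>j\<in>{1..N}. j \<in> candidates Q R N F x (c x) k \<longleftrightarrow> j \<in> B}"
      using eq[OF candidates_subset] by (simp only: vimage_def Int_def mem_Collect_eq singleton_iff conj_commute)
    also have "\<dots> \<in> sets configs" by measurable
    finally show "(\<lambda>x. candidates Q R N F x (c x) k) -` {B} \<inter> space configs \<in> sets configs" .
  qed
  have pick: "(\<lambda>x. nat \<lfloor>x (Pick k (candidates Q R N F x (c x) k))\<rfloor>) \<in> configs \<rightarrow>\<^sub>M count_space UNIV"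
    by (rule measurable_compose_countable'[OF _ cand, where f="\<lambda>B x. nat \<lfloor>x (Pick k B)\<rfloor>"])
       (auto intro!: countable_finite)
  then show "(\<lambda>x. fst (jiq_step Q R N F x (c x) k)) \<in> configs \<rightarrow>\<^sub>M count_space UNIV"
    by (simp add: jiq_step_def Let_def)
  have m: "(\<lambda>x. Max (insert (arr x k) ((\<lambda>l. snd (c x l)) ` earlier_at F x (c x) j k)) + x (Service k j))
      \<in> borel_measurable configs" for j
  proof -
    \<comment> \<open>The maximum over a random set of tasks becomes one over a fixed index set:
      tasks outside the random set contribute \<open>arr x k\<close>, which is present anyway as the
      entry of \<open>None\<close>.\<close>
    have eq: "insert (arr x k) ((\<lambda>l. snd (c x l)) ` earlier_at F x (c x) j k) =
      (\<lambda>l. case l of None \<Rightarrow> arr x k | Some l \<Rightarrow> if l \<in> earlier_at F x (c x) j k then snd (c x l) else arr x k)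
        ` insert None (Some ` F)" for x
    proof -
      have "insert a (f ` E) = insert a ((\<lambda>l. if l \<in> E then f l else a) ` F)"
        if "E \<subseteq> F" for a :: real and f :: "task \<Rightarrow> real" and E
      proof -
        have "f ` E \<subseteq> (\<lambda>l. if l \<in> E then f l else a) ` F" using that by (auto simp: image_iff intro!: bexI)
        then show ?thesis by auto
      qed
      moreover have "earlier_at F x (c x) j k \<subseteq> F" by (auto simp: earlier_at_def)
      ultimately show ?thesis by (simp add: image_image)
    qed
    have "(\<lambda>x. Max ((\<lambda>l. case l of None \<Rightarrow> arr x k | Some l \<Rightarrow> if l \<in> earlier_at F x (c x) j k then snd (c x l) else arr x k)
        ` insert None (Some ` F))) \<in> borel_measurable configs"
      using F by (intro borel_measurable_Max) (auto split: option.split)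
    then show ?thesis unfolding eq by measurable
  qed
  have "(\<lambda>x. (\<lambda>j x. Max (insert (arr x k) ((\<lambda>l. snd (c x l)) ` earlier_at F x (c x) j k)) + x (Service k j))
      (nat \<lfloor>x (Pick k (candidates Q R N F x (c x) k))\<rfloor>) x) \<in> borel_measurable configs"
    by (rule measurable_compose_countable[OF m pick])
  then show "(\<lambda>x. snd (jiq_step Q R N F x (c x) k)) \<in> borel_measurable configs"
    by (simp add: jiq_step_def Let_def)
qed

lemma measurable_jiq_assign:
  assumes "finite F"
  shows "(\<lambda>x. jiq_assign Q R N F x k) \<in> configs \<rightarrow>\<^sub>M count_space UNIV"
proof -
  have "(\<lambda>x. fst (jiq_iter Q R N F x n k)) \<in> configs \<rightarrow>\<^sub>M count_space UNIV \<and>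
        (\<lambda>x. snd (jiq_iter Q R N F x n k)) \<in> borel_measurable configs" for n k
    by (induction n arbitrary: k) (auto intro!: measurable_jiq_step assms)
  then show ?thesis unfolding jiq_assign_def by blast
qed

section \<open>Cells of the regime and elementary estimates\<close>

lemma partition_mono:
  fixes w :: "nat \<Rightarrow> real"
  assumes "\<forall>h<n. w h < w (Suc h)" "i \<le> j" "j \<le> n"
  shows "w i \<le> w j"
  using assms(2,3)
proof (induction j rule: dec_induct)
  case (step k)
  then show ?case using assms(1)[rule_format, of k] by simp
qed simp

lemma partition_cell_ex1:
  fixes w :: "nat \<Rightarrow> real"
  assumes w: "w 0 = 0" "w n = 1" "\<forall>h<n. w h < w (Suc h)" and x: "x \<in> {0..<1}"
  shows "\<exists>!h. h \<in> {1..n} \<and> x \<in> {w (h - 1)..<w h}"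
proof -
  define h where "h = (LEAST h. x < w h)"
  have xn: "x < w n" using w x by simp
  then have 1: "x < w h" and 2: "h \<le> n" unfolding h_def by (auto intro: LeastI Least_le)
  have 3: "h \<noteq> 0" using 1 w x by (metis atLeastLessThan_iff not_less)
  have 4: "w (h - 1) \<le> x" using not_less_Least[of "h - 1" "\<lambda>h. x < w h"] 3 unfolding h_def[symmetric] by simp
  show ?thesis
  proof (rule ex1I[of _ h])
    show "h \<in> {1..n} \<and> x \<in> {w (h - 1)..<w h}" using 1 2 3 4 by simp
    fix g assume g: "g \<in> {1..n} \<and> x \<in> {w (g - 1)..<w g}"
    show "g = h"
    proof (rule ccontr)
      assume "g \<noteq> h"
      then consider "g \<le> h - 1" | "h \<le> g - 1" by linarith
      then show False
      proof cases
        case 1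
        have "h - 1 \<le> n" using \<open>h \<le> n\<close> by simp
        then show False using partition_mono[OF w(3) 1] 4 g by auto
      next
        case 2
        have "g - 1 \<le> n" using g by auto
        then show False using partition_mono[OF w(3) 2] \<open>x < w h\<close> g by auto
      qed
    qed
  qed
qed

definition disp_class :: "load_model \<Rightarrow> regime \<Rightarrow> nat \<Rightarrow> nat" where
  "disp_class Q R i = (THE h. h \<in> {1..numH R} \<and> disp_pos Q i \<in> wcell R h)"

lemma disp_class_iff:
  assumes "f_sequence Q" "subcritical Q R" "1 \<le> i"
  shows "h \<in> {1..numH R} \<and> disp_pos Q i \<in> wcell R h \<longleftrightarrow> h = disp_class Q R i"
proof -
  have "\<exists>!h. h \<in> {1..numH R} \<and> disp_pos Q i \<in> wcell R h"
    unfolding wcell_def using assms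
    by (intro partition_cell_ex1) (auto simp: f_sequence_def subcritical_def)
  from theI'[OF this] this show ?thesis unfolding disp_class_def by blast
qed

lemma serv_class_unique:
  assumes "f_sequence Q" "subcritical Q R"
    and "m \<in> {1..numM R}" "m' \<in> {1..numM R}" "j \<in> serv_class Q R N m" "j \<in> serv_class Q R N m'"
  shows "m = m'"
proof -
  have "\<exists>!m. m \<in> {1..numM R} \<and> serv_pos Q j \<in> {vpart R (m - 1)..<vpart R m}"
    using assms by (intro partition_cell_ex1) (auto simp: f_sequence_def subcritical_def serv_class_def)
  then show ?thesis using assms by (auto simp: serv_class_def vcell_def)
qed

lemma cell_props:
  assumes "subcritical Q R"
  shows "h \<in> {1..numH R} \<Longrightarrow> wcell R h \<subseteq> {0..<1} \<and> wpart R (h - 1) < wpart R h \<and> 0 \<le> wpart R (h - 1) \<and> wpart R h \<le> 1"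
    and "m \<in> {1..numM R} \<Longrightarrow> vcell R m \<subseteq> {0..<1} \<and> vpart R (m - 1) < vpart R m \<and> 0 \<le> vpart R (m - 1) \<and> vpart R m \<le> 1"
proof -
  have g: "{w (h - 1)..<w h} \<subseteq> {0..<1} \<and> w (h - 1) < w h \<and> 0 \<le> w (h - 1) \<and> w h \<le> 1"
    if "w 0 = 0" "w n = 1" "\<forall>h<n. w h < w (Suc h)" "h \<in> {1..n}" for w :: "nat \<Rightarrow> real" and n h
  proof -
    have h: "h - 1 < n" "Suc (h - 1) = h" "h \<le> n" using that(4) by auto
    have "w (h - 1) < w h" using that(3)[rule_format, OF h(1)] h(2) by simp
    moreover have "w 0 \<le> w (h - 1)" using h(1) by (intro partition_mono[OF that(3)]) auto
    moreover have "w h \<le> w n" using h(3) by (intro partition_mono[OF that(3)]) auto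
    ultimately show ?thesis using that(1,2) by auto
  qed
  show "h \<in> {1..numH R} \<Longrightarrow> wcell R h \<subseteq> {0..<1} \<and> wpart R (h - 1) < wpart R h \<and> 0 \<le> wpart R (h - 1) \<and> wpart R h \<le> 1"
    using assms g[of "wpart R" "numH R" h] unfolding wcell_def subcritical_def by blast
  show "m \<in> {1..numM R} \<Longrightarrow> vcell R m \<subseteq> {0..<1} \<and> vpart R (m - 1) < vpart R m \<and> 0 \<le> vpart R (m - 1) \<and> vpart R m \<le> 1"
    using assms g[of "vpart R" "numM R" m] unfolding vcell_def subcritical_def by blast
qed

lemma mu_star_nonneg_le:
  assumes "f_sequence Q" "subcritical Q R" "h \<in> {1..numH R}" "m \<in> {1..numM R}"
  shows "0 \<le> mu_star Q R h m"
    and "x \<in> wcell R h \<Longrightarrow> y \<in> vcell R m \<Longrightarrow> mu_star Q R h m \<le> serv_fun Q (x, y)"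
proof -
  note c = cell_props(1)[OF assms(2,3)] cell_props(2)[OF assms(2,4)]
  have ne: "wcell R h \<noteq> {}" "vcell R m \<noteq> {}" using c by (auto simp: wcell_def vcell_def)
  have nn: "0 \<le> s" if "s \<in> serv_fun Q ` (wcell R h \<times> vcell R m)" for s
    using that c assms(1) unfolding f_sequence_def by blast
  show "0 \<le> mu_star Q R h m"
    unfolding mu_star_def using nn ne by (intro cInf_greatest) auto
  assume "x \<in> wcell R h" "y \<in> vcell R m"
  then show "mu_star Q R h m \<le> serv_fun Q (x, y)"
    unfolding mu_star_def using nn by (intro cInf_lower bdd_belowI[of _ 0]) auto
qed

text \<open>Otherwise the term of \<open>h\<close> in the subcriticality sum would be a positive
  number over zero, hence infinite.\<close>

lemma mu_star_pos:
  assumes "f_sequence Q" "subcritical Q R" "h \<in> {1..numH R}" "m \<in> {1..numM R}" "0 < pmat R h m"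
  shows "0 < mu_star Q R h m"
proof (rule ccontr)
  let ?f = "\<lambda>h. ennreal (pmat R h m * lam_cell Q R h) /
           ennreal ((vpart R m - vpart R (m - 1)) * mu_star Q R h m)"
  assume "\<not> 0 < mu_star Q R h m"
  then have "mu_star Q R h m = 0" using mu_star_nonneg_le(1)[OF assms(1-4)] by simp
  moreover have "0 < pmat R h m * lam_cell Q R h" using assms by (auto simp: subcritical_def)
  ultimately have "?f h = top" by (auto simp: ennreal_divide_zero)
  moreover have "?f h \<le> (\<Sum>h\<in>{1..numH R}. ?f h)" using assms(3) by (intro member_le_sum) auto
  then have "?f h < 1" by (rule order_le_less_trans) (use assms in \<open>auto simp: subcritical_def\<close>)
  ultimately show False by (simp only: top.not_eq_extremum less_top) simp
qed

text \<open>From \<open>2 * n + 1 \<le> 2 * 2 ^ n\<close> and the exponential series at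
  \<open>2 * y\<close>; the point is a bound free of \<open>L\<close>.\<close>

lemma sum_weighted_exp_le:
  fixes y :: real
  assumes "0 \<le> y"
  shows "(\<Sum>n<L. (2 * real n + 1) * (y * y ^ n / fact n)) \<le> 2 * y * exp (2 * y)"
proof -
  have two: "2 * real n + 1 \<le> 2 * 2 ^ n" for n
  proof (induction n)
    case (Suc n)
    have "(1::real) \<le> 2 ^ n" by (rule one_le_power) simp
    then show ?case using Suc by (simp del: one_le_power)
  qed simp
  have "(\<Sum>n<L. (2 * real n + 1) * (y * y ^ n / fact n)) \<le> (\<Sum>n<L. 2 * y * ((2 * y) ^ n /\<^sub>R fact n))"
  proof (rule sum_mono)
    fix n
    have "(2 * real n + 1) * (y * y ^ n / fact n) \<le> (2 * 2 ^ n) * (y * y ^ n / fact n)"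
      using assms two by (intro mult_right_mono) auto
    also have "\<dots> = 2 * y * ((2 * y) ^ n /\<^sub>R fact n)" by (simp add: power_mult_distrib divide_inverse mult_ac)
    finally show "(2 * real n + 1) * (y * y ^ n / fact n) \<le> 2 * y * ((2 * y) ^ n /\<^sub>R fact n)" .
  qed
  also have "\<dots> \<le> 2 * y * exp (2 * y)"
    unfolding sum_distrib_left[symmetric] exp_def using assms
    by (intro mult_left_mono sum_le_suminf summable_exp_generic) auto
  finally show ?thesis .
qed

text \<open>The first bound drops the exponential factor. For the second, the Erlang densities of
  all arrival epochs of a Poisson process add up to its constant intensity \<open>l\<close>, and any
  \<open>L\<close> of them stay below it.\<close>

lemma erlang_density_bounds:
  assumes "0 < l"
  shows "0 \<le> b \<Longrightarrow> s \<le> b \<Longrightarrow> erlang_density n l s \<le> l * ((l * b) ^ n / fact n)"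
    and "(\<Sum>n<L. erlang_density n l s) \<le> l"
proof -
  show "erlang_density n l s \<le> l * ((l * b) ^ n / fact n)" if "0 \<le> b" "s \<le> b"
  proof (cases "s < 0")
    case False
    then have "s ^ n * exp (- l * s) \<le> b ^ n * 1"
      using assms that by (intro mult_mono power_mono) auto
    then have "l ^ Suc n * (s ^ n * exp (- l * s)) / fact n \<le> l ^ Suc n * (b ^ n * 1) / fact n"
      using assms by (intro divide_right_mono mult_left_mono) auto
    then show ?thesis using False by (simp add: erlang_density_def power_mult_distrib mult_ac)
  qed (use that assms in \<open>simp add: erlang_density_def\<close>)
  have exp_ge: "(\<Sum>n<L. y ^ n /\<^sub>R fact n) \<le> exp y" if "0 \<le> y" for y :: real
    unfolding exp_def using that
    by (intro sum_le_suminf summable_exp_generic) auto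
  show "(\<Sum>n<L. erlang_density n l s) \<le> l"
  proof (cases "s < 0")
    case False
    have "(\<Sum>n<L. erlang_density n l s) = l * exp (- l * s) * (\<Sum>n<L. (l * s) ^ n /\<^sub>R fact n)"
      using False by (simp add: erlang_density_def sum_distrib_left power_mult_distrib divide_inverse mult_ac)
    also have "\<dots> \<le> l * exp (- l * s) * exp (l * s)"
      using assms False by (intro mult_left_mono exp_ge) auto
    also have "\<dots> = l" by (simp add: mult.assoc exp_add[symmetric])
    finally show ?thesis .
  qed (use assms in \<open>simp add: erlang_density_def\<close>)
qed

text \<open>Per unit of arrival rate, the right-hand side is the mean content at time
  \<open>a\<close> of an infinite server queue started empty, plus the length of [a, b], because
  arrivals inside the window are counted in full.\<close>

lemma integral_discounted_le:
  fixes a b \<mu> :: real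
  assumes "0 \<le> a" "a \<le> b" "0 < \<mu>"
  shows "integrable lborel (\<lambda>s. indicator {0..b} s * exp (- \<mu> * max 0 (a - s)))"
    and "(\<integral>s. indicator {0..b} s * exp (- \<mu> * max 0 (a - s)) \<partial>lborel) \<le> (1 - exp (- \<mu> * a)) / \<mu> + (b - a)"
proof -
  have 1: "has_bochner_integral lborel (\<lambda>s. indicator {0..a} s *\<^sub>R exp (- \<mu> * (a - s)))
      (exp (- \<mu> * (a - a)) / \<mu> - exp (- \<mu> * (a - 0)) / \<mu>)"
    using assms
    by (intro has_bochner_integral_FTC_Icc continuous_intros)
       (auto intro!: derivative_eq_intros simp flip: has_real_derivative_iff_has_vector_derivative)
  have 2: "has_bochner_integral lborel (indicator {a..b} :: real \<Rightarrow> real) (b - a)"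
    using has_bochner_integral_real_indicator[of "{a..b}" lborel] assms by simp
  note 3 = has_bochner_integral_add[OF 1 2]
  have le: "norm (indicator {0..b} s * exp (- \<mu> * max 0 (a - s))) \<le>
      indicator {0..a} s *\<^sub>R exp (- \<mu> * (a - s)) + indicator {a..b} s" for s
    using assms by (auto simp: indicator_def max_def)
  show i: "integrable lborel (\<lambda>s. indicator {0..b} s * exp (- \<mu> * max 0 (a - s)))"
    using le by (intro Bochner_Integration.integrable_bound[OF integrable.intros[OF 3]]) (auto intro!: AE_I2 elim: order_trans)
  have "(\<integral>s. indicator {0..b} s * exp (- \<mu> * max 0 (a - s)) \<partial>lborel)
      \<le> (\<integral>s. indicator {0..a} s *\<^sub>R exp (- \<mu> * (a - s)) + indicator {a..b} s \<partial>lborel)"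
    using le by (intro integral_mono[OF i integrable.intros[OF 3]]) (metis abs_le_D1 le real_norm_def)
  also have "\<dots> = (1 - exp (- \<mu> * a)) / \<mu> + (b - a)"
    using has_bochner_integral_integral_eq[OF 3] by (simp add: diff_divide_distrib)
  finally show "(\<integral>s. indicator {0..b} s * exp (- \<mu> * max 0 (a - s)) \<partial>lborel) \<le> (1 - exp (- \<mu> * a)) / \<mu> + (b - a)" .
qed

section \<open>The number of tasks in service in a short window\<close>

locale jiq_run =
  fixes Q :: load_model and R :: regime and N :: nat and S :: "'a lb_system"
  assumes fs: "f_sequence Q" and sub: "subcritical Q R" and sys: "jiq_system Q R N S"
begin

sublocale prob_space "pspace S"
  using sys by (simp add: jiq_system_def)

abbreviation conf :: "'a \<Rightarrow> primitive \<Rightarrow> real" where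
  "conf \<equiv> config S (primitives Q N)"

lemma indep: "indep_vars (\<lambda>_. borel) (prim_var S) (primitives Q N)"
  using sys by (simp add: jiq_system_def primitive_laws_def)

lemma laws:
  assumes "k \<in> tasks Q N"
  shows "distributed (pspace S) lborel (interarrival S k) (exponential_density (arr_rate Q (fst k)))"
    and "\<lbrakk>h \<in> {1..numH R}; disp_pos Q (fst k) \<in> wcell R h; m \<in> {1..numM R}\<rbrakk> \<Longrightarrow>
           \<P>(\<omega> in pspace S. target S k \<omega> = m) = pmat R h m"
    and "\<lbrakk>j \<in> {1..N}; 0 < serv_rate Q (fst k) j\<rbrakk> \<Longrightarrow>
           distributed (pspace S) lborel (service S k j) (exponential_density (serv_rate Q (fst k) j))"
    and "\<lbrakk>B \<subseteq> {1..N}; j \<in> B\<rbrakk> \<Longrightarrow> \<P>(\<omega> in pspace S. pick S k B \<omega> = j) = 1 / real (card B)"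
  using sys assms unfolding jiq_system_def primitive_laws_def by blast+

lemma measurable_config: "J \<subseteq> primitives Q N \<Longrightarrow> config S J \<in> pspace S \<rightarrow>\<^sub>M configs"
  using indep_config[OF indep, of J "{}"] by (auto dest: indep_var_rv1)

lemma measurable_conf[measurable]: "conf \<in> pspace S \<rightarrow>\<^sub>M configs"
  by (rule measurable_config) simp

lemma tasks_ge1: "k \<in> tasks Q N \<Longrightarrow> 1 \<le> fst k" "k \<in> tasks Q N \<Longrightarrow> 0 < arr_rate Q (fst k)"
  by (auto simp: tasks_def)

lemma disp_class_mem:
  assumes "k \<in> tasks Q N"
  shows "disp_class Q R (fst k) \<in> {1..numH R}" "disp_pos Q (fst k) \<in> wcell R (disp_class Q R (fst k))"
  using disp_class_iff[OF fs sub tasks_ge1(1)[OF assms]] by blast+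

text \<open>Tasks are numbered from 0, so task \<open>n\<close> arrives after \<open>n + 1\<close>
  interarrival times; \<open>erlang_density n\<close> is the law of a sum of that many
  exponentials.\<close>

lemma arr_distributed:
  assumes "(i, n) \<in> tasks Q N"
  shows "distributed (pspace S) lborel (\<lambda>\<omega>. arr (conf \<omega>) (i, n)) (erlang_density n (arr_rate Q i))"
proof -
  define I where "I = Interarrival ` ({i} \<times> {..n})"
  have t: "(i, l) \<in> tasks Q N" for l using tasks_prefix[OF assms] .
  have I: "I \<subseteq> primitives Q N" using t by (auto simp: I_def primitives_def)
  have "distributed (pspace S) lborel (\<lambda>\<omega>. \<Sum>p\<in>I. prim_var S p \<omega>) (erlang_density (card I - 1) (arr_rate Q i))"
  proof (rule exponential_distributed_sum)
    show "finite I" "I \<noteq> {}" by (auto simp: I_def)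
    show "0 < arr_rate Q i" using tasks_ge1(2)[OF assms] by simp
    show "indep_vars (\<lambda>i. borel) (prim_var S) I" by (rule indep_vars_subset[OF indep I])
    fix p assume "p \<in> I"
    then show "distributed (pspace S) lborel (prim_var S p) (exponential_density (arr_rate Q i))"
      using laws(1)[OF t] by (auto simp: I_def)
  qed
  moreover have "card I = Suc n"
    unfolding I_def by (subst card_image) (auto simp: inj_on_def)
  moreover have "(\<Sum>p\<in>I. prim_var S p \<omega>) = arr (conf \<omega>) (i, n)" for \<omega>
  proof -
    have "(\<Sum>p\<in>I. prim_var S p \<omega>) = (\<Sum>p\<in>(\<lambda>l. Interarrival (i, l)) ` {..n}. prim_var S p \<omega>)"
      by (intro sum.cong) (auto simp: I_def)
    also have "\<dots> = arr (conf \<omega>) (i, n)"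
      unfolding arr_def using t
      by (subst sum.reindex) (auto simp: inj_on_def config_def primitives_def intro!: sum.cong)
    finally show ?thesis .
  qed
  ultimately show ?thesis by simp
qed

lemma measurable_arr_conf[measurable]: "(\<lambda>\<omega>. arr (conf \<omega>) k) \<in> borel_measurable (pspace S)"
  by (rule measurable_compose[OF measurable_conf measurable_arr])

lemma integrable_bounded:
  fixes f :: "'a \<Rightarrow> real"
  assumes "f \<in> borel_measurable (pspace S)" "\<And>\<omega>. \<bar>f \<omega>\<bar> \<le> B"
  shows "integrable (pspace S) f"
  using assms by (intro integrable_const_bound[where B=B]) auto

lemma expectation_arr_le:
  assumes k: "(i, n) \<in> tasks Q N" and b: "0 \<le> b"
  shows "expectation (\<lambda>\<omega>. of_bool (arr (conf \<omega>) (i, n) \<le> b))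
           \<le> arr_rate Q i * b * (arr_rate Q i * b) ^ n / fact n"
proof -
  let ?l = "arr_rate Q i"
  have l: "0 < ?l" using tasks_ge1(2)[OF k] by simp
  define C where "C = ?l * ((?l * b) ^ n / fact n)"
  have "expectation (\<lambda>\<omega>. of_bool (arr (conf \<omega>) (i, n) \<le> b)) = (\<integral>s. erlang_density n ?l s * of_bool (s \<le> b) \<partial>lborel)"
    by (rule distributed_integral[OF arr_distributed[OF k], symmetric]) (use l in auto)
  also have "\<dots> \<le> (\<integral>s. indicator {0..b} s *\<^sub>R C \<partial>lborel)"
  proof (rule integral_mono_AE')
    show "integrable lborel (\<lambda>s. indicator {0..b} s *\<^sub>R C)"
      using b by (intro integrable_scaleR_left integrable_real_indicator) auto
    show "AE s in lborel. erlang_density n ?l s * of_bool (s \<le> b) \<le> indicator {0..b} s *\<^sub>R C"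
    proof (rule AE_I2)
      fix s
      show "erlang_density n ?l s * of_bool (s \<le> b) \<le> indicator {0..b} s *\<^sub>R C"
        using erlang_density_bounds(1)[OF l b, of s n]
        by (cases "0 \<le> s \<and> s \<le> b") (auto simp: C_def erlang_density_def not_le)
    qed
    show "AE s in lborel. 0 \<le> indicator {0..b} s *\<^sub>R C"
      using l b by (auto simp: C_def)
  qed
  also have "\<dots> = b * C" using b by simp
  finally show ?thesis by (simp add: C_def mult_ac)
qed

lemma sum_expectation_arr_le:
  assumes "i \<in> {1..num_disp Q N}" "0 < arr_rate Q i" "arr_rate Q i * b \<le> y" and b: "0 \<le> b"
  shows "(\<Sum>n<L. (2 * real n + 1) * expectation (\<lambda>\<omega>. of_bool (arr (conf \<omega>) (i, n) \<le> b))) \<le> 2 * y * exp (2 * y)"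
proof -
  have k: "(i, n) \<in> tasks Q N" for n using assms by (auto simp: tasks_def)
  have y: "0 \<le> y" using assms by (meson mult_nonneg_nonneg less_imp_le order_trans)
  have "(\<Sum>n<L. (2 * real n + 1) * expectation (\<lambda>\<omega>. of_bool (arr (conf \<omega>) (i, n) \<le> b)))
      \<le> (\<Sum>n<L. (2 * real n + 1) * (y * y ^ n / fact n))"
  proof (intro sum_mono mult_left_mono)
    fix n
    have "expectation (\<lambda>\<omega>. of_bool (arr (conf \<omega>) (i, n) \<le> b)) \<le> arr_rate Q i * b * (arr_rate Q i * b) ^ n / fact n"
      by (rule expectation_arr_le[OF k b])
    also have "\<dots> \<le> y * y ^ n / fact n"
      using assms b y by (intro divide_right_mono mult_mono power_mono) auto
    finally show "expectation (\<lambda>\<omega>. of_bool (arr (conf \<omega>) (i, n) \<le> b)) \<le> y * y ^ n / fact n" .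
  qed simp
  also have "\<dots> \<le> 2 * y * exp (2 * y)" by (rule sum_weighted_exp_le[OF y])
  finally show ?thesis .
qed

lemma expectation_target:
  assumes k: "k \<in> tasks Q N" and m: "m \<in> {1..numM R}"
    and h[measurable]: "h \<in> borel_measurable borel" and hb: "\<And>s. \<bar>h s\<bar> \<le> (1::real)"
  shows "expectation (\<lambda>\<omega>. of_bool (nat \<lfloor>conf \<omega> (Target k)\<rfloor> = m) * h (arr (conf \<omega>) k))
       = pmat R (disp_class Q R (fst k)) m * expectation (\<lambda>\<omega>. h (arr (conf \<omega>) k))"
proof -
  define A where "A = {Target k}"
  define B where "B = Interarrival ` tasks Q N"
  have AB: "A \<inter> B = {}" "A \<subseteq> primitives Q N" "B \<subseteq> primitives Q N"
    using k by (auto simp: A_def B_def primitives_def)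
  note [measurable] = measurable_config_component measurable_arr
  have i: "indep_var borel ((\<lambda>x. of_bool (nat \<lfloor>x (Target k)\<rfloor> = m)) \<circ> config S A) borel ((\<lambda>x. h (arr x k)) \<circ> config S B)"
    by (rule indep_var_compose[OF indep_config[OF indep AB]]) measurable
  have eqA: "config S A \<omega> (Target k) = conf \<omega> (Target k)" for \<omega>
    using k by (auto simp: A_def config_def primitives_def)
  have eqB: "arr (config S B \<omega>) k = arr (conf \<omega>) k" for \<omega>
    using arr_config[OF k, of B S] arr_config[OF k, of "primitives Q N" S] AB(3) by (simp add: B_def)
  have ia: "integrable (pspace S) (\<lambda>\<omega>. of_bool (nat \<lfloor>conf \<omega> (Target k)\<rfloor> = m) :: real)"
    by (rule integrable_bounded[of _ 1]) auto
  have ib: "integrable (pspace S) (\<lambda>\<omega>. h (arr (conf \<omega>) k))"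
    by (rule integrable_bounded[of _ 1]) (auto simp: hb)
  have "expectation (\<lambda>\<omega>. of_bool (nat \<lfloor>conf \<omega> (Target k)\<rfloor> = m) * h (arr (conf \<omega>) k))
      = expectation (\<lambda>\<omega>. of_bool (nat \<lfloor>conf \<omega> (Target k)\<rfloor> = m)) * expectation (\<lambda>\<omega>. h (arr (conf \<omega>) k))"
    using indep_var_lebesgue_integral[OF i] ia ib by (simp add: comp_def eqA eqB)
  also have "expectation (\<lambda>\<omega>. of_bool (nat \<lfloor>conf \<omega> (Target k)\<rfloor> = m)) = \<P>(\<omega> in pspace S. target S k \<omega> = m)"
  proof -
    have t: "nat \<lfloor>conf \<omega> (Target k)\<rfloor> = target S k \<omega>" for \<omega>
      using k by (auto simp: config_def primitives_def)
    have s: "{\<omega>\<in>space (pspace S). nat \<lfloor>conf \<omega> (Target k)\<rfloor> = m} \<in> sets (pspace S)" by measurable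
    have "expectation (\<lambda>\<omega>. of_bool (nat \<lfloor>conf \<omega> (Target k)\<rfloor> = m))
        = expectation (indicator {\<omega>\<in>space (pspace S). nat \<lfloor>conf \<omega> (Target k)\<rfloor> = m})"
      by (intro Bochner_Integration.integral_cong) (auto simp: indicator_def)
    also have "\<dots> = prob {\<omega>\<in>space (pspace S). nat \<lfloor>conf \<omega> (Target k)\<rfloor> = m}"
      using s by simp
    finally show ?thesis by (simp add: t)
  qed
  also have "\<dots> = pmat R (disp_class Q R (fst k)) m"
    by (rule laws(2)[OF k disp_class_mem[OF k] m])
  finally show ?thesis .
qed

end

section \<open>Decomposition of a window count into noise and load\<close>

locale jiq_window = jiq_run Q R N S for Q R N and S :: "'a lb_system" +
  fixes m L :: nat and a b :: real
  assumes m: "m \<in> {1..numM R}" and a: "0 \<le> a" "a \<le> b"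
begin

definition disps :: "nat set" where
  "disps = {i\<in>{1..num_disp Q N}. 0 < arr_rate Q i}"

text \<open>Dispatchers with weight 0 for class \<open>m\<close> are left out because
  \<open>mu_star\<close> may vanish for them; for the remaining ones subcriticality makes it
  positive.\<close>

definition feeders :: "nat set" where
  "feeders = {i\<in>disps. 0 < pmat R (disp_class Q R i) m}"

definition asg :: "(primitive \<Rightarrow> real) \<Rightarrow> task \<Rightarrow> nat" where
  "asg = jiq_assign Q R N (disps \<times> {..<L})"

text \<open>A task served on arrival and present at some time of the window arrives by
  \<open>b\<close> and has a service time exceeding its age at \<open>a\<close>. For arrivals inside
  the window the age is negative, hence the truncation \<open>max 0\<close> in the means.\<close>

definition age :: "(primitive \<Rightarrow> real) \<Rightarrow> task \<Rightarrow> real" where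
  "age x k = a - arr x k"

definition joins :: "(primitive \<Rightarrow> real) \<Rightarrow> task \<Rightarrow> real" where
  "joins x k = of_bool (nat \<lfloor>x (Target k)\<rfloor> = m) * of_bool (arr x k \<le> b)"

text \<open>
  The window \<open>[a, b]\<close> is one cell of the time mesh: \<open>in_service\<close> counts the tasks which may be
  present at some time in it.  It is split into \<open>noise\<close>, centred given the past of each task,
  and an upper bound \<open>load\<close> of the conditional means.
\<close>

definition noise :: "(primitive \<Rightarrow> real) \<Rightarrow> task \<Rightarrow> real" where
  "noise x k = (\<Sum>j\<in>serv_class Q R N m. joins x k * of_bool (asg x k = j) *
     (of_bool (age x k < x (Service k j)) - exp (- serv_rate Q (fst k) j * max 0 (age x k))))"

definition load :: "(primitive \<Rightarrow> real) \<Rightarrow> nat \<Rightarrow> real" where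
  "load x i = (\<Sum>n<L. joins x (i, n) * exp (- mu_star Q R (disp_class Q R i) m * max 0 (age x (i, n))))"

definition in_service :: "(primitive \<Rightarrow> real) \<Rightarrow> real" where
  "in_service x = (\<Sum>k\<in>feeders \<times> {..<L}. \<Sum>j\<in>serv_class Q R N m.
     joins x k * of_bool (asg x k = j) * of_bool (age x k < x (Service k j)))"

lemma feeder_task: "i \<in> feeders \<Longrightarrow> (i, n) \<in> tasks Q N"
  by (auto simp: feeders_def disps_def tasks_def)

lemma finite_sets[simp]: "finite disps" "finite feeders" "finite (serv_class Q R N m)"
  by (auto simp: disps_def feeders_def serv_class_def)

lemma feeder_rate:
  assumes "i \<in> feeders"
  shows "0 < mu_star Q R (disp_class Q R i) m"
    and "j \<in> serv_class Q R N m \<Longrightarrow> mu_star Q R (disp_class Q R i) m \<le> serv_rate Q i j"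
proof -
  note c = disp_class_mem[OF feeder_task[OF assms, of 0], simplified fst_conv]
  show "0 < mu_star Q R (disp_class Q R i) m"
    using assms by (intro mu_star_pos[OF fs sub c(1) m]) (simp add: feeders_def)
  assume "j \<in> serv_class Q R N m"
  then show "mu_star Q R (disp_class Q R i) m \<le> serv_rate Q i j"
    unfolding serv_rate_def by (intro mu_star_nonneg_le(2)[OF fs sub c(1) m c(2)]) (auto simp: serv_class_def)
qed

lemma joins_bounds: "0 \<le> joins x k" "joins x k \<le> 1" "joins x k \<le> of_bool (arr x k \<le> b)"
  by (auto simp: joins_def)

text \<open>Subtracting the noise replaces the indicators of survival by their conditional means,
  which increase when \<open>serv_rate\<close> is lowered to \<open>mu_star\<close>. At most one
  \<open>j\<close> is the assigned server, so the sum over servers collapses.\<close>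

lemma in_service_le:
  "in_service x \<le> (\<Sum>k\<in>feeders \<times> {..<L}. noise x k) + (\<Sum>i\<in>feeders. load x i)"
proof -
  have "(\<Sum>j\<in>serv_class Q R N m. joins x k * of_bool (asg x k = j) * of_bool (age x k < x (Service k j)))
      \<le> noise x k + joins x k * exp (- mu_star Q R (disp_class Q R (fst k)) m * max 0 (age x k))"
    if k: "k \<in> feeders \<times> {..<L}" for k
  proof -
    let ?q = "exp (- mu_star Q R (disp_class Q R (fst k)) m * max 0 (age x k))"
    have "(\<Sum>j\<in>serv_class Q R N m. joins x k * of_bool (asg x k = j) * of_bool (age x k < x (Service k j))) - noise x k
        = (\<Sum>j\<in>serv_class Q R N m. joins x k * of_bool (asg x k = j) * exp (- serv_rate Q (fst k) j * max 0 (age x k)))"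
      unfolding noise_def sum_subtractf[symmetric] by (simp add: algebra_simps)
    also have "\<dots> \<le> (\<Sum>j\<in>serv_class Q R N m. joins x k * of_bool (asg x k = j) * ?q)"
      using k feeder_rate(2)[of "fst k"] joins_bounds(1)
      by (intro sum_mono mult_left_mono) (auto intro!: mult_right_mono)
    also have "\<dots> = (\<Sum>j\<in>serv_class Q R N m. if asg x k = j then joins x k * ?q else 0)"
      by (intro sum.cong) auto
    also have "\<dots> \<le> joins x k * ?q" using joins_bounds(1) by simp
    finally show ?thesis by simp
  qed
  then have "in_service x \<le> (\<Sum>k\<in>feeders \<times> {..<L}. noise x k +
      joins x k * exp (- mu_star Q R (disp_class Q R (fst k)) m * max 0 (age x k)))"
    unfolding in_service_def by (intro sum_mono)
  also have "\<dots> = (\<Sum>k\<in>feeders \<times> {..<L}. noise x k) + (\<Sum>i\<in>feeders. load x i)"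
    unfolding sum.distrib load_def by (simp add: sum.cartesian_product case_prod_beta)
  finally show ?thesis .
qed

lemma noise_bound: assumes "i \<in> feeders" shows "\<bar>noise x (i, n)\<bar> \<le> joins x (i, n)"
proof -
  let ?k = "(i, n)"
  define c where "c j = of_bool (age x ?k < x (Service ?k j)) - exp (- serv_rate Q i j * max 0 (age x ?k))" for j
  have "\<bar>c j\<bar> \<le> 1" if "j \<in> serv_class Q R N m" for j
  proof -
    have "0 < serv_rate Q i j" using feeder_rate[OF assms] that by (meson less_le_trans)
    then have "0 \<le> exp (- serv_rate Q i j * max 0 (age x ?k))" "exp (- serv_rate Q i j * max 0 (age x ?k)) \<le> 1" by auto
    then show ?thesis unfolding c_def by (auto simp: abs_le_iff simp del: exp_le_one_iff intro: order_trans[of _ 0])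
  qed
  moreover have "noise x ?k = (\<Sum>j\<in>serv_class Q R N m. if asg x ?k = j then joins x ?k * c j else 0)"
    unfolding noise_def c_def by (intro sum.cong) auto
  then have "noise x ?k = (if asg x ?k \<in> serv_class Q R N m then joins x ?k * c (asg x ?k) else 0)" by simp
  ultimately show ?thesis using joins_bounds[of x ?k] by (auto simp: abs_mult mult_left_le)
qed

lemma measurable_asg[measurable]: "(\<lambda>x. asg x k) \<in> configs \<rightarrow>\<^sub>M count_space UNIV"
  unfolding asg_def by (rule measurable_jiq_assign) auto

lemma measurable_aux[measurable]:
  "(\<lambda>x. joins x k) \<in> borel_measurable configs" "(\<lambda>x. age x k) \<in> borel_measurable configs"
  "(\<lambda>x. noise x k) \<in> borel_measurable configs" "(\<lambda>x. load x i) \<in> borel_measurable configs"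
  "in_service \<in> borel_measurable configs"
proof -
  note [measurable] = measurable_config_component measurable_arr
  show 1[measurable]: "(\<lambda>x. joins x k) \<in> borel_measurable configs" for k unfolding joins_def by measurable
  show 2[measurable]: "(\<lambda>x. age x k) \<in> borel_measurable configs" for k unfolding age_def by measurable
  show "(\<lambda>x. noise x k) \<in> borel_measurable configs" unfolding noise_def by measurable
  show "(\<lambda>x. load x i) \<in> borel_measurable configs" unfolding load_def by measurable
  show "in_service \<in> borel_measurable configs" unfolding in_service_def by measurable
qed

text \<open>Given everything but its own service times, a task sees a centred noise term.\<close>

lemma expectation_noise:
  assumes i: "i \<in> feeders" and w[measurable]: "w \<in> borel_measurable configs" and wb: "\<And>x. \<bar>w x\<bar> \<le> 1"
    and loc: "\<And>x y. (\<And>p. (\<forall>j. p \<noteq> Service (i, n) j) \<Longrightarrow> x p = y p) \<Longrightarrow> w x = w y"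
  shows "expectation (\<lambda>\<omega>. w (conf \<omega>) * noise (conf \<omega>) (i, n)) = 0"
proof -
  let ?l = "(i, n)" and ?V = "serv_class Q R N m"
  \<comment> \<open>All service times of the task are discarded, whichever server they belong to. By
    locality its arrival, its server and the weight \<open>w\<close> can still be computed from what
    remains.\<close>
  define J where "J = primitives Q N - range (Service ?l)"
  define Y where "Y = config S J"
  note [measurable] = measurable_config_component measurable_arr
  have Ym[measurable]: "Y \<in> pspace S \<rightarrow>\<^sub>M configs" unfolding Y_def J_def by (rule measurable_config) auto
  have agree: "conf \<omega> p = Y \<omega> p" if "\<forall>j. p \<noteq> Service ?l j" for \<omega> p
    using that by (auto simp: Y_def J_def config_def)
  have weq: "w (conf \<omega>) = w (Y \<omega>)" for \<omega> by (rule loc) (rule agree)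
  have arreq: "arr (conf \<omega>) k = arr (Y \<omega>) k" for \<omega> k by (rule jiq_iter_local(1)[of ?l]) (rule agree)
  have aeq: "asg (conf \<omega>) ?l = asg (Y \<omega>) ?l" for \<omega>
    unfolding asg_def by (rule jiq_assign_local[of ?l]) (use agree in auto)
  have jeq: "joins (conf \<omega>) ?l = joins (Y \<omega>) ?l" "age (conf \<omega>) ?l = age (Y \<omega>) ?l" for \<omega>
    unfolding joins_def age_def arreq using agree by simp_all
  \<comment> \<open>Splitting over servers makes the service time a fixed coordinate: for given
    \<open>j\<close>, whether \<open>j\<close> is the server depends on \<open>Y\<close> alone, and
    \<open>Y\<close> is independent of \<open>Service ?l j\<close>.\<close>
  define f where "f j \<omega> = (w (Y \<omega>) * joins (Y \<omega>) ?l * of_bool (asg (Y \<omega>) ?l = j)) *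
      (of_bool (age (Y \<omega>) ?l < config S {Service ?l j} \<omega> (Service ?l j)) - exp (- serv_rate Q i j * max 0 (age (Y \<omega>) ?l)))" for j \<omega>
  have pr: "Service ?l j \<in> primitives Q N" "0 < serv_rate Q i j" if "j \<in> ?V" for j
  proof -
    show "0 < serv_rate Q i j" using feeder_rate[OF i] that by (meson less_le_trans)
    then show "Service ?l j \<in> primitives Q N"
      using feeder_task[OF i, of n] that serv_class_subset[of Q R N m] unfolding primitives_def by auto
  qed
  have "w (conf \<omega>) * noise (conf \<omega>) ?l = (\<Sum>j\<in>?V. f j \<omega>)" for \<omega>
    unfolding noise_def weq jeq aeq sum_distrib_left f_def
    using pr by (intro sum.cong refl) (simp add: config_def mult_ac)
  then have "expectation (\<lambda>\<omega>. w (conf \<omega>) * noise (conf \<omega>) ?l) = expectation (\<lambda>\<omega>. \<Sum>j\<in>?V. f j \<omega>)" by simp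
  also have "\<dots> = (\<Sum>j\<in>?V. expectation (f j))"
  proof (rule Bochner_Integration.integral_sum)
    fix j assume j: "j \<in> ?V"
    have [measurable]: "config S {Service ?l j} \<in> pspace S \<rightarrow>\<^sub>M configs"
      using pr[OF j] by (intro measurable_config) auto
    have [measurable]: "(\<lambda>\<omega>. config S {Service ?l j} \<omega> (Service ?l j)) \<in> borel_measurable (pspace S)"
      by (rule measurable_compose[OF _ measurable_config_component]) measurable
    have fm: "f j \<in> borel_measurable (pspace S)" unfolding f_def by measurable
    have "\<bar>f j \<omega>\<bar> \<le> 1 * 1" for \<omega>
      unfolding f_def abs_mult[of "w (Y \<omega>) * joins (Y \<omega>) ?l * of_bool (asg (Y \<omega>) ?l = j)"]
    proof (rule mult_mono)
      show "\<bar>w (Y \<omega>) * joins (Y \<omega>) ?l * of_bool (asg (Y \<omega>) ?l = j)\<bar> \<le> 1"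
        using wb[of "Y \<omega>"] by (auto simp: abs_mult joins_def)
      have "0 \<le> exp (- serv_rate Q i j * max 0 (age (Y \<omega>) ?l))" "exp (- serv_rate Q i j * max 0 (age (Y \<omega>) ?l)) \<le> 1"
        using pr(2)[OF j] by auto
      then show "\<bar>of_bool (age (Y \<omega>) ?l < config S {Service ?l j} \<omega> (Service ?l j)) - exp (- serv_rate Q i j * max 0 (age (Y \<omega>) ?l))\<bar> \<le> 1"
        by (auto simp: abs_le_iff simp del: exp_le_one_iff intro: order_trans[of _ 0])
    qed auto
    then show "integrable (pspace S) (f j)"
      by (intro integrable_bounded[OF fm, of 1]) simp
  qed
  also have "\<dots> = 0"
  proof (rule sum.neutral, rule ballI)
    fix j assume j: "j \<in> ?V"
    show "expectation (f j) = 0"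
      unfolding f_def
    proof (rule expectation_exponential_centred[where u="\<lambda>x. x (Service ?l j)" and c=1
          and w="\<lambda>x. w x * joins x ?l * of_bool (asg x ?l = j)" and g="\<lambda>x. age x ?l" and X=Y and Z="config S {Service ?l j}"])
      show "indep_var configs (config S {Service ?l j}) configs Y"
        unfolding Y_def J_def using pr[OF j] by (intro indep_config[OF indep]) auto
      show "distributed (pspace S) lborel (\<lambda>\<omega>. config S {Service ?l j} \<omega> (Service ?l j)) (exponential_density (serv_rate Q i j))"
        using laws(3)[OF feeder_task[OF i, of n], of j] pr[OF j] j serv_class_subset[of Q R N m]
        by (auto simp: config_def)
      show "\<bar>w x * joins x ?l * of_bool (asg x ?l = j)\<bar> \<le> 1" for x
        using wb[of x] by (auto simp: abs_mult joins_def)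
    qed (use pr[OF j] in measurable)
  qed
  finally show ?thesis .
qed

lemma noise_local:
  assumes "\<And>p. (\<forall>j. p \<noteq> Service l j) \<Longrightarrow> x p = y p" "k \<noteq> l" "arr x k \<le> arr x l"
  shows "noise x k = noise y k"
proof -
  have 1: "arr x k = arr y k" using assms(1) by (rule jiq_iter_local(1))
  moreover have "asg x k = asg y k"
    unfolding asg_def using assms(1,3) by (rule jiq_assign_local)
  moreover have "x (Service k j) = y (Service k j)" for j using assms(1,2) by simp
  moreover have "x (Target k) = y (Target k)" using assms(1) by simp
  ultimately show ?thesis by (simp add: noise_def joins_def age_def)
qed

lemma noise_le1: "k \<in> feeders \<times> {..<L} \<Longrightarrow> \<bar>noise x k\<bar> \<le> 1"
  using noise_bound[of "fst k" x "snd k"] joins_bounds(2)[of x k] by auto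

text \<open>The order of arrival is random, so the product is split by which task comes first. In
  either half the noise of the earlier task, times the order indicator, is a bounded weight
  untouched by the service times of the later one. Ties go to the first half.\<close>

lemma expectation_noise_noise:
  assumes "k \<in> feeders \<times> {..<L}" "l \<in> feeders \<times> {..<L}" "k \<noteq> l"
  shows "expectation (\<lambda>\<omega>. noise (conf \<omega>) k * noise (conf \<omega>) l) = 0"
proof -
  note [measurable] = measurable_arr
  have half: "expectation (\<lambda>\<omega>. (noise (conf \<omega>) k * of_bool (P (arr (conf \<omega>) k) (arr (conf \<omega>) l))) * noise (conf \<omega>) l) = 0"
    if kl: "k \<in> feeders \<times> {..<L}" "l \<in> feeders \<times> {..<L}" "k \<noteq> l"
      and P: "\<And>s t. P s t \<Longrightarrow> s \<le> t"
      and Pm: "(\<lambda>x. of_bool (P (arr x k) (arr x l)) :: real) \<in> borel_measurable configs" for k l P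
  proof -
    obtain i n where l: "l = (i, n)" "i \<in> feeders" using kl by auto
    show ?thesis unfolding l(1)
    proof (rule expectation_noise[where w="\<lambda>x. noise x k * of_bool (P (arr x k) (arr x (i, n)))"])
      show "(\<lambda>x. noise x k * of_bool (P (arr x k) (arr x (i, n)))) \<in> borel_measurable configs"
        using Pm unfolding l(1) by (intro borel_measurable_times measurable_aux)
      show "\<bar>noise x k * of_bool (P (arr x k) (arr x (i, n)))\<bar> \<le> 1" for x
        using noise_le1[OF kl(1)] by (simp add: abs_mult)
      fix x y :: "primitive \<Rightarrow> real" assume xy: "\<And>p. (\<forall>j. p \<noteq> Service (i, n) j) \<Longrightarrow> x p = y p"
      have "arr x k = arr y k" for k using xy by (rule jiq_iter_local(1))
      moreover have "noise x k = noise y k" if "P (arr x k) (arr x (i, n))"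
        using xy kl(3) P[OF that] unfolding l(1) by (rule noise_local)
      ultimately show "noise x k * of_bool (P (arr x k) (arr x (i, n))) = noise y k * of_bool (P (arr y k) (arr y (i, n)))"
        by auto
    qed (rule l(2))
  qed
  let ?f = "\<lambda>\<omega>. (noise (conf \<omega>) k * of_bool (arr (conf \<omega>) k \<le> arr (conf \<omega>) l)) * noise (conf \<omega>) l"
  let ?g = "\<lambda>\<omega>. (noise (conf \<omega>) l * of_bool (arr (conf \<omega>) l < arr (conf \<omega>) k)) * noise (conf \<omega>) k"
  have le: "\<bar>(noise x k * of_bool A) * noise x l\<bar> \<le> 1 * 1" if "k \<in> feeders \<times> {..<L}" "l \<in> feeders \<times> {..<L}" for x k l A
    unfolding abs_mult using noise_le1[OF that(1), of x] noise_le1[OF that(2), of x] by (intro mult_mono) auto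
  have "integrable (pspace S) ?f" "integrable (pspace S) ?g"
    using le[OF assms(1,2)] le[OF assms(2,1)] by (auto intro!: integrable_bounded[of _ 1])
  moreover have le_m: "(\<lambda>x. of_bool (arr x k \<le> arr x l) :: real) \<in> borel_measurable configs" for k l
    unfolding not_less[symmetric] by measurable
  have "expectation ?f = 0" by (rule half[OF assms, of "(\<le>)"]) (simp, rule le_m)
  moreover have less_m: "(\<lambda>x. of_bool (arr x k < arr x l) :: real) \<in> borel_measurable configs" for k l
    by measurable
  have "expectation ?g = 0" by (rule half[OF assms(2,1) assms(3)[symmetric], of "(<)"]) (simp, rule less_m)
  moreover have "expectation (\<lambda>\<omega>. noise (conf \<omega>) k * noise (conf \<omega>) l) = expectation (\<lambda>\<omega>. ?f \<omega> + ?g \<omega>)"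
    by (intro Bochner_Integration.integral_cong) auto
  ultimately show ?thesis by (simp only: Bochner_Integration.integral_add)
qed

end

section \<open>Moments of noise and load, and the tail of the window count\<close>

context jiq_window
begin

text \<open>The stream of dispatcher \<open>i\<close>, thinned by \<open>pmat\<close>, is fed into
  an infinite server queue with service rate \<open>mu_star\<close>: its mean at time
  \<open>a\<close>, plus all arrivals expected during the window.\<close>

definition mean_load :: "nat \<Rightarrow> real" where
  "mean_load i = pmat R (disp_class Q R i) m * arr_rate Q i *
     ((1 - exp (- mu_star Q R (disp_class Q R i) m * a)) / mu_star Q R (disp_class Q R i) m + (b - a))"

lemma feeder_disp: "i \<in> feeders \<Longrightarrow> i \<in> {1..num_disp Q N} \<and> 0 < arr_rate Q i"
  by (auto simp: feeders_def disps_def)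

lemma measurable_conf_funs[measurable]:
  "(\<lambda>\<omega>. noise (conf \<omega>) k) \<in> borel_measurable (pspace S)"
  "(\<lambda>\<omega>. load (conf \<omega>) i) \<in> borel_measurable (pspace S)"
  "(\<lambda>\<omega>. in_service (conf \<omega>)) \<in> borel_measurable (pspace S)"
  "(\<lambda>\<omega>. of_bool (arr (conf \<omega>) k \<le> b) :: real) \<in> borel_measurable (pspace S)"
  by measurable

lemma integrable_of_bool_arr: "integrable (pspace S) (\<lambda>\<omega>. of_bool (arr (conf \<omega>) k \<le> b) :: real)"
  by (rule integrable_bounded[of _ 1]) auto

text \<open>Orthogonality leaves only the squares, and each square is at most the indicator of an
  arrival by \<open>b\<close>. Hence the bound is proportional to the number of feeders, whatever
  \<open>L\<close> is.\<close>

lemma noise_second_moment: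
  assumes y: "\<And>i. i \<in> feeders \<Longrightarrow> arr_rate Q i * b \<le> y"
  shows "integrable (pspace S) (\<lambda>\<omega>. (\<Sum>k\<in>feeders \<times> {..<L}. noise (conf \<omega>) k)\<^sup>2)"
    and "expectation (\<lambda>\<omega>. (\<Sum>k\<in>feeders \<times> {..<L}. noise (conf \<omega>) k)\<^sup>2) \<le> card feeders * (2 * y * exp (2 * y))"
proof -
  let ?K = "feeders \<times> {..<L}"
  have le: "\<bar>noise x k * noise x l\<bar> \<le> 1 * 1" if "k \<in> ?K" "l \<in> ?K" for x k l
    unfolding abs_mult using noise_le1[OF that(1), of x] noise_le1[OF that(2), of x] by (intro mult_mono) auto
  have int: "integrable (pspace S) (\<lambda>\<omega>. noise (conf \<omega>) k * noise (conf \<omega>) l)" if "k \<in> ?K" "l \<in> ?K" for k l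
    using le[OF that] by (intro integrable_bounded[of _ 1]) auto
  note sq = expectation_square_sum_orthogonal[of ?K "\<lambda>k \<omega>. noise (conf \<omega>) k", OF _ int expectation_noise_noise]
  show "integrable (pspace S) (\<lambda>\<omega>. (\<Sum>k\<in>?K. noise (conf \<omega>) k)\<^sup>2)"
    by (rule sq(1)) simp_all
  have "expectation (\<lambda>\<omega>. (\<Sum>k\<in>?K. noise (conf \<omega>) k)\<^sup>2) = (\<Sum>k\<in>?K. expectation (\<lambda>\<omega>. (noise (conf \<omega>) k)\<^sup>2))"
    by (rule sq(2)) simp_all
  also have "\<dots> \<le> (\<Sum>k\<in>?K. expectation (\<lambda>\<omega>. of_bool (arr (conf \<omega>) k \<le> b)))"
  proof (intro sum_mono integral_mono integrable_of_bool_arr)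
    fix k \<omega> assume k: "k \<in> ?K"
    show "integrable (pspace S) (\<lambda>\<omega>. (noise (conf \<omega>) k)\<^sup>2)" using int[OF k k] by (simp add: power2_eq_square)
    have "\<bar>noise (conf \<omega>) k\<bar> * \<bar>noise (conf \<omega>) k\<bar> \<le> 1 * of_bool (arr (conf \<omega>) k \<le> b)"
      using k noise_le1[OF k] noise_bound[of "fst k" "conf \<omega>" "snd k"] joins_bounds(3)[of "conf \<omega>" k]
      by (intro mult_mono) auto
    then show "(noise (conf \<omega>) k)\<^sup>2 \<le> of_bool (arr (conf \<omega>) k \<le> b)" by (simp add: power2_eq_square)
  qed
  also have "\<dots> = (\<Sum>i\<in>feeders. \<Sum>n<L. expectation (\<lambda>\<omega>. of_bool (arr (conf \<omega>) (i, n) \<le> b)))"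
    by (simp add: sum.cartesian_product case_prod_beta)
  \<comment> \<open>The weights are at least 1; inserting them allows the bound for squared arrival
    counts to serve here too.\<close>
  also have "\<dots> \<le> (\<Sum>i\<in>feeders. \<Sum>n<L. (2 * real n + 1) * expectation (\<lambda>\<omega>. of_bool (arr (conf \<omega>) (i, n) \<le> b)))"
  proof (intro sum_mono)
    fix i n
    have "0 \<le> expectation (\<lambda>\<omega>. of_bool (arr (conf \<omega>) (i, n) \<le> b) :: real)" by (rule integral_nonneg_AE) auto
    then show "expectation (\<lambda>\<omega>. of_bool (arr (conf \<omega>) (i, n) \<le> b))
        \<le> (2 * real n + 1) * expectation (\<lambda>\<omega>. of_bool (arr (conf \<omega>) (i, n) \<le> b))"
      using mult_right_mono[of 1 "2 * real n + 1"] by simp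
  qed
  also have "\<dots> \<le> (\<Sum>i\<in>feeders. 2 * y * exp (2 * y))"
    using feeder_disp y a by (intro sum_mono sum_expectation_arr_le) auto
  finally show "expectation (\<lambda>\<omega>. (\<Sum>k\<in>?K. noise (conf \<omega>) k)\<^sup>2) \<le> card feeders * (2 * y * exp (2 * y))" by simp
qed

lemma load_bounds:
  assumes "i \<in> feeders"
  shows "0 \<le> load x i" "load x i \<le> (\<Sum>n<L. of_bool (arr x (i, n) \<le> b))" "load x i \<le> L"
proof -
  show "0 \<le> load x i" unfolding load_def using joins_bounds by (intro sum_nonneg mult_nonneg_nonneg) auto
  show 1: "load x i \<le> (\<Sum>n<L. of_bool (arr x (i, n) \<le> b))"
    unfolding load_def
  proof (rule sum_mono)
    fix n
    have "exp (- mu_star Q R (disp_class Q R i) m * max 0 (age x (i, n))) \<le> 1"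
      using feeder_rate(1)[OF assms] by simp
    then have "joins x (i, n) * exp (- mu_star Q R (disp_class Q R i) m * max 0 (age x (i, n))) \<le> joins x (i, n) * 1"
      using joins_bounds by (intro mult_left_mono) auto
    then show "joins x (i, n) * exp (- mu_star Q R (disp_class Q R i) m * max 0 (age x (i, n))) \<le> of_bool (arr x (i, n) \<le> b)"
      using joins_bounds(3)[of x "(i, n)"] by simp
  qed
  also have "\<dots> \<le> (\<Sum>n<L. 1)" by (intro sum_mono) auto
  finally show "load x i \<le> L" by simp
qed

lemma integrable_load:
  assumes "i \<in> feeders" shows "integrable (pspace S) (\<lambda>\<omega>. load (conf \<omega>) i)"
  using load_bounds[OF assms] by (intro integrable_bounded[of _ L]) auto

lemma load_second_moment:
  assumes i: "i \<in> feeders" and y: "arr_rate Q i * b \<le> y"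
  shows "expectation (\<lambda>\<omega>. (load (conf \<omega>) i)\<^sup>2) \<le> 2 * y * exp (2 * y)"
proof -
  have "expectation (\<lambda>\<omega>. (load (conf \<omega>) i)\<^sup>2)
      \<le> expectation (\<lambda>\<omega>. \<Sum>n<L. (2 * real n + 1) * of_bool (arr (conf \<omega>) (i, n) \<le> b))"
  proof (rule integral_mono)
    have "(load x i)\<^sup>2 \<le> (real L)\<^sup>2" for x using load_bounds[OF i] by (intro power_mono) auto
    then show "integrable (pspace S) (\<lambda>\<omega>. (load (conf \<omega>) i)\<^sup>2)"
      by (intro integrable_bounded[of _ "(real L)\<^sup>2"]) auto
    show "integrable (pspace S) (\<lambda>\<omega>. \<Sum>n<L. (2 * real n + 1) * of_bool (arr (conf \<omega>) (i, n) \<le> b))"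
      using integrable_of_bool_arr by (intro Bochner_Integration.integrable_sum integrable_mult_right) auto
    fix \<omega>
    have "(load (conf \<omega>) i)\<^sup>2 \<le> (\<Sum>n<L. of_bool (arr (conf \<omega>) (i, n) \<le> b))\<^sup>2"
      using load_bounds[OF i] by (intro power_mono) auto
    also have "\<dots> \<le> (\<Sum>n<L. (2 * real n + 1) * of_bool (arr (conf \<omega>) (i, n) \<le> b))"
      by (rule square_sum_le_weighted) auto
    finally show "(load (conf \<omega>) i)\<^sup>2 \<le> (\<Sum>n<L. (2 * real n + 1) * of_bool (arr (conf \<omega>) (i, n) \<le> b))" .
  qed
  also have "\<dots> = (\<Sum>n<L. (2 * real n + 1) * expectation (\<lambda>\<omega>. of_bool (arr (conf \<omega>) (i, n) \<le> b)))"
    using integrable_of_bool_arr by (subst Bochner_Integration.integral_sum) auto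
  also have "\<dots> \<le> 2 * y * exp (2 * y)"
    using feeder_disp[OF i] y a by (intro sum_expectation_arr_le) auto
  finally show ?thesis .
qed

text \<open>Independent targets thin the stream by \<open>pmat\<close>. Summing the Erlang densities
  over the tasks of the dispatcher bounds the law of its arrival epochs by the constant intensity
  \<open>arr_rate\<close>, and the discounted integral does the rest.\<close>

lemma expectation_load_le:
  assumes i: "i \<in> feeders"
  shows "expectation (\<lambda>\<omega>. load (conf \<omega>) i) \<le> mean_load i"
proof -
  let ?p = "pmat R (disp_class Q R i) m" and ?\<mu> = "mu_star Q R (disp_class Q R i) m" and ?l = "arr_rate Q i"
  define h where "h s = of_bool (s \<le> b) * exp (- ?\<mu> * max 0 (a - s))" for s :: real
  have \<mu>: "0 < ?\<mu>" by (rule feeder_rate(1)[OF i])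
  have l: "0 < ?l" using feeder_disp[OF i] by simp
  have p: "0 < ?p" using i by (simp add: feeders_def)
  have hm[measurable]: "h \<in> borel_measurable borel" unfolding h_def by measurable
  have h1: "\<bar>h s\<bar> \<le> 1" for s using \<mu> by (auto simp: h_def abs_mult)
  note k = feeder_task[OF i]
  have hi: "integrable (pspace S) (\<lambda>\<omega>. h (arr (conf \<omega>) k))" for k
    by (rule integrable_bounded[of _ 1]) (auto simp: h1)
  have hint: "integrable lborel (\<lambda>s. erlang_density n ?l s * h s)" for n
    using hi[of "(i, n)"] l by (subst distributed_integrable[OF arr_distributed[OF k]]) auto
  have eq: "expectation (\<lambda>\<omega>. load (conf \<omega>) i) = (\<Sum>n<L. ?p * expectation (\<lambda>\<omega>. h (arr (conf \<omega>) (i, n))))"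
  proof -
    have ld: "load x i = (\<Sum>n<L. of_bool (nat \<lfloor>x (Target (i, n))\<rfloor> = m) * h (arr x (i, n)))" for x
      unfolding load_def joins_def h_def age_def by (simp add: mult_ac)
    have "integrable (pspace S) (\<lambda>\<omega>. of_bool (nat \<lfloor>conf \<omega> (Target k)\<rfloor> = m) * h (arr (conf \<omega>) k))" for k
      using h1 measurable_compose[OF measurable_conf measurable_config_component[of "Target k"]]
      by (intro integrable_bounded[of _ 1]) auto
    then show ?thesis
      unfolding ld using expectation_target[OF k m hm h1]
      by (subst Bochner_Integration.integral_sum) auto
  qed
  also have "\<dots> = ?p * (\<Sum>n<L. \<integral>s. erlang_density n ?l s * h s \<partial>lborel)"
    using l by (simp add: sum_distrib_left distributed_integral[OF arr_distributed[OF k]])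
  also have "(\<Sum>n<L. \<integral>s. erlang_density n ?l s * h s \<partial>lborel) = (\<integral>s. (\<Sum>n<L. erlang_density n ?l s * h s) \<partial>lborel)"
    using hint by (subst Bochner_Integration.integral_sum) auto
  also have "\<dots> \<le> (\<integral>s. ?l * (indicator {0..b} s * exp (- ?\<mu> * max 0 (a - s))) \<partial>lborel)"
  proof (rule integral_mono)
    show "integrable lborel (\<lambda>s. \<Sum>n<L. erlang_density n ?l s * h s)"
      using hint by (intro Bochner_Integration.integrable_sum) auto
    show "integrable lborel (\<lambda>s. ?l * (indicator {0..b} s * exp (- ?\<mu> * max 0 (a - s))))"
      using integral_discounted_le(1)[OF a \<mu>] by (rule integrable_mult_right)
    fix s
    show "(\<Sum>n<L. erlang_density n ?l s * h s) \<le> ?l * (indicator {0..b} s * exp (- ?\<mu> * max 0 (a - s)))"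
    proof (cases "0 \<le> s")
      case True
      have "(\<Sum>n<L. erlang_density n ?l s) * h s \<le> ?l * h s"
        using erlang_density_bounds(2)[OF l] by (intro mult_right_mono) (auto simp: h_def)
      then show ?thesis using True by (simp add: sum_distrib_right h_def indicator_def)
    qed (simp add: erlang_density_def)
  qed
  also have "\<dots> \<le> ?l * ((1 - exp (- ?\<mu> * a)) / ?\<mu> + (b - a))"
    using integral_discounted_le[OF a \<mu>] l by simp
  finally show ?thesis using p by (simp add: mean_load_def mult.assoc)
qed

text \<open>Tasks of one dispatcher share interarrival times, so independence holds only between
  dispatchers; this is why \<open>load\<close> collects all tasks of a dispatcher.\<close>

lemma load_uncorrelated:
  assumes ij: "i \<in> feeders" "j \<in> feeders" "i \<noteq> j"
  shows "expectation (\<lambda>\<omega>. (load (conf \<omega>) i - c) * (load (conf \<omega>) j - d))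
       = expectation (\<lambda>\<omega>. load (conf \<omega>) i - c) * expectation (\<lambda>\<omega>. load (conf \<omega>) j - d)"
proof -
  define J where "J i = range (\<lambda>n. Interarrival (i, n)) \<union> range (\<lambda>n. Target (i, n))" for i
  have J: "J i \<inter> J j = {}" "J i \<subseteq> primitives Q N" "J j \<subseteq> primitives Q N"
    using ij feeder_task by (auto simp: J_def primitives_def)
  have eq: "load (config S (J i) \<omega>) i = load (conf \<omega>) i" if "J i \<subseteq> primitives Q N" for i \<omega>
  proof -
    have "config S (J i) \<omega> p = conf \<omega> p" if "p \<in> J i" for p
      using that \<open>J i \<subseteq> primitives Q N\<close> by (auto simp: config_def)
    then have "arr (config S (J i) \<omega>) (i, n) = arr (conf \<omega>) (i, n)"
      "config S (J i) \<omega> (Target (i, n)) = conf \<omega> (Target (i, n))" for n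
      by (auto simp: arr_def J_def)
    then show ?thesis by (simp add: load_def joins_def age_def)
  qed
  have "indep_var borel ((\<lambda>x. load x i - c) \<circ> config S (J i)) borel ((\<lambda>x. load x j - d) \<circ> config S (J j))"
    by (rule indep_var_compose[OF indep_config[OF indep J]]) measurable
  from indep_var_lebesgue_integral[OF this] show ?thesis
    using integrable_load[OF ij(1)] integrable_load[OF ij(2)] by (simp add: comp_def eq J)
qed

lemma load_variance:
  assumes y: "\<And>i. i \<in> feeders \<Longrightarrow> arr_rate Q i * b \<le> y"
  defines "e \<equiv> \<lambda>i. expectation (\<lambda>\<omega>. load (conf \<omega>) i)"
  shows "integrable (pspace S) (\<lambda>\<omega>. (\<Sum>i\<in>feeders. load (conf \<omega>) i - e i)\<^sup>2)"
    and "expectation (\<lambda>\<omega>. (\<Sum>i\<in>feeders. load (conf \<omega>) i - e i)\<^sup>2) \<le> card feeders * (2 * y * exp (2 * y))"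
proof -
  have e0: "0 \<le> e i" "e i \<le> L" if "i \<in> feeders" for i
    unfolding e_def using load_bounds[OF that] integrable_load[OF that]
    by (auto intro!: integral_nonneg_AE integral_le_const)
  have b: "\<bar>load x i - e i\<bar> \<le> L" if "i \<in> feeders" for i x
    using load_bounds[OF that, of x] e0[OF that] by (simp add: abs_le_iff)
  have int: "integrable (pspace S) (\<lambda>\<omega>. (load (conf \<omega>) i - e i) * (load (conf \<omega>) j - e j))"
    if "i \<in> feeders" "j \<in> feeders" for i j
  proof (rule integrable_bounded)
    show "\<bar>(load (conf \<omega>) i - e i) * (load (conf \<omega>) j - e j)\<bar> \<le> real L * real L" for \<omega>
      unfolding abs_mult using b[OF that(1)] b[OF that(2)] by (intro mult_mono) auto
  qed measurable
  have orth: "expectation (\<lambda>\<omega>. (load (conf \<omega>) i - e i) * (load (conf \<omega>) j - e j)) = 0"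
    if "i \<in> feeders" "j \<in> feeders" "i \<noteq> j" for i j
    unfolding load_uncorrelated[OF that]
    using integrable_load[OF that(1)] by (simp add: e_def prob_space)
  note sq = expectation_square_sum_orthogonal[of feeders "\<lambda>i \<omega>. load (conf \<omega>) i - e i", OF _ int orth]
  show "integrable (pspace S) (\<lambda>\<omega>. (\<Sum>i\<in>feeders. load (conf \<omega>) i - e i)\<^sup>2)"
    by (rule sq(1)) simp_all
  have "expectation (\<lambda>\<omega>. (\<Sum>i\<in>feeders. load (conf \<omega>) i - e i)\<^sup>2)
      = (\<Sum>i\<in>feeders. expectation (\<lambda>\<omega>. (load (conf \<omega>) i - e i)\<^sup>2))"
    by (rule sq(2)) simp_all
  also have "\<dots> \<le> (\<Sum>i\<in>feeders. 2 * y * exp (2 * y))"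
  proof (rule sum_mono)
    fix i assume i: "i \<in> feeders"
    have "(load x i)\<^sup>2 \<le> (real L)\<^sup>2" for x using load_bounds[OF i] by (intro power_mono) auto
    then have "integrable (pspace S) (\<lambda>\<omega>. (load (conf \<omega>) i)\<^sup>2)"
      by (intro integrable_bounded[of _ "(real L)\<^sup>2"]) auto
    then have "expectation (\<lambda>\<omega>. (load (conf \<omega>) i - e i)\<^sup>2) = expectation (\<lambda>\<omega>. (load (conf \<omega>) i)\<^sup>2) - (e i)\<^sup>2"
      using integrable_load[OF i] variance_eq[of "\<lambda>\<omega>. load (conf \<omega>) i"] by (simp add: e_def)
    then show "expectation (\<lambda>\<omega>. (load (conf \<omega>) i - e i)\<^sup>2) \<le> 2 * y * exp (2 * y)"
      using load_second_moment[OF i y[OF i]] zero_le_power2[of "e i"] by linarith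
  qed
  finally show "expectation (\<lambda>\<omega>. (\<Sum>i\<in>feeders. load (conf \<omega>) i - e i)\<^sup>2) \<le> card feeders * (2 * y * exp (2 * y))"
    by simp
qed

text \<open>The room \<open>2 * d\<close> is shared: if neither the noise nor the centred load
  reaches \<open>d\<close>, the count cannot exceed \<open>c\<close>. Each of the two gets a second
  moment bound.\<close>

lemma in_service_tail:
  assumes y: "\<And>i. i \<in> feeders \<Longrightarrow> arr_rate Q i * b \<le> y"
    and d: "0 < d" and c: "(\<Sum>i\<in>feeders. mean_load i) + 2 * d \<le> c"
  shows "\<P>(\<omega> in pspace S. c < in_service (conf \<omega>)) \<le> 2 * (card feeders * (2 * y * exp (2 * y)) / d\<^sup>2)"
proof -
  define e where "e i = expectation (\<lambda>\<omega>. load (conf \<omega>) i)" for i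
  let ?A = "{\<omega>\<in>space (pspace S). d \<le> (\<Sum>k\<in>feeders \<times> {..<L}. noise (conf \<omega>) k)}"
  let ?B = "{\<omega>\<in>space (pspace S). d \<le> (\<Sum>i\<in>feeders. load (conf \<omega>) i - e i)}"
  have "(\<Sum>i\<in>feeders. e i) \<le> (\<Sum>i\<in>feeders. mean_load i)"
    unfolding e_def by (intro sum_mono expectation_load_le)
  then have "d \<le> (\<Sum>k\<in>feeders \<times> {..<L}. noise x k) \<or> d \<le> (\<Sum>i\<in>feeders. load x i - e i)"
    if "c < in_service x" for x
    using in_service_le[of x] c that unfolding sum_subtractf by linarith
  then have "{\<omega>\<in>space (pspace S). c < in_service (conf \<omega>)} \<subseteq> ?A \<union> ?B" by blast
  then have "\<P>(\<omega> in pspace S. c < in_service (conf \<omega>)) \<le> prob (?A \<union> ?B)"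
    by (intro finite_measure_mono) measurable
  also have "\<dots> \<le> prob ?A + prob ?B" by (intro measure_Un_le) measurable
  also have "\<dots> \<le> card feeders * (2 * y * exp (2 * y)) / d\<^sup>2 + card feeders * (2 * y * exp (2 * y)) / d\<^sup>2"
    using noise_second_moment[of y] load_variance[of y] y d unfolding e_def[symmetric]
    by (intro add_mono prob_gt_le_second_moment) auto
  finally show ?thesis by (simp only: mult_2)
qed

end

section \<open>The pathwise argument\<close>

lemma card_le_of_labelled:
  assumes "finite W" "\<And>j. j \<in> J \<Longrightarrow> \<exists>l\<in>W. f l = j"
  shows "card J \<le> card W"
proof -
  have "J \<subseteq> f ` W" using assms(2) by blast
  then show ?thesis using assms(1) by (meson card_image_le card_mono finite_imageI le_trans)
qed

context jiq_run
begin

text \<open>What the pathwise argument uses about a realisation. The last clause confines the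
  arrivals up to \<open>T\<close> to finitely many tasks; with \<open>L\<close> fixed it holds only
  with high probability, the other clauses almost surely.\<close>

definition regular :: "real \<Rightarrow> nat \<Rightarrow> 'a \<Rightarrow> bool" where
  "regular T L \<omega> \<longleftrightarrow> (\<forall>k\<in>tasks Q N.
     jiq_assignment Q R N S k \<omega> \<and> fcfs_departure Q N S k \<omega> \<and>
     (\<forall>B. B \<subseteq> {1..N} \<and> B \<noteq> {} \<longrightarrow> pick S k B \<omega> \<in> B) \<and>
     target S k \<omega> \<in> {1..numM R} \<and> 0 < pmat R (disp_class Q R (fst k)) (target S k \<omega>) \<and>
     0 \<le> arrival S k \<omega> \<and> (arrival S k \<omega> \<le> T \<longrightarrow> snd k < L))"

text \<open>The set \<open>disps \<times> {..<L}\<close> of the window locale, available without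
  fixing a window.\<close>

definition task_set :: "nat \<Rightarrow> task set" where
  "task_set L = {i\<in>{1..num_disp Q N}. 0 < arr_rate Q i} \<times> {..<L}"

lemma task_set_props: "finite (task_set L)" "task_set L \<subseteq> tasks Q N"
  "k \<in> tasks Q N \<Longrightarrow> snd k < L \<Longrightarrow> k \<in> task_set L"
  by (auto simp: task_set_def tasks_def)

lemma class_rate_pos:
  assumes "k \<in> tasks Q N" "m \<in> {1..numM R}" "0 < pmat R (disp_class Q R (fst k)) m" "j \<in> serv_class Q R N m"
  shows "0 < serv_rate Q (fst k) j"
proof -
  note c = disp_class_mem[OF assms(1)]
  have "0 < mu_star Q R (disp_class Q R (fst k)) m" using assms by (intro mu_star_pos[OF fs sub c(1)])
  also have "\<dots> \<le> serv_rate Q (fst k) j"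
    unfolding serv_rate_def using assms(4) by (intro mu_star_nonneg_le(2)[OF fs sub c(1) assms(2) c(2)]) (auto simp: serv_class_def)
  finally show ?thesis .
qed

text \<open>The last claim is the characteristic feature of JIQ: a busy server is chosen only if the
  whole target class is busy. Nonempty classes guarantee that picks are made from nonempty
  sets.\<close>

lemma regular_props:
  assumes reg: "regular T L \<omega>" and ne: "\<forall>m\<in>{1..numM R}. serv_class Q R N m \<noteq> {}"
    and k: "k \<in> tasks Q N"
  shows "assigned S k \<omega> \<in> serv_class Q R N (target S k \<omega>)"
    and "0 < serv_rate Q (fst k) (assigned S k \<omega>)"
    and "arrival S k \<omega> \<le> T \<Longrightarrow> jiq_assign Q R N (task_set L) (conf \<omega>) k = assigned S k \<omega>"
    and "ahead Q N S (assigned S k \<omega>) k \<omega> = {} \<Longrightarrow>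
           departure S k \<omega> = arrival S k \<omega> + service S k (assigned S k \<omega>) \<omega>"
    and "ahead Q N S (assigned S k \<omega>) k \<omega> \<noteq> {} \<Longrightarrow> j \<in> serv_class Q R N (target S k \<omega>) \<Longrightarrow>
           ahead Q N S j k \<omega> \<noteq> {}"
proof -
  note r = reg[unfolded regular_def, rule_format]
  define V where "V = serv_class Q R N (target S k \<omega>)"
  define I where "I = {j\<in>V. ahead Q N S j k \<omega> = {}}"
  have V: "V \<subseteq> {1..N}" "V \<noteq> {}" using serv_class_subset[of Q R N] ne r[OF k] by (simp_all add: V_def)
  have as: "assigned S k \<omega> = pick S k (if I \<noteq> {} then I else V) \<omega>"
  proof -
    have "jiq_assignment Q R N S k \<omega>" using r[OF k] by blast
    then show ?thesis unfolding jiq_assignment_def Let_def V_def I_def .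
  qed
  have pick: "pick S k B \<omega> \<in> B" if "B \<subseteq> {1..N}" "B \<noteq> {}" for B using r[OF k] that by blast
  have IV: "I \<subseteq> V" by (auto simp: I_def)
  have mem: "assigned S k \<omega> \<in> (if I \<noteq> {} then I else V)"
    unfolding as using V IV by (intro pick) auto
  then show 1: "assigned S k \<omega> \<in> serv_class Q R N (target S k \<omega>)"
    using IV by (auto simp: V_def split: if_splits)
  show "0 < serv_rate Q (fst k) (assigned S k \<omega>)"
    using r[OF k] 1 by (intro class_rate_pos[OF k]) auto
  show "departure S k \<omega> = arrival S k \<omega> + service S k (assigned S k \<omega>) \<omega>"
    if "ahead Q N S (assigned S k \<omega>) k \<omega> = {}"
    using r[OF k] that by (simp add: fcfs_departure_def)
  show "ahead Q N S j k \<omega> \<noteq> {}"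
    if "ahead Q N S (assigned S k \<omega>) k \<omega> \<noteq> {}" "j \<in> serv_class Q R N (target S k \<omega>)"
    using mem that by (auto simp: I_def V_def split: if_splits)
  show "jiq_assign Q R N (task_set L) (conf \<omega>) k = assigned S k \<omega>" if "arrival S k \<omega> \<le> T"
  proof (rule jiq_iter_correct[OF task_set_props(1,2)])
    fix k assume k: "k \<in> tasks Q N"
    show "jiq_assignment Q R N S k \<omega> \<and> fcfs_departure Q N S k \<omega>" using r[OF k] by blast
    show "pick S k B \<omega> \<in> B" if "B \<subseteq> {1..N}" "B \<noteq> {}" for B using r[OF k] that by blast
    show "serv_class Q R N (target S k \<omega>) \<noteq> {}" using r[OF k] ne by blast
    show "0 < serv_rate Q (fst k) j" if "j \<in> serv_class Q R N (target S k \<omega>)" for j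
      using r[OF k] that by (intro class_rate_pos[OF k]) auto
    show "k \<in> task_set L" if "arrival S k \<omega> \<le> T" using r[OF k] that by (intro task_set_props(3)[OF k]) auto
  qed (use k that in auto)
qed

end

context jiq_window
begin

text \<open>\<open>W\<close> consists of the tasks which would be present at \<open>s\<close> if
  each were served on arrival. For such a task the summand of its own server in
  \<open>in_service\<close> equals 1.\<close>

lemma card_present_le:
  assumes reg: "regular T L \<omega>" and ne: "\<forall>m\<in>{1..numM R}. serv_class Q R N m \<noteq> {}"
    and s: "a \<le> s" "s \<le> b" "s \<le> T"
  defines "W \<equiv> {k\<in>tasks Q N. target S k \<omega> = m \<and> arrival S k \<omega> \<le> s \<and>
      s < arrival S k \<omega> + service S k (assigned S k \<omega>) \<omega>}"
  shows "finite W" "card W \<le> in_service (conf \<omega>)"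
proof -
  note r = reg[unfolded regular_def, rule_format]
  have W: "W \<subseteq> feeders \<times> {..<L}"
  proof
    fix k assume k: "k \<in> W"
    then have "snd k < L" using r[of k] s by (auto simp: W_def)
    moreover have "fst k \<in> feeders" using k r[of k] by (auto simp: W_def feeders_def disps_def tasks_def)
    ultimately show "k \<in> feeders \<times> {..<L}" by (cases k) auto
  qed
  then show fin: "finite W" by (rule finite_subset) simp
  define g where "g k = (\<Sum>j\<in>serv_class Q R N m.
     joins (conf \<omega>) k * of_bool (asg (conf \<omega>) k = j) * of_bool (age (conf \<omega>) k < conf \<omega> (Service k j)))" for k
  have g0: "0 \<le> g k" for k unfolding g_def using joins_bounds by (intro sum_nonneg) auto
  have "1 \<le> g k" if k: "k \<in> W" for k
  proof -
    have kt: "k \<in> tasks Q N" and kT: "arrival S k \<omega> \<le> T" and tm: "target S k \<omega> = m" using k s by (auto simp: W_def)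
    let ?j = "assigned S k \<omega>"
    note p = regular_props[OF reg ne kt]
    have j: "?j \<in> serv_class Q R N m" using p(1) tm by simp
    have asg: "asg (conf \<omega>) k = ?j" using p(3)[OF kT] by (simp add: asg_def disps_def task_set_def)
    have arr: "arr (conf \<omega>) k = arrival S k \<omega>" using kt by (intro arr_config) (auto simp: primitives_def)
    have "Target k \<in> primitives Q N" using kt by (simp add: primitives_def)
    then have "joins (conf \<omega>) k = 1" using k s tm arr by (simp add: joins_def W_def config_def)
    moreover have "?j \<in> {1..N}" using j serv_class_subset[of Q R N m] by (rule subsetD[rotated])
    then have "Service k ?j \<in> primitives Q N" using kt p(2) unfolding primitives_def by blast
    then have "age (conf \<omega>) k < conf \<omega> (Service k ?j)" using k s arr by (simp add: age_def W_def config_def)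
    ultimately have "1 = joins (conf \<omega>) k * of_bool (asg (conf \<omega>) k = ?j) * of_bool (age (conf \<omega>) k < conf \<omega> (Service k ?j))"
      using asg by simp
    also have "\<dots> \<le> g k" unfolding g_def using j joins_bounds by (intro member_le_sum) auto
    finally show ?thesis .
  qed
  then have "card W \<le> (\<Sum>k\<in>W. g k)" using sum_bounded_below[of W 1 g] by simp
  also have "\<dots> \<le> (\<Sum>k\<in>feeders \<times> {..<L}. g k)" using W g0 by (intro sum_mono2) auto
  finally show "card W \<le> in_service (conf \<omega>)" unfolding in_service_def g_def .
qed

end

context jiq_run
begin

text \<open>The window depends on the time at hand, so the count is needed as a function of
  \<open>a\<close> and \<open>b\<close>, outside the locale that fixes them.\<close>

definition occupancy :: "nat \<Rightarrow> nat \<Rightarrow> real \<Rightarrow> real \<Rightarrow> 'a \<Rightarrow> real" where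
  "occupancy m L a b \<omega> = jiq_window.in_service Q R N m L a b (conf \<omega>)"

text \<open>When the earliest offending task arrives, every server of its class holds a task which
  arrived strictly earlier and was thus itself served on arrival. These tasks sit at different
  servers and are all counted in \<open>occupancy\<close>, which would then reach the class size.
  The earliest offender may belong to any class, so \<open>occ\<close> is assumed for all of
  them.\<close>

lemma never_assigned_to_busy:
  assumes reg: "regular T L \<omega>" and ne: "\<forall>m\<in>{1..numM R}. serv_class Q R N m \<noteq> {}"
    and occ: "\<And>m s. m \<in> {1..numM R} \<Longrightarrow> 0 \<le> s \<Longrightarrow> s \<le> T \<Longrightarrow>
       \<exists>a b. 0 \<le> a \<and> a \<le> s \<and> s \<le> b \<and> occupancy m L a b \<omega> < card (serv_class Q R N m)"
    and k: "k \<in> tasks Q N" "arrival S k \<omega> \<le> T"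
  shows "\<not> assigned_to_busy Q N S k \<omega>"
proof
  define Bad where "Bad = {k\<in>tasks Q N. arrival S k \<omega> \<le> T \<and> assigned_to_busy Q N S k \<omega>}"
  note r = reg[unfolded regular_def, rule_format]
  have "Bad \<subseteq> task_set L" using r task_set_props(3) by (auto simp: Bad_def)
  then have fin: "finite Bad" using task_set_props(1) finite_subset by blast
  assume "assigned_to_busy Q N S k \<omega>"
  then have "Bad \<noteq> {}" using k unfolding Bad_def by blast
  then obtain k0 where k0: "k0 \<in> Bad" and min: "\<And>l. l \<in> Bad \<Longrightarrow> arrival S k0 \<omega> \<le> arrival S l \<omega>"
    using ex_min_if_finite[of "(\<lambda>k. arrival S k \<omega>) ` Bad"] fin by (auto simp: not_less)
  define m where "m = target S k0 \<omega>"
  define s where "s = arrival S k0 \<omega>"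
  have kt: "k0 \<in> tasks Q N" and sT: "s \<le> T" and bad: "ahead Q N S (assigned S k0 \<omega>) k0 \<omega> \<noteq> {}"
    using k0 by (auto simp: Bad_def s_def assigned_to_busy_def)
  have m: "m \<in> {1..numM R}" and s0: "0 \<le> s" using r[OF kt] by (auto simp: m_def s_def)
  obtain a b where ab: "0 \<le> a" "a \<le> s" "s \<le> b" "occupancy m L a b \<omega> < card (serv_class Q R N m)"
    using occ[OF m s0 sT] by blast
  interpret w: jiq_window Q R N S m L a b by unfold_locales (use m ab in auto)
  let ?W = "{k\<in>tasks Q N. target S k \<omega> = m \<and> arrival S k \<omega> \<le> s \<and>
      s < arrival S k \<omega> + service S k (assigned S k \<omega>) \<omega>}"
  note W = w.card_present_le[OF reg ne ab(2,3) sT]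
  have "\<exists>l\<in>?W. assigned S l \<omega> = j" if j: "j \<in> serv_class Q R N m" for j
  proof -
    obtain l where l: "l \<in> ahead Q N S j k0 \<omega>"
      using regular_props(5)[OF reg ne kt bad, of j] j by (auto simp: m_def)
    then have lt: "l \<in> tasks Q N" and la: "assigned S l \<omega> = j" "arrival S l \<omega> < s" "s < departure S l \<omega>"
      by (auto simp: ahead_def s_def)
    have "l \<notin> Bad" using min[of l] la by (auto simp: s_def)
    then have "ahead Q N S (assigned S l \<omega>) l \<omega> = {}" using lt la sT by (auto simp: Bad_def assigned_to_busy_def)
    from regular_props(4)[OF reg ne lt this] have "s < arrival S l \<omega> + service S l (assigned S l \<omega>) \<omega>" using la by simp
    moreover have "target S l \<omega> = m"
      using regular_props(1)[OF reg ne lt] r[OF lt] m j la(1) by (intro serv_class_unique[OF fs sub]) auto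
    ultimately show ?thesis using lt la by (intro bexI[of _ l]) auto
  qed
  then have "card (serv_class Q R N m) \<le> card ?W"
    using W(1) by (intro card_le_of_labelled[where f="\<lambda>l. assigned S l \<omega>"]) auto
  then show False using W(2) ab(4) unfolding occupancy_def by linarith
qed

lemma busy_le_occupancy:
  assumes reg: "regular T L \<omega>" and ne: "\<forall>m\<in>{1..numM R}. serv_class Q R N m \<noteq> {}"
    and idle: "\<And>k. k \<in> tasks Q N \<Longrightarrow> arrival S k \<omega> \<le> T \<Longrightarrow> \<not> assigned_to_busy Q N S k \<omega>"
    and m: "m \<in> {1..numM R}" and s: "0 \<le> a" "a \<le> s" "s \<le> b" "s \<le> T"
  shows "card {j\<in>serv_class Q R N m. queue Q N S j s \<omega> \<noteq> {}} \<le> occupancy m L a b \<omega>"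
proof -
  note r = reg[unfolded regular_def, rule_format]
  interpret w: jiq_window Q R N S m L a b by unfold_locales (use m s in auto)
  let ?W = "{k\<in>tasks Q N. target S k \<omega> = m \<and> arrival S k \<omega> \<le> s \<and>
      s < arrival S k \<omega> + service S k (assigned S k \<omega>) \<omega>}"
  note W = w.card_present_le[OF reg ne s(2-4)]
  have "\<exists>l\<in>?W. assigned S l \<omega> = j" if j: "j \<in> serv_class Q R N m" "queue Q N S j s \<omega> \<noteq> {}" for j
  proof -
    obtain l where l: "l \<in> queue Q N S j s \<omega>" using j by auto
    then have lt: "l \<in> tasks Q N" and la: "assigned S l \<omega> = j" "arrival S l \<omega> \<le> s" "s < departure S l \<omega>"
      by (auto simp: queue_def)
    have "ahead Q N S (assigned S l \<omega>) l \<omega> = {}" using idle[OF lt] la s by (auto simp: assigned_to_busy_def)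
    from regular_props(4)[OF reg ne lt this] have "s < arrival S l \<omega> + service S l (assigned S l \<omega>) \<omega>" using la by simp
    moreover have "target S l \<omega> = m"
      using regular_props(1)[OF reg ne lt] r[OF lt] m j la(1) by (intro serv_class_unique[OF fs sub]) auto
    ultimately show ?thesis using lt la by (intro bexI[of _ l]) auto
  qed
  then have "card {j\<in>serv_class Q R N m. queue Q N S j s \<omega> \<noteq> {}} \<le> card ?W"
    using W(1) by (intro card_le_of_labelled[where f="\<lambda>l. assigned S l \<omega>"]) auto
  then show ?thesis using W(2) unfolding occupancy_def by linarith
qed

section \<open>Almost sure regularity of the paths\<close>

lemma AE_mem_of_sum_prob:
  fixes X :: "'a \<Rightarrow> nat"
  assumes X: "(\<lambda>\<omega>. real (X \<omega>)) \<in> borel_measurable (pspace S)" and J: "finite J"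
    and p: "\<And>j. j \<in> J \<Longrightarrow> \<P>(\<omega> in pspace S. X \<omega> = j) = p j" and sum: "sum p J = 1"
  shows "AE \<omega> in pspace S. X \<omega> \<in> J"
proof -
  have meas: "{\<omega>\<in>space (pspace S). X \<omega> = j} \<in> sets (pspace S)" for j
  proof -
    have "{\<omega>\<in>space (pspace S). X \<omega> = j} = {\<omega>\<in>space (pspace S). real (X \<omega>) = real j}" by auto
    also have "\<dots> \<in> sets (pspace S)" using X by measurable
    finally show ?thesis .
  qed
  have "prob (\<Union>j\<in>J. {\<omega>\<in>space (pspace S). X \<omega> = j}) = (\<Sum>j\<in>J. \<P>(\<omega> in pspace S. X \<omega> = j))"
    using meas J by (intro finite_measure_finite_Union) (auto simp: disjoint_family_on_def)
  also have "\<dots> = 1" using p sum by simp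
  finally have "AE \<omega> in pspace S. \<omega> \<in> (\<Union>j\<in>J. {\<omega>\<in>space (pspace S). X \<omega> = j})"
    using meas J by (subst (asm) prob_eq_1) auto
  then show ?thesis by (auto elim: eventually_mono)
qed

lemma prim_var_measurable: "p \<in> primitives Q N \<Longrightarrow> prim_var S p \<in> borel_measurable (pspace S)"
  using indep by (auto simp: indep_vars_def)

text \<open>Interarrival times are almost surely positive, so once task \<open>L\<close> of a
  dispatcher arrives after \<open>T\<close>, all its later tasks do. There are countably many tasks
  and finitely many sets \<open>B\<close>, so the exceptional null sets can be united.\<close>

lemma AE_regular:
  "AE \<omega> in pspace S. (\<forall>i\<in>{1..num_disp Q N}. 0 < arr_rate Q i \<longrightarrow> T < arr (conf \<omega>) (i, L)) \<longrightarrow> regular T L \<omega>"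
proof -
  have 1: "AE \<omega> in pspace S. \<forall>k\<in>tasks Q N. jiq_assignment Q R N S k \<omega> \<and> fcfs_departure Q N S k \<omega>"
    using sys by (simp add: jiq_system_def)
  have 2: "AE \<omega> in pspace S. \<forall>k\<in>tasks Q N. \<forall>B\<in>Pow {1..N} - {{}}. pick S k B \<omega> \<in> B"
  proof (intro AE_ball_countable[THEN iffD2] ballI)
    fix k B assume k: "k \<in> tasks Q N" and B: "B \<in> Pow {1..N} - {{}}"
    have fin: "finite B" using B finite_subset by auto
    show "AE \<omega> in pspace S. pick S k B \<omega> \<in> B"
    proof (rule AE_mem_of_sum_prob)
      have "Pick k B \<in> primitives Q N" using k B unfolding primitives_def by blast
      from prim_var_measurable[OF this] show "(\<lambda>\<omega>. real (pick S k B \<omega>)) \<in> borel_measurable (pspace S)" by simp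
      show "\<P>(\<omega> in pspace S. pick S k B \<omega> = j) = 1 / real (card B)" if "j \<in> B" for j
        using B that by (intro laws(4)[OF k]) auto
      show "(\<Sum>j\<in>B. 1 / real (card B)) = 1" using B fin by simp
    qed (rule fin)
  qed (auto intro: countable_finite)
  have 3: "AE \<omega> in pspace S. \<forall>k\<in>tasks Q N. target S k \<omega> \<in> {m\<in>{1..numM R}. 0 < pmat R (disp_class Q R (fst k)) m}"
  proof (intro AE_ball_countable[THEN iffD2] ballI)
    fix k assume k: "k \<in> tasks Q N"
    let ?h = "disp_class Q R (fst k)"
    note c = disp_class_mem[OF k]
    show "AE \<omega> in pspace S. target S k \<omega> \<in> {m\<in>{1..numM R}. 0 < pmat R ?h m}"
    proof (rule AE_mem_of_sum_prob)
      have "Target k \<in> primitives Q N" using k unfolding primitives_def by blast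
      from prim_var_measurable[OF this] show "(\<lambda>\<omega>. real (target S k \<omega>)) \<in> borel_measurable (pspace S)" by simp
      show "\<P>(\<omega> in pspace S. target S k \<omega> = j) = pmat R ?h j" if "j \<in> {m\<in>{1..numM R}. 0 < pmat R ?h m}" for j
        using that by (intro laws(2)[OF k c]) auto
      have nn: "\<forall>m\<in>{1..numM R}. 0 \<le> pmat R ?h m" and one: "(\<Sum>m\<in>{1..numM R}. pmat R ?h m) = 1"
        using sub c(1) unfolding subcritical_def by auto
      have "(\<Sum>m\<in>{m\<in>{1..numM R}. 0 < pmat R ?h m}. pmat R ?h m) = (\<Sum>m\<in>{1..numM R}. pmat R ?h m)"
        using nn by (intro sum.mono_neutral_left) force+
      then show "(\<Sum>m\<in>{m\<in>{1..numM R}. 0 < pmat R ?h m}. pmat R ?h m) = 1" using one by simp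
    qed simp
  qed auto
  have 4: "AE \<omega> in pspace S. \<forall>k\<in>tasks Q N. 0 < interarrival S k \<omega>"
  proof (intro AE_ball_countable[THEN iffD2] ballI)
    fix k assume k: "k \<in> tasks Q N"
    have [measurable]: "interarrival S k \<in> borel_measurable (pspace S)"
      using distributed_measurable[OF laws(1)[OF k]] by simp
    have "\<P>(\<omega> in pspace S. 0 < interarrival S k \<omega>) = 1"
      using exponential_distributedD_gt[OF laws(1)[OF k], of 0] tasks_ge1(2)[OF k] by simp
    then show "AE \<omega> in pspace S. 0 < interarrival S k \<omega>"
      by (subst (asm) prob_Collect_eq_1) auto
  qed auto
  from 1 2 3 4 show ?thesis
  proof eventually_elim
    case (elim \<omega>)
    have mono: "arrival S (i, n) \<omega> \<le> arrival S (i, n') \<omega>" if "(i, n) \<in> tasks Q N" "n \<le> n'" for i n n'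
      using that elim(4) tasks_prefix[OF that(1)] unfolding arrival_def fst_conv snd_conv
      by (intro sum_mono2) (auto intro: less_imp_le)
    show ?case
    proof
      assume T: "\<forall>i\<in>{1..num_disp Q N}. 0 < arr_rate Q i \<longrightarrow> T < arr (conf \<omega>) (i, L)"
      have "0 \<le> arrival S k \<omega>" if "k \<in> tasks Q N" for k
        unfolding arrival_def using elim(4) tasks_prefix[of "fst k" "snd k"] that by (intro sum_nonneg) (auto intro: less_imp_le)
      moreover have "snd k < L" if k: "k \<in> tasks Q N" and le: "arrival S k \<omega> \<le> T" for k
      proof (rule ccontr)
        assume "\<not> snd k < L"
        have kL: "(fst k, L) \<in> tasks Q N" using k by (auto simp: tasks_def)
        have "T < arr (conf \<omega>) (fst k, L)" using T k by (auto simp: tasks_def)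
        also have "\<dots> = arrival S (fst k, L) \<omega>" using kL by (intro arr_config) (auto simp: primitives_def)
        also have "\<dots> \<le> arrival S k \<omega>" using mono[OF kL, of "snd k"] \<open>\<not> snd k < L\<close> by simp
        finally show False using le by simp
      qed
      ultimately show "regular T L \<omega>" using elim(1-3) unfolding regular_def by blast
    qed
  qed
qed

section \<open>Measurability of the supremum of the busy fraction\<close>

lemma arrival_measurable: "k \<in> tasks Q N \<Longrightarrow> arrival S k \<in> borel_measurable (pspace S)"
proof -
  assume k: "k \<in> tasks Q N"
  have "arrival S k = (\<lambda>\<omega>. arr (conf \<omega>) k)"
    using k by (intro ext arr_config[symmetric]) (auto simp: primitives_def)
  then show ?thesis by simp
qed

text \<open>Random times are allowed because the fraction will be evaluated at arrival
  times.\<close>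

lemma busy_fraction_measurable:
  assumes \<tau>[measurable]: "\<tau> \<in> borel_measurable (pspace S)"
  shows "(\<lambda>\<omega>. busy_fraction Q R N S m (\<tau> \<omega>) \<omega>) \<in> borel_measurable (pspace S)"
proof -
  have pr: "Measurable.pred (pspace S) (\<lambda>\<omega>. k \<in> queue Q N S j (\<tau> \<omega>) \<omega>)" for k j
  proof (cases "k \<in> tasks Q N")
    case True
    have [measurable]: "assigned S k \<in> pspace S \<rightarrow>\<^sub>M count_space UNIV" "departure S k \<in> borel_measurable (pspace S)"
      "arrival S k \<in> borel_measurable (pspace S)"
      using sys True arrival_measurable by (auto simp: jiq_system_def)
    show ?thesis using True unfolding queue_def by simp
  qed (simp add: queue_def)
  have "Measurable.pred (pspace S) (\<lambda>\<omega>. \<exists>k. k \<in> queue Q N S j (\<tau> \<omega>) \<omega>)" for j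
    using pr by (intro pred_intros_countable)
  then have [measurable]: "Measurable.pred (pspace S) (\<lambda>\<omega>. queue Q N S j (\<tau> \<omega>) \<omega> \<noteq> {})" for j
    by (simp only: ex_in_conv)
  have "busy_fraction Q R N S m (\<tau> \<omega>) \<omega> = (\<Sum>j\<in>serv_class Q R N m. of_bool (queue Q N S j (\<tau> \<omega>) \<omega> \<noteq> {})) / real N" for \<omega>
  proof -
    have "finite (serv_class Q R N m)" by (auto simp: serv_class_def)
    then have "real (card {j\<in>serv_class Q R N m. queue Q N S j (\<tau> \<omega>) \<omega> \<noteq> {}})
       = (\<Sum>j\<in>serv_class Q R N m. of_bool (queue Q N S j (\<tau> \<omega>) \<omega> \<noteq> {}))"
      by (simp add: of_bool_def sum.If_cases Int_def)
    then show ?thesis by (simp only: busy_fraction_def)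
  qed
  then show ?thesis by simp
qed

text \<open>The number of busy servers only grows at arrival times, which reduces the
  uncountable supremum to a countable one.\<close>

lemma busy_fraction_gt_iff:
  assumes T: "0 \<le> T"
  shows "(\<exists>t\<in>{0..T}. c < busy_fraction Q R N S m t \<omega>) \<longleftrightarrow>
    c < busy_fraction Q R N S m 0 \<omega> \<or>
    (\<exists>k. k \<in> tasks Q N \<and> 0 \<le> arrival S k \<omega> \<and> arrival S k \<omega> \<le> T \<and> c < busy_fraction Q R N S m (arrival S k \<omega>) \<omega>)"
    (is "?l \<longleftrightarrow> ?r")
proof
  assume ?l
  then obtain t where t: "0 \<le> t" "t \<le> T" "c < busy_fraction Q R N S m t \<omega>" by auto
  define J where "J = {j\<in>serv_class Q R N m. queue Q N S j t \<omega> \<noteq> {}}"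
  have fJ: "finite J" by (auto simp: J_def serv_class_def)
  have "\<forall>j\<in>J. \<exists>k. k \<in> queue Q N S j t \<omega>" by (auto simp: J_def)
  then obtain w where w: "\<And>j. j \<in> J \<Longrightarrow> w j \<in> queue Q N S j t \<omega>" by metis
  \<comment> \<open>The latest arrival among one witness task per busy server: at that moment all
    these servers are already busy, since the witnesses have arrived and leave only after
    \<open>t\<close>. The extra 0 covers an empty \<open>J\<close> and keeps the maximum nonnegative
    on every path.\<close>
  define A where "A = insert 0 ((\<lambda>j. arrival S (w j) \<omega>) ` J)"
  have "Max A \<in> A" using fJ by (intro Max_in) (auto simp: A_def)
  have up: "x \<le> Max A" if "x \<in> A" for x using fJ that by (intro Max_ge) (auto simp: A_def)
  have le: "Max A \<le> t" using \<open>Max A \<in> A\<close> w t by (auto simp: A_def queue_def)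
  have "w j \<in> queue Q N S j (Max A) \<omega>" if "j \<in> J" for j
    using w[OF that] up[of "arrival S (w j) \<omega>"] le that by (auto simp: queue_def A_def)
  then have "J \<subseteq> {j\<in>serv_class Q R N m. queue Q N S j (Max A) \<omega> \<noteq> {}}" by (auto simp: J_def)
  then have "card J \<le> card {j\<in>serv_class Q R N m. queue Q N S j (Max A) \<omega> \<noteq> {}}"
    by (intro card_mono) (auto simp: serv_class_def)
  then have "busy_fraction Q R N S m t \<omega> \<le> busy_fraction Q R N S m (Max A) \<omega>"
    unfolding busy_fraction_def J_def[symmetric] by (intro divide_right_mono) auto
  then have gt: "c < busy_fraction Q R N S m (Max A) \<omega>" using t by simp
  show ?r
  proof (cases "Max A = 0")
    case False
    then obtain j where "j \<in> J" "Max A = arrival S (w j) \<omega>" using \<open>Max A \<in> A\<close> by (auto simp: A_def)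
    moreover have "0 \<le> Max A" using up[of 0] by (simp add: A_def)
    moreover have "w j \<in> tasks Q N" using w[OF \<open>j \<in> J\<close>] by (simp add: queue_def)
    ultimately show ?thesis using gt le t by (intro disjI2 exI[of _ "w j"]) simp
  qed (use gt in simp)
next
  assume ?r then show ?l using T by (auto intro: bexI[of _ 0])
qed

text \<open>The probability of this event is later bounded from below by monotonicity, which
  requires the larger set to be measurable.\<close>

lemma busy_event_measurable:
  assumes T: "0 \<le> T"
  shows "{\<omega>\<in>space (pspace S). (SUP t\<in>{0..T}. ennreal (busy_fraction Q R N S m t \<omega>)) \<le> ennreal c} \<in> sets (pspace S)"
proof -
  have eq: "((SUP t\<in>{0..T}. ennreal (busy_fraction Q R N S m t \<omega>)) \<le> ennreal c) \<longleftrightarrow>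
    \<not> (\<exists>t\<in>{0..T}. max 0 c < busy_fraction Q R N S m t \<omega>)" for \<omega>
  proof -
    have "ennreal c = ennreal (max 0 c)" by (simp add: max_def ennreal_neg)
    then have "ennreal (busy_fraction Q R N S m t \<omega>) \<le> ennreal c \<longleftrightarrow> busy_fraction Q R N S m t \<omega> \<le> max 0 c" for t
      using ennreal_le_iff[of "max 0 c"] by simp
    then show ?thesis by (auto simp: SUP_le_iff not_less)
  qed
  have "Measurable.pred (pspace S) (\<lambda>\<omega>. k \<in> tasks Q N \<and> 0 \<le> arrival S k \<omega> \<and> arrival S k \<omega> \<le> T \<and>
      max 0 c < busy_fraction Q R N S m (arrival S k \<omega>) \<omega>)" for k
  proof (cases "k \<in> tasks Q N")
    case True
    note [measurable] = arrival_measurable[OF True] busy_fraction_measurable[OF arrival_measurable[OF True]]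
    show ?thesis using True by simp
  qed simp
  then have [measurable]: "Measurable.pred (pspace S) (\<lambda>\<omega>. \<exists>k. k \<in> tasks Q N \<and> 0 \<le> arrival S k \<omega> \<and> arrival S k \<omega> \<le> T \<and>
      max 0 c < busy_fraction Q R N S m (arrival S k \<omega>) \<omega>)"
    by (intro pred_intros_countable)
  note [measurable] = busy_fraction_measurable[of "\<lambda>_. 0"]
  show ?thesis unfolding eq busy_fraction_gt_iff[OF T] by measurable
qed

end

section \<open>One system\<close>

context jiq_run
begin

definition crowded :: "nat \<Rightarrow> nat \<Rightarrow> real \<Rightarrow> nat \<Rightarrow> real \<Rightarrow> nat \<Rightarrow> 'a set" where
  "crowded m L T n c r = {\<omega>\<in>space (pspace S). c < occupancy m L (T * r / n) (T * Suc r / n) \<omega>}"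

text \<open>On this event the first \<open>L\<close> tasks of dispatcher \<open>i\<close> do not
  exhaust its arrivals up to \<open>T\<close>, so the truncation fails.\<close>

definition late :: "nat \<Rightarrow> real \<Rightarrow> nat \<Rightarrow> 'a set" where
  "late L T i = {\<omega>\<in>space (pspace S). arr (conf \<omega>) (i, L) \<le> T}"

lemma window:
  assumes "m \<in> {1..numM R}" "0 \<le> T"
  shows "jiq_window Q R N S m (T * real r / real n) (T * real (Suc r) / real n)"
  using assms by unfold_locales (auto intro!: divide_right_mono mult_left_mono)

lemma crowded_measurable:
  assumes "m \<in> {1..numM R}" "0 \<le> T"
  shows "crowded m L T n c r \<in> sets (pspace S)"
proof -
  interpret w: jiq_window Q R N S m L "T * real r / real n" "T * real (Suc r) / real n"
    by (rule window[OF assms])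
  show ?thesis unfolding crowded_def occupancy_def by measurable
qed

lemma late_measurable: "late L T i \<in> sets (pspace S)"
  unfolding late_def by measurable

lemma prob_late_le:
  assumes i: "i \<in> {1..num_disp Q N}" "0 < arr_rate Q i" and T: "0 \<le> T" and y: "arr_rate Q i * T \<le> y"
  shows "prob (late L T i) \<le> y * (y ^ L / fact L)"
proof -
  have k: "(i, L) \<in> tasks Q N" using i by (auto simp: tasks_def)
  have "prob (late L T i) = expectation (indicator (late L T i))"
    using late_measurable by simp
  also have "\<dots> = expectation (\<lambda>\<omega>. of_bool (arr (conf \<omega>) (i, L) \<le> T))"
    by (intro Bochner_Integration.integral_cong) (auto simp: late_def indicator_def)
  also have "\<dots> \<le> arr_rate Q i * T * (arr_rate Q i * T) ^ L / fact L"
    by (rule expectation_arr_le[OF k T])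
  also have "\<dots> \<le> y * y ^ L / fact L"
    using i T y by (intro divide_right_mono mult_mono power_mono) (auto intro: order_trans[OF _ y])
  finally show ?thesis by simp
qed

text \<open>The transient mean grows with \<open>a\<close> and every window lies in [0, T], so one
  bound serves all windows. The mesh enters only through \<open>T / n\<close>, the length in which
  arrivals are counted in full, and the second moment constant depends on
  \<open>\<Lambda> * T\<close> alone.\<close>

lemma prob_crowded_le:
  assumes m: "m \<in> {1..numM R}" and T: "0 \<le> T" and r: "r < n"
    and rate: "\<And>i. 1 \<le> i \<Longrightarrow> 0 \<le> arr_rate Q i \<and> arr_rate Q i \<le> \<Lambda>"
    and d: "0 < d"
    and c: "(\<Sum>h\<in>{1..numH R}. pmat R h m * ((1 - exp (- mu_star Q R h m * T)) / mu_star Q R h m + T / n) *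
        (\<Sum>i | i \<in> {1..num_disp Q N} \<and> disp_pos Q i \<in> wcell R h. arr_rate Q i)) + 2 * d \<le> c"
  shows "prob (crowded m L T n c r) \<le> 2 * (num_disp Q N * (2 * (\<Lambda> * T) * exp (2 * (\<Lambda> * T))) / d\<^sup>2)"
proof -
  let ?a = "T * real r / real n" and ?b = "T * real (Suc r) / real n"
  interpret w: jiq_window Q R N S m L ?a ?b by (rule window[OF m T])
  have aT: "?a \<le> T" "?b \<le> T"
  proof -
    have "T * real (Suc r) \<le> T * real n" using T r by (intro mult_left_mono) auto
    then show bT: "?b \<le> T" using r by (simp add: field_simps)
    show "?a \<le> T" using w.a bT by linarith
  qed
  have ba: "?b - ?a = T / n" by (simp add: distrib_left add_divide_distrib)
  define f where "f i = pmat R (disp_class Q R i) m * ((1 - exp (- mu_star Q R (disp_class Q R i) m * T)) / mu_star Q R (disp_class Q R i) m + T / n) *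
    arr_rate Q i" for i
  have dc: "disp_class Q R i \<in> {1..numH R}" if "1 \<le> i" for i using disp_class_iff[OF fs sub that] by blast
  have f0: "0 \<le> f i" if "1 \<le> i" for i
    unfolding f_def
    using rate[OF that] dc[OF that] m T sub mu_star_nonneg_le(1)[OF fs sub dc[OF that] m]
    by (intro mult_nonneg_nonneg add_nonneg_nonneg divide_nonneg_nonneg) (auto simp: subcritical_def)
  have "w.mean_load i \<le> f i" if i: "i \<in> w.feeders" for i
  proof -
    let ?\<mu> = "mu_star Q R (disp_class Q R i) m"
    have \<mu>: "0 < ?\<mu>" by (rule w.feeder_rate(1)[OF i])
    have "(1 - exp (- ?\<mu> * ?a)) / ?\<mu> + (?b - ?a) \<le> (1 - exp (- ?\<mu> * T)) / ?\<mu> + T / n"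
    proof -
      have "?\<mu> * ?a \<le> ?\<mu> * T" using \<mu> aT(1) by (intro mult_left_mono) auto
      then have "exp (- ?\<mu> * T) \<le> exp (- ?\<mu> * ?a)" by (simp only: exp_le_cancel_iff mult_minus_left neg_le_iff_le)
      then show ?thesis unfolding ba using \<mu> by (intro add_right_mono divide_right_mono) auto
    qed
    then have "pmat R (disp_class Q R i) m * arr_rate Q i * ((1 - exp (- ?\<mu> * ?a)) / ?\<mu> + (?b - ?a))
        \<le> pmat R (disp_class Q R i) m * arr_rate Q i * ((1 - exp (- ?\<mu> * T)) / ?\<mu> + T / n)"
      using i by (intro mult_left_mono) (auto simp: w.feeders_def w.disps_def)
    then show ?thesis unfolding w.mean_load_def f_def by (simp only: mult_ac)
  qed
  then have "(\<Sum>i\<in>w.feeders. w.mean_load i) \<le> (\<Sum>i\<in>w.feeders. f i)" by (rule sum_mono)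
  also have "\<dots> \<le> (\<Sum>i\<in>{1..num_disp Q N}. f i)"
    using f0 by (intro sum_mono2) (auto simp: w.feeders_def w.disps_def)
  also have "\<dots> = (\<Sum>h\<in>{1..numH R}. \<Sum>i | i \<in> {1..num_disp Q N} \<and> disp_class Q R i = h. f i)"
    using dc by (intro sum.group[symmetric]) auto
  also have "\<dots> = (\<Sum>h\<in>{1..numH R}. pmat R h m * ((1 - exp (- mu_star Q R h m * T)) / mu_star Q R h m + T / n) *
        (\<Sum>i | i \<in> {1..num_disp Q N} \<and> disp_pos Q i \<in> wcell R h. arr_rate Q i))"
  proof (intro sum.cong refl)
    fix h assume h: "h \<in> {1..numH R}"
    have "{i. i \<in> {1..num_disp Q N} \<and> disp_class Q R i = h} = {i. i \<in> {1..num_disp Q N} \<and> disp_pos Q i \<in> wcell R h}"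
      using disp_class_iff[OF fs sub, of _ h] h by auto
    moreover have "(\<Sum>i | i \<in> {1..num_disp Q N} \<and> disp_class Q R i = h. f i) =
      pmat R h m * ((1 - exp (- mu_star Q R h m * T)) / mu_star Q R h m + T / n) *
        (\<Sum>i | i \<in> {1..num_disp Q N} \<and> disp_class Q R i = h. arr_rate Q i)"
      unfolding sum_distrib_left by (intro sum.cong) (auto simp: f_def)
    ultimately show "(\<Sum>i | i \<in> {1..num_disp Q N} \<and> disp_class Q R i = h. f i) =
      pmat R h m * ((1 - exp (- mu_star Q R h m * T)) / mu_star Q R h m + T / n) *
        (\<Sum>i | i \<in> {1..num_disp Q N} \<and> disp_pos Q i \<in> wcell R h. arr_rate Q i)" by simp
  qed
  finally have sum: "(\<Sum>i\<in>w.feeders. w.mean_load i) + 2 * d \<le> c" using c by linarith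
  have y: "arr_rate Q i * ?b \<le> \<Lambda> * T" if "i \<in> w.feeders" for i
    using rate[of i] that aT(2) w.a by (intro mult_mono) (auto simp: w.feeders_def w.disps_def)
  have "0 \<le> \<Lambda>" using rate[of 1] by auto
  have "prob (crowded m L T n c r) \<le> 2 * (card w.feeders * (2 * (\<Lambda> * T) * exp (2 * (\<Lambda> * T))) / d\<^sup>2)"
    using w.in_service_tail[OF y d sum] by (simp add: crowded_def occupancy_def)
  also have "\<dots> \<le> 2 * (num_disp Q N * (2 * (\<Lambda> * T) * exp (2 * (\<Lambda> * T))) / d\<^sup>2)"
  proof -
    have "card w.feeders \<le> card {1..num_disp Q N}" by (intro card_mono) (auto simp: w.feeders_def w.disps_def)
    then show ?thesis
      using \<open>0 \<le> \<Lambda>\<close> T by (intro mult_left_mono divide_right_mono mult_right_mono) auto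
  qed
  finally show ?thesis .
qed

text \<open>Such a class has limiting fraction 0, which leaves no margin for a second moment bound;
  it is settled by having nothing to count.\<close>

lemma no_feeder_not_crowded:
  assumes m: "m \<in> {1..numM R}" and T: "0 \<le> T" and p: "\<And>h. h \<in> {1..numH R} \<Longrightarrow> pmat R h m = 0" and c: "0 \<le> c"
  shows "crowded m L T n c r = {}"
proof -
  interpret w: jiq_window Q R N S m L "T * real r / real n" "T * real (Suc r) / real n" by (rule window[OF m T])
  have "w.feeders = {}"
  proof -
    have False if i: "i \<in> w.feeders" for i
      using p[OF disp_class_mem(1)[OF w.feeder_task[OF i, of 0]]] i by (simp add: w.feeders_def)
    then show ?thesis by blast
  qed
  then have "w.in_service x = 0" for x unfolding w.in_service_def by simp
  then show ?thesis using c unfolding crowded_def occupancy_def by simp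
qed

definition bad :: "nat \<Rightarrow> real \<Rightarrow> nat \<Rightarrow> (nat \<Rightarrow> real) \<Rightarrow> 'a set" where
  "bad L T n c = (\<Union>m\<in>{1..numM R}. \<Union>r<n. crowded m L T n (c m) r) \<union>
     (\<Union>i\<in>{i\<in>{1..num_disp Q N}. 0 < arr_rate Q i}. late L T i)"

lemma bad_measurable: "0 \<le> T \<Longrightarrow> bad L T n c \<in> sets (pspace S)"
  unfolding bad_def using crowded_measurable late_measurable
  by (intro sets.Un sets.finite_UN) auto

lemma prob_bad_le:
  assumes "0 \<le> T"
  shows "prob (bad L T n c) \<le> (\<Sum>m\<in>{1..numM R}. \<Sum>r<n. prob (crowded m L T n (c m) r)) +
    (\<Sum>i\<in>{i\<in>{1..num_disp Q N}. 0 < arr_rate Q i}. prob (late L T i))"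
proof -
  have 1: "prob (\<Union>r<n. crowded m L T n (c m) r) \<le> (\<Sum>r<n. prob (crowded m L T n (c m) r))" if "m \<in> {1..numM R}" for m
    using crowded_measurable[OF that assms] by (intro measure_UNION_le) auto
  have "prob (\<Union>m\<in>{1..numM R}. \<Union>r<n. crowded m L T n (c m) r) \<le> (\<Sum>m\<in>{1..numM R}. prob (\<Union>r<n. crowded m L T n (c m) r))"
    using crowded_measurable[OF _ assms] by (intro measure_UNION_le sets.finite_UN) auto
  also have "\<dots> \<le> (\<Sum>m\<in>{1..numM R}. \<Sum>r<n. prob (crowded m L T n (c m) r))"
    by (intro sum_mono 1)
  finally have 2: "prob (\<Union>m\<in>{1..numM R}. \<Union>r<n. crowded m L T n (c m) r) \<le> \<dots>" .
  have 3: "prob (\<Union>i\<in>{i\<in>{1..num_disp Q N}. 0 < arr_rate Q i}. late L T i) \<le>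
      (\<Sum>i\<in>{i\<in>{1..num_disp Q N}. 0 < arr_rate Q i}. prob (late L T i))"
    using late_measurable by (intro measure_UNION_le) auto
  have "prob (bad L T n c) \<le> prob (\<Union>m\<in>{1..numM R}. \<Union>r<n. crowded m L T n (c m) r) +
      prob (\<Union>i\<in>{i\<in>{1..num_disp Q N}. 0 < arr_rate Q i}. late L T i)"
    unfolding bad_def using crowded_measurable[OF _ assms] late_measurable
    by (intro measure_Un_le sets.finite_UN) auto
  then show ?thesis using 2 3 by linarith
qed

lemma window_cover:
  fixes s :: real
  assumes "0 < n" "0 \<le> s" "s \<le> T"
  shows "\<exists>r<n. T * real r / real n \<le> s \<and> s \<le> T * real (Suc r) / real n"
proof (cases "s < T")
  case True
  obtain r where "r < n" "s \<in> {0 + real r * ((T - 0) / real n)..<0 + real (Suc r) * ((T - 0) / real n)}"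
    using uniform_cell[OF assms(2) True assms(1)] by blast
  then show ?thesis by (intro exI[of _ r]) (auto simp: mult.commute)
next
  case False
  \<comment> \<open>The right endpoint lies in no half-open cell; the last window, being closed,
    takes it.\<close>
  then have s: "s = T" using assms by simp
  have "T * real (n - 1) \<le> T * real n" using assms by (intro mult_left_mono) auto
  then have "T * real (n - 1) / real n \<le> T" using assms by (simp add: field_simps)
  moreover have "T \<le> T * real (Suc (n - 1)) / real n" using assms by simp
  ultimately show ?thesis using assms(1) s by (intro exI[of _ "n - 1"]) auto
qed

text \<open>The thresholds \<open>c m\<close> count servers. Lying strictly below the class sizes,
  they first exclude assignments to busy servers and then, every task being served on arrival, bound
  the busy fraction. One exceptional event thus serves both claims.\<close>

lemma AE_good:
  fixes c :: "nat \<Rightarrow> real"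
  assumes T: "0 \<le> T" and n: "0 < n"
    and c: "\<forall>m\<in>{1..numM R}. 0 \<le> c m \<and> c m < card (serv_class Q R N m)"
  shows "AE \<omega> in pspace S. \<omega> \<notin> bad L T n c \<longrightarrow>
    (\<forall>k\<in>tasks Q N. arrival S k \<omega> \<le> T \<longrightarrow> \<not> assigned_to_busy Q N S k \<omega>) \<and>
    (\<forall>m\<in>{1..numM R}. \<forall>t\<in>{0..T}. busy_fraction Q R N S m t \<omega> \<le> c m / N)"
  using AE_regular[of T L] AE_space
proof eventually_elim
  case (elim \<omega>)
  show ?case
  proof
    assume good: "\<omega> \<notin> bad L T n c"
    have "regular T L \<omega>"
      using elim good by (fastforce simp: bad_def late_def not_le)
    have ne: "\<forall>m\<in>{1..numM R}. serv_class Q R N m \<noteq> {}" using c by fastforce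
    have occ: "\<exists>a b. 0 \<le> a \<and> a \<le> s \<and> s \<le> b \<and> occupancy m L a b \<omega> \<le> c m"
      if m: "m \<in> {1..numM R}" and s: "0 \<le> s" "s \<le> T" for m s
    proof -
      obtain r where r: "r < n" "T * real r / real n \<le> s" "s \<le> T * real (Suc r) / real n"
        using window_cover[OF n s] by blast
      have "occupancy m L (T * real r / real n) (T * real (Suc r) / real n) \<omega> \<le> c m"
        using good elim(2) m r(1) by (force simp: bad_def crowded_def not_less)
      then show ?thesis using r T by (intro exI[of _ "T * real r / real n"] exI[of _ "T * real (Suc r) / real n"]) auto
    qed
    have idle: "\<not> assigned_to_busy Q N S k \<omega>" if "k \<in> tasks Q N" "arrival S k \<omega> \<le> T" for k
    proof (rule never_assigned_to_busy[OF \<open>regular T L \<omega>\<close> ne _ that])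
      fix m and s :: real assume "m \<in> {1..numM R}" "0 \<le> s" "s \<le> T"
      then show "\<exists>a b. 0 \<le> a \<and> a \<le> s \<and> s \<le> b \<and> occupancy m L a b \<omega> < card (serv_class Q R N m)"
        using occ[of m s] c le_less_trans by blast
    qed
    moreover have "busy_fraction Q R N S m t \<omega> \<le> c m / N" if m: "m \<in> {1..numM R}" and t: "t \<in> {0..T}" for m t
    proof -
      obtain a b where ab: "0 \<le> a" "a \<le> t" "t \<le> b" "occupancy m L a b \<omega> \<le> c m" using occ[OF m, of t] t by auto
      have "card {j\<in>serv_class Q R N m. queue Q N S j t \<omega> \<noteq> {}} \<le> c m"
        using busy_le_occupancy[OF \<open>regular T L \<omega>\<close> ne idle m ab(1-3)] t ab(4) by auto
      then show ?thesis unfolding busy_fraction_def by (intro divide_right_mono) auto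
    qed
    ultimately show "(\<forall>k\<in>tasks Q N. arrival S k \<omega> \<le> T \<longrightarrow> \<not> assigned_to_busy Q N S k \<omega>) \<and>
      (\<forall>m\<in>{1..numM R}. \<forall>t\<in>{0..T}. busy_fraction Q R N S m t \<omega> \<le> c m / N)" by blast
  qed
qed

lemma prob_good:
  fixes c :: "nat \<Rightarrow> real"
  assumes T: "0 \<le> T" and n: "0 < n"
    and c: "\<forall>m\<in>{1..numM R}. 0 \<le> c m \<and> c m < card (serv_class Q R N m)"
  shows "m \<in> {1..numM R} \<Longrightarrow> 1 - prob (bad L T n c) \<le>
       \<P>(\<omega> in pspace S. (SUP t\<in>{0..T}. ennreal (busy_fraction Q R N S m t \<omega>)) \<le> ennreal (c m / N))"
    and "\<P>(\<omega> in pspace S. \<exists>k\<in>tasks Q N. arrival S k \<omega> \<le> T \<and> assigned_to_busy Q N S k \<omega>) \<le> prob (bad L T n c)"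
proof -
  note AE = AE_good[OF T n c, of L]
  note bm = bad_measurable[OF T, of L n c]
  show "1 - prob (bad L T n c) \<le>
       \<P>(\<omega> in pspace S. (SUP t\<in>{0..T}. ennreal (busy_fraction Q R N S m t \<omega>)) \<le> ennreal (c m / N))"
    if m: "m \<in> {1..numM R}"
  proof -
    have "prob (space (pspace S) - bad L T n c) \<le>
       \<P>(\<omega> in pspace S. (SUP t\<in>{0..T}. ennreal (busy_fraction Q R N S m t \<omega>)) \<le> ennreal (c m / N))"
    proof (rule finite_measure_mono_AE)
      show "AE \<omega> in pspace S. \<omega> \<in> space (pspace S) - bad L T n c \<longrightarrow>
        \<omega> \<in> {\<omega>\<in>space (pspace S). (SUP t\<in>{0..T}. ennreal (busy_fraction Q R N S m t \<omega>)) \<le> ennreal (c m / N)}"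
        using AE
      proof eventually_elim
        case (elim \<omega>)
        show ?case
        proof
          assume "\<omega> \<in> space (pspace S) - bad L T n c"
          then have "\<omega> \<in> space (pspace S)" "\<forall>t\<in>{0..T}. busy_fraction Q R N S m t \<omega> \<le> c m / N"
            using elim m by blast+
          then show "\<omega> \<in> {\<omega>\<in>space (pspace S). (SUP t\<in>{0..T}. ennreal (busy_fraction Q R N S m t \<omega>)) \<le> ennreal (c m / N)}"
            by (intro CollectI conjI SUP_least ennreal_leI) blast+
        qed
      qed
    qed (rule busy_event_measurable[OF T])
    then show ?thesis using bm by (simp add: prob_compl)
  qed
  \<comment> \<open>For an upper bound only the larger set, \<open>bad\<close>, has to be
    measurable.\<close>
  show "\<P>(\<omega> in pspace S. \<exists>k\<in>tasks Q N. arrival S k \<omega> \<le> T \<and> assigned_to_busy Q N S k \<omega>) \<le> prob (bad L T n c)"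
    by (rule finite_measure_mono_AE[OF _ bm]) (use AE in \<open>eventually_elim, blast\<close>)
qed

end

section \<open>The limiting busy fraction as a real number\<close>

lemma ennreal_divide_real:
  assumes "0 \<le> x" "0 \<le> y" "y = 0 \<Longrightarrow> x = 0"
  shows "ennreal x / ennreal y = ennreal (x / y)"
  using assms by (cases "y = 0") (auto simp: divide_ennreal)

text \<open>The stationary mean of the infinite server queue of class \<open>m\<close> with service
  rates \<open>mu_star\<close>, scaled by \<open>1 / N\<close>, in the limit.\<close>

definition x_total :: "load_model \<Rightarrow> regime \<Rightarrow> nat \<Rightarrow> real" where
  "x_total Q R m = (\<Sum>h\<in>{1..numH R}. pmat R h m * lam_cell Q R h / mu_star Q R h m)"

lemma subcritical_term:
  assumes "f_sequence Q" "subcritical Q R" "h \<in> {1..numH R}" "m \<in> {1..numM R}"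
  shows "0 \<le> pmat R h m * lam_cell Q R h" "0 \<le> mu_star Q R h m"
    "mu_star Q R h m = 0 \<Longrightarrow> pmat R h m * lam_cell Q R h = 0"
proof -
  have p: "0 \<le> pmat R h m" "0 < lam_cell Q R h" using assms by (auto simp: subcritical_def)
  then show "0 \<le> pmat R h m * lam_cell Q R h" by simp
  show "0 \<le> mu_star Q R h m" by (rule mu_star_nonneg_le(1)[OF assms])
  show "pmat R h m * lam_cell Q R h = 0" if "mu_star Q R h m = 0"
    using mu_star_pos[OF assms] that p by (cases "pmat R h m = 0") auto
qed

lemma x_total_bounds:
  assumes fs: "f_sequence Q" and sub: "subcritical Q R" and m: "m \<in> {1..numM R}"
  shows "0 \<le> x_total Q R m" "x_total Q R m < vpart R m - vpart R (m - 1)"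
proof -
  note t = subcritical_term[OF fs sub _ m]
  show "0 \<le> x_total Q R m" unfolding x_total_def using t by (intro sum_nonneg divide_nonneg_nonneg) auto
  define v where "v = vpart R m - vpart R (m - 1)"
  have v: "0 < v" using cell_props(2)[OF sub m] by (simp add: v_def)
  have "(\<Sum>h\<in>{1..numH R}. ennreal (pmat R h m * lam_cell Q R h) / ennreal (v * mu_star Q R h m))
      = (\<Sum>h\<in>{1..numH R}. ennreal (pmat R h m * lam_cell Q R h / (v * mu_star Q R h m)))"
    using t v by (intro sum.cong refl ennreal_divide_real) auto
  also have "\<dots> = ennreal (\<Sum>h\<in>{1..numH R}. pmat R h m * lam_cell Q R h / (v * mu_star Q R h m))"
    using t v by (intro sum_ennreal) auto
  finally have eq: "(\<Sum>h\<in>{1..numH R}. ennreal (pmat R h m * lam_cell Q R h) / ennreal (v * mu_star Q R h m))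
      = ennreal (\<Sum>h\<in>{1..numH R}. pmat R h m * lam_cell Q R h / (v * mu_star Q R h m))" .
  have "ennreal (\<Sum>h\<in>{1..numH R}. pmat R h m * lam_cell Q R h / (v * mu_star Q R h m)) < 1"
  proof -
    have "\<forall>m\<in>{1..numM R}.
        (\<Sum>h\<in>{1..numH R}. ennreal (pmat R h m * lam_cell Q R h) /
           ennreal ((vpart R m - vpart R (m - 1)) * mu_star Q R h m)) < 1"
      using sub unfolding subcritical_def by blast
    then have "(\<Sum>h\<in>{1..numH R}. ennreal (pmat R h m * lam_cell Q R h) / ennreal (v * mu_star Q R h m)) < 1"
      using m unfolding v_def by blast
    then show ?thesis unfolding eq .
  qed
  then have "(\<Sum>h\<in>{1..numH R}. pmat R h m * lam_cell Q R h / (v * mu_star Q R h m)) < 1"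
    by (metis ennreal_1 ennreal_leI not_less)
  also have "(\<Sum>h\<in>{1..numH R}. pmat R h m * lam_cell Q R h / (v * mu_star Q R h m)) = x_total Q R m / v"
    unfolding x_total_def sum_divide_distrib by (intro sum.cong) (auto simp: mult.commute)
  finally show "x_total Q R m < vpart R m - vpart R (m - 1)" using v by (simp add: v_def)
qed

text \<open>Each \<open>h\<close> contributes to exactly one of the distinct values, so exchanging
  the two sums undoes the grouping by value.\<close>

lemma sum_x_p:
  assumes fs: "f_sequence Q" and sub: "subcritical Q R" and m: "m \<in> {1..numM R}"
    and bij: "bij_betw \<mu> {1..K} ((\<lambda>(h, m). mu_star Q R h m) ` ({1..numH R} \<times> {1..numM R}))"
  shows "(\<Sum>k\<in>{1..K}. x_p Q R m (\<mu> k)) = ennreal (x_total Q R m)"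
proof -
  define C where "C = (\<lambda>(h, m). mu_star Q R h m) ` ({1..numH R} \<times> {1..numM R})"
  note t = subcritical_term[OF fs sub _ m]
  have C0: "0 \<le> c" if "c \<in> C" for c using that mu_star_nonneg_le(1)[OF fs sub] by (auto simp: C_def)
  have lam: "0 \<le> lam_p Q R m c" "c = 0 \<Longrightarrow> lam_p Q R m c = 0" for c
    unfolding lam_p_def using t by (auto intro!: sum_nonneg sum.neutral)
  have "(\<Sum>k\<in>{1..K}. x_p Q R m (\<mu> k)) = (\<Sum>c\<in>C. x_p Q R m c)"
    using bij unfolding C_def by (intro sum.reindex_bij_betw)
  also have "\<dots> = (\<Sum>c\<in>C. ennreal (lam_p Q R m c / c))"
    unfolding x_p_def using lam C0 by (intro sum.cong refl ennreal_divide_real) auto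
  also have "\<dots> = ennreal (\<Sum>c\<in>C. lam_p Q R m c / c)"
    using lam C0 by (intro sum_ennreal) auto
  also have "(\<Sum>c\<in>C. lam_p Q R m c / c)
      = (\<Sum>h\<in>{1..numH R}. \<Sum>c\<in>C. if mu_star Q R h m = c then pmat R h m * lam_cell Q R h / c else 0)"
    unfolding lam_p_def sum_divide_distrib by (subst sum.swap) (intro sum.cong refl, auto)
  also have "\<dots> = x_total Q R m"
    unfolding x_total_def
  proof (intro sum.cong refl)
    fix h assume h: "h \<in> {1..numH R}"
    have "finite C" "mu_star Q R h m \<in> C" using h m by (auto simp: C_def)
    then show "(\<Sum>c\<in>C. if mu_star Q R h m = c then pmat R h m * lam_cell Q R h / c else 0)
      = pmat R h m * lam_cell Q R h / mu_star Q R h m" by simp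
  qed
  finally show ?thesis .
qed

section \<open>Limits\<close>

lemma arr_rate_bounded:
  assumes "f_sequence Q" "standing_assumptions Q"
  shows "\<exists>\<Lambda>>0. \<forall>i\<ge>1. 0 \<le> arr_rate Q i \<and> arr_rate Q i \<le> \<Lambda>"
proof -
  let ?g = "\<lambda>x. if x \<in> {0..<1} then arr_fun Q x else 0"
  have "riemann_integrable ?g 0 1" using assms(2) by (simp add: standing_assumptions_def)
  from riemann_integrable_bounded[OF this] obtain B where B: "B > 0" "\<forall>x\<in>{0..<1}. \<bar>?g x\<bar> \<le> B" by blast
  have "0 \<le> arr_rate Q i \<and> arr_rate Q i \<le> B" if "1 \<le> i" for i
  proof -
    have x: "disp_pos Q i \<in> {0..<1}" using assms(1) that unfolding f_sequence_def by blast
    then have "0 \<le> arr_fun Q (disp_pos Q i)" using assms(2) unfolding standing_assumptions_def by blast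
    moreover have "\<bar>?g (disp_pos Q i)\<bar> \<le> B" using B x by blast
    ultimately show ?thesis using x by (simp add: arr_rate_def)
  qed
  then show ?thesis using B(1) by blast
qed

lemma class_rate_limit:
  assumes fs: "f_sequence Q" and sa: "standing_assumptions Q" and sub: "subcritical Q R"
    and h: "h \<in> {1..numH R}" and e: "0 < e"
  shows "eventually (\<lambda>N. (\<Sum>i | i \<in> {1..num_disp Q N} \<and> disp_pos Q i \<in> wcell R h. arr_rate Q i) / N
    \<le> lam_cell Q R h + e) sequentially"
proof -
  let ?g = "\<lambda>x. if x \<in> {0..<1} then arr_fun Q x else 0"
  let ?a = "wpart R (h - 1)" and ?b = "wpart R h"
  have c: "wcell R h \<subseteq> {0..<1}" "?a < ?b" "0 \<le> ?a" "?b \<le> 1" using cell_props(1)[OF sub h] by auto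
  have "eventually (\<lambda>N. (\<Sum>i | i \<in> {1..num_disp Q N} \<and> disp_pos Q i \<in> {?a..<?b}. ?g (disp_pos Q i)) / real N
      \<le> disp_ratio Q * integral {?a..?b} ?g + e) sequentially"
  proof (rule equidistributed_sum_le[OF _ _ c(3,2,4) e])
    show "riemann_integrable ?g 0 1" "(\<lambda>N. real (num_disp Q N) / real N) \<longlonglongrightarrow> disp_ratio Q" "0 < disp_ratio Q"
      using sa unfolding standing_assumptions_def by blast+
    have "\<forall>x\<in>{0..<1}. 0 \<le> arr_fun Q x" using sa unfolding standing_assumptions_def by blast
    then show "0 \<le> ?g x" for x by simp
    show "(\<lambda>N. real (card {i\<in>{1..num_disp Q N}. disp_pos Q i \<in> E}) / real (num_disp Q N)) \<longlonglongrightarrow> measure lebesgue E"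
      if "is_interval E" "E \<subseteq> {0..<1}" for E
      using sa that unfolding standing_assumptions_def by blast
  qed
  moreover have "(\<Sum>i | i \<in> {1..num_disp Q N} \<and> disp_pos Q i \<in> {?a..<?b}. ?g (disp_pos Q i)) =
      (\<Sum>i | i \<in> {1..num_disp Q N} \<and> disp_pos Q i \<in> wcell R h. arr_rate Q i)" for N
    using c(1) by (intro sum.cong) (auto simp: wcell_def arr_rate_def)
  moreover have "integral {?a..?b} ?g = integral (wcell R h) (arr_fun Q)"
  proof -
    have "integral {?a..?b} ?g = integral (wcell R h) ?g"
      unfolding wcell_def
      by (intro integral_subset_negligible[symmetric]) (auto intro: negligible_subset[of "{?b}"])
    also have "\<dots> = integral (wcell R h) (arr_fun Q)"
      using c(1) by (intro Henstock_Kurzweil_Integration.integral_cong) auto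
    finally show ?thesis .
  qed
  ultimately show ?thesis by (simp add: lam_cell_def)
qed

lemma class_size_limit:
  assumes fs: "f_sequence Q" and sa: "standing_assumptions Q" and sub: "subcritical Q R" and m: "m \<in> {1..numM R}"
  shows "eventually (\<lambda>N. real N * x_total Q R m < card (serv_class Q R N m)) sequentially"
proof -
  have c: "vcell R m \<subseteq> {0..<1}" "vpart R (m - 1) < vpart R m" using cell_props(2)[OF sub m] by auto
  have "is_interval (vcell R m)" by (simp add: vcell_def is_interval_co)
  then have "(\<lambda>N. real (card {j\<in>{1..N}. serv_pos Q j \<in> vcell R m}) / real N) \<longlonglongrightarrow> measure lebesgue (vcell R m)"
    using sa c(1) unfolding standing_assumptions_def by blast
  moreover have "measure lebesgue (vcell R m) = vpart R m - vpart R (m - 1)"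
    using c(2) by (simp add: vcell_def)
  ultimately have "eventually (\<lambda>N. x_total Q R m < real (card (serv_class Q R N m)) / real N) sequentially"
    using x_total_bounds(2)[OF fs sub m] unfolding serv_class_def by (intro order_tendstoD(1)) auto
  then show ?thesis using eventually_gt_at_top[of 0]
    by eventually_elim (simp add: field_simps)
qed

text \<open>The \<open>D\<close> of the proof is the part of the stationary mean not yet reached at
  time \<open>T\<close>; the weight of \<open>h0\<close> makes it positive. The mesh is refined
  before \<open>N\<close> grows: for large \<open>n\<close> the windowed mean is below
  \<open>x_total - D / 2\<close>. The other half is the margin for two deviations, so the witness is
  \<open>D / 4\<close>.\<close>

lemma mean_occupancy_limit:
  assumes fs: "f_sequence Q" and sa: "standing_assumptions Q" and sub: "subcritical Q R"
    and m: "m \<in> {1..numM R}" and T: "0 \<le> T" and p: "h0 \<in> {1..numH R}" "pmat R h0 m \<noteq> 0"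
  shows "\<exists>D>0. eventually (\<lambda>n. eventually (\<lambda>N.
     (\<Sum>h\<in>{1..numH R}. pmat R h m * ((1 - exp (- mu_star Q R h m * T)) / mu_star Q R h m + T / real n) *
        (\<Sum>i | i \<in> {1..num_disp Q N} \<and> disp_pos Q i \<in> wcell R h. arr_rate Q i)) + 2 * (real N * D)
      \<le> real N * x_total Q R m) sequentially) sequentially"
proof -
  let ?H = "{1..numH R}"
  define \<psi> where "\<psi> n h = pmat R h m * ((1 - exp (- mu_star Q R h m * T)) / mu_star Q R h m + T / real n)" for n :: nat and h
  define A where "A N h = (\<Sum>i | i \<in> {1..num_disp Q N} \<and> disp_pos Q i \<in> wcell R h. arr_rate Q i)" for N h
  define D where "D = (\<Sum>h\<in>?H. pmat R h m * lam_cell Q R h * exp (- mu_star Q R h m * T) / mu_star Q R h m)"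
  have pm: "0 \<le> pmat R h m" "0 < lam_cell Q R h" "0 \<le> mu_star Q R h m" if "h \<in> ?H" for h
    using sub that m mu_star_nonneg_le(1)[OF fs sub that m] by (auto simp: subcritical_def)
  have "0 < mu_star Q R h0 m" using p pm[of h0] by (intro mu_star_pos[OF fs sub p(1) m]) auto
  then have "0 < pmat R h0 m * lam_cell Q R h0 * exp (- mu_star Q R h0 m * T) / mu_star Q R h0 m"
    using p pm[of h0] by (intro divide_pos_pos mult_pos_pos) auto
  also have "\<dots> \<le> D"
    unfolding D_def using p pm by (intro member_le_sum divide_nonneg_nonneg mult_nonneg_nonneg) (auto intro: less_imp_le)
  finally have D: "0 < D" .
  have "(\<lambda>n. \<Sum>h\<in>?H. \<psi> n h * lam_cell Q R h) \<longlonglongrightarrow>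
      (\<Sum>h\<in>?H. pmat R h m * ((1 - exp (- mu_star Q R h m * T)) / mu_star Q R h m + 0) * lam_cell Q R h)"
    unfolding \<psi>_def by (intro tendsto_intros lim_const_over_n)
  moreover have "(\<Sum>h\<in>?H. pmat R h m * ((1 - exp (- mu_star Q R h m * T)) / mu_star Q R h m + 0) * lam_cell Q R h)
      = x_total Q R m - D"
    unfolding x_total_def D_def sum_subtractf[symmetric]
    by (intro sum.cong refl) (simp add: diff_divide_distrib algebra_simps)
  ultimately have ev: "eventually (\<lambda>n. (\<Sum>h\<in>?H. \<psi> n h * lam_cell Q R h) < x_total Q R m - D / 2) sequentially"
    using D by (intro order_tendstoD(2)) auto
  have main: "eventually (\<lambda>N. (\<Sum>h\<in>?H. \<psi> n h * A N h) + 2 * (real N * (D / 4)) \<le> real N * x_total Q R m) sequentially"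
    if n: "(\<Sum>h\<in>?H. \<psi> n h * lam_cell Q R h) < x_total Q R m - D / 2" for n
  proof -
    have \<psi>0: "0 \<le> \<psi> n h" if "h \<in> ?H" for h
      unfolding \<psi>_def using pm[OF that] T
      by (intro mult_nonneg_nonneg add_nonneg_nonneg divide_nonneg_nonneg) auto
    \<comment> \<open>A tolerance for the intensity of every class such that the total error,
      weighted by \<psi>, stays within the gap; the added 1 keeps the denominator positive.\<close>
    define e where "e = (x_total Q R m - D / 2 - (\<Sum>h\<in>?H. \<psi> n h * lam_cell Q R h)) / (1 + (\<Sum>h\<in>?H. \<psi> n h))"
    have s0: "0 \<le> (\<Sum>h\<in>?H. \<psi> n h)" using \<psi>0 by (intro sum_nonneg)
    have e: "0 < e" unfolding e_def using n s0 by (intro divide_pos_pos) auto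
    have e_eq: "e * (1 + (\<Sum>h\<in>?H. \<psi> n h)) = x_total Q R m - D / 2 - (\<Sum>h\<in>?H. \<psi> n h * lam_cell Q R h)"
      using s0 by (simp add: e_def)
    have "eventually (\<lambda>N. \<forall>h\<in>?H. A N h / real N \<le> lam_cell Q R h + e) sequentially"
      unfolding A_def using class_rate_limit[OF fs sa sub _ e] by (intro eventually_ball_finite) auto
    then show ?thesis using eventually_gt_at_top[of 0]
    proof eventually_elim
      case (elim N)
      have "(\<Sum>h\<in>?H. \<psi> n h * A N h) = real N * (\<Sum>h\<in>?H. \<psi> n h * (A N h / real N))"
        using elim(2) by (simp add: sum_distrib_left)
      also have "\<dots> \<le> real N * (\<Sum>h\<in>?H. \<psi> n h * (lam_cell Q R h + e))"
        using elim(1) \<psi>0 by (intro mult_left_mono sum_mono) auto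
      also have "(\<Sum>h\<in>?H. \<psi> n h * (lam_cell Q R h + e)) = (\<Sum>h\<in>?H. \<psi> n h * lam_cell Q R h) + e * (\<Sum>h\<in>?H. \<psi> n h)"
        by (simp add: distrib_left sum.distrib sum_distrib_left mult.commute)
      also have "\<dots> \<le> x_total Q R m - D / 2" using e_eq e by (simp add: distrib_left)
      finally have "(\<Sum>h\<in>?H. \<psi> n h * A N h) \<le> real N * (x_total Q R m - D / 2)" by (simp add: mult_left_mono)
      then show ?case by (simp add: algebra_simps)
    qed
  qed
  have "eventually (\<lambda>n. eventually (\<lambda>N. (\<Sum>h\<in>?H. \<psi> n h * A N h) + 2 * (real N * (D / 4))
      \<le> real N * x_total Q R m) sequentially) sequentially"
    using ev by (rule eventually_mono) (rule main)
  then show ?thesis unfolding \<psi>_def A_def using D by (intro exI[of _ "D / 4"]) auto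
qed

text \<open>The bound \<open>u\<close> must not depend on \<open>L\<close>, which is picked for each
  \<open>N\<close> afterwards without control of its growth. It is of order \<open>1 / N\<close>:
  the second moments are of order \<open>num_disp Q N\<close>, hence \<open>N\<close>, while the
  margin is of order \<open>N\<close> and enters squared.\<close>

lemma prob_crowded_limit:
  fixes Q :: load_model and R :: regime
  assumes fs: "f_sequence Q" and sa: "standing_assumptions Q" and sub: "subcritical Q R"
    and m: "m \<in> {1..numM R}" and T: "0 \<le> T"
  shows "eventually (\<lambda>n. \<exists>u. u \<longlonglongrightarrow> 0 \<and> eventually (\<lambda>N. \<forall>(S :: 'a lb_system) L r. jiq_run Q R N S \<longrightarrow> r < n \<longrightarrow>
     measure (pspace S) (jiq_run.crowded Q R N S m L T n (real N * x_total Q R m) r) \<le> u N) sequentially) sequentially"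
proof (cases "\<exists>h\<in>{1..numH R}. pmat R h m \<noteq> 0")
  case True
  then obtain h0 where h0: "h0 \<in> {1..numH R}" "pmat R h0 m \<noteq> 0" by blast
  obtain D where D: "0 < D" and ev: "eventually (\<lambda>n. eventually (\<lambda>N.
     (\<Sum>h\<in>{1..numH R}. pmat R h m * ((1 - exp (- mu_star Q R h m * T)) / mu_star Q R h m + T / real n) *
        (\<Sum>i | i \<in> {1..num_disp Q N} \<and> disp_pos Q i \<in> wcell R h. arr_rate Q i)) + 2 * (real N * D)
      \<le> real N * x_total Q R m) sequentially) sequentially"
    using mean_occupancy_limit[OF fs sa sub m T h0] by blast
  obtain \<Lambda> where \<Lambda>: "\<And>i. 1 \<le> i \<Longrightarrow> 0 \<le> arr_rate Q i \<and> arr_rate Q i \<le> \<Lambda>"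
    using arr_rate_bounded[OF fs sa] by blast
  define \<kappa> where "\<kappa> = 2 * (\<Lambda> * T) * exp (2 * (\<Lambda> * T))"
  define u where "u N = 2 * (num_disp Q N * \<kappa> / (real N * D)\<^sup>2)" for N :: nat
  have u: "u \<longlonglongrightarrow> 0"
  proof -
    have "(\<lambda>N. 2 * \<kappa> / D\<^sup>2 * ((real (num_disp Q N) / real N) * (1 / real N))) \<longlonglongrightarrow> 2 * \<kappa> / D\<^sup>2 * (disp_ratio Q * 0)"
      using sa by (intro tendsto_intros lim_const_over_n) (auto simp: standing_assumptions_def)
    moreover have "u = (\<lambda>N. 2 * \<kappa> / D\<^sup>2 * ((real (num_disp Q N) / real N) * (1 / real N)))"
      by (intro ext) (simp add: u_def power2_eq_square mult_ac)
    ultimately show ?thesis by simp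
  qed
  show ?thesis
    using ev
  proof (rule eventually_mono)
    fix n
    assume "eventually (\<lambda>N.
     (\<Sum>h\<in>{1..numH R}. pmat R h m * ((1 - exp (- mu_star Q R h m * T)) / mu_star Q R h m + T / real n) *
        (\<Sum>i | i \<in> {1..num_disp Q N} \<and> disp_pos Q i \<in> wcell R h. arr_rate Q i)) + 2 * (real N * D)
      \<le> real N * x_total Q R m) sequentially"
    then have "eventually (\<lambda>N. \<forall>(S :: 'a lb_system) L r. jiq_run Q R N S \<longrightarrow> r < n \<longrightarrow>
     measure (pspace S) (jiq_run.crowded Q R N S m L T n (real N * x_total Q R m) r) \<le> u N) sequentially"
      using eventually_gt_at_top[of 0]
    proof eventually_elim
      case (elim N)
      show ?case
      proof (intro allI impI)
        fix S :: "'a lb_system" and L r assume "jiq_run Q R N S" and r: "r < n"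
        then interpret jiq_run Q R N S by simp
        have "0 < real N * D" using elim(2) D by simp
        from prob_crowded_le[OF m T r \<Lambda> this elim(1), of L]
        show "measure (pspace S) (jiq_run.crowded Q R N S m L T n (real N * x_total Q R m) r) \<le> u N"
          by (simp add: u_def \<kappa>_def)
      qed
    qed
    then show "\<exists>u. u \<longlonglongrightarrow> 0 \<and> eventually (\<lambda>N. \<forall>(S :: 'a lb_system) L r. jiq_run Q R N S \<longrightarrow> r < n \<longrightarrow>
     measure (pspace S) (jiq_run.crowded Q R N S m L T n (real N * x_total Q R m) r) \<le> u N) sequentially"
      using u by blast
  qed
next
  case False
  have "measure (pspace S) (jiq_run.crowded Q R N S m L T n (real N * x_total Q R m) r) \<le> 0"
    if "jiq_run Q R N S" for S :: "'a lb_system" and N L n r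
  proof -
    interpret jiq_run Q R N S by fact
    show ?thesis
      using False x_total_bounds(1)[OF fs sub m] by (subst no_feeder_not_crowded[OF m T]) auto
  qed
  note le = this
  show ?thesis
    by (intro always_eventually allI exI[of _ "\<lambda>_. 0"] conjI tendsto_const impI) (rule le)
qed

text \<open>For fixed \<open>N\<close> the terms of the exponential series tend to 0, so a large
  \<open>L\<close> makes the truncation error as small as desired; \<open>1 / N\<close> is a
  convenient null sequence.\<close>

lemma prob_late_limit:
  fixes S :: "nat \<Rightarrow> 'a lb_system"
  assumes fs: "f_sequence Q" and sa: "standing_assumptions Q" and T: "0 \<le> T"
    and run: "\<forall>N\<ge>1. jiq_run Q R N (S N)"
  shows "\<exists>L. \<forall>N\<ge>1. (\<Sum>i\<in>{i\<in>{1..num_disp Q N}. 0 < arr_rate Q i}.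
     measure (pspace (S N)) (jiq_run.late Q N (S N) (L N) T i)) \<le> 1 / real N"
proof -
  obtain \<Lambda> where \<Lambda>: "\<Lambda> > 0" "\<And>i. 1 \<le> i \<Longrightarrow> 0 \<le> arr_rate Q i \<and> arr_rate Q i \<le> \<Lambda>"
    using arr_rate_bounded[OF fs sa] by blast
  define y where "y = \<Lambda> * T"
  have y: "0 \<le> y" using \<Lambda> T by (simp add: y_def)
  have "\<exists>L. (\<Sum>i\<in>{i\<in>{1..num_disp Q N}. 0 < arr_rate Q i}.
     measure (pspace (S N)) (jiq_run.late Q N (S N) L T i)) \<le> 1 / real N" if N: "1 \<le> N" for N
  proof -
    interpret jiq_run Q R N "S N" using run N by blast
    have "(\<lambda>L. y ^ L / fact L) \<longlonglongrightarrow> 0"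
      using summable_LIMSEQ_zero[OF summable_exp_generic[of y]] by (simp add: divide_inverse mult.commute)
    then have "(\<lambda>L. real (num_disp Q N) * (y * (y ^ L / fact L))) \<longlonglongrightarrow> real (num_disp Q N) * (y * 0)"
      by (intro tendsto_intros)
    then have "eventually (\<lambda>L. real (num_disp Q N) * (y * (y ^ L / fact L)) < 1 / real N) sequentially"
      using N by (intro order_tendstoD(2)) auto
    then obtain L where L: "real (num_disp Q N) * (y * (y ^ L / fact L)) < 1 / real N"
      by (auto simp: eventually_sequentially)
    have "(\<Sum>i\<in>{i\<in>{1..num_disp Q N}. 0 < arr_rate Q i}. prob (late L T i))
        \<le> (\<Sum>i\<in>{i\<in>{1..num_disp Q N}. 0 < arr_rate Q i}. y * (y ^ L / fact L))"
      using \<Lambda> T by (intro sum_mono prob_late_le) (auto simp: y_def intro: mult_right_mono)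
    also have "\<dots> \<le> (\<Sum>i\<in>{1..num_disp Q N}. y * (y ^ L / fact L))"
      using y by (intro sum_mono2) auto
    finally show ?thesis using L by (intro exI[of _ L]) simp
  qed
  then have "\<forall>N. \<exists>L. 1 \<le> N \<longrightarrow> (\<Sum>i\<in>{i\<in>{1..num_disp Q N}. 0 < arr_rate Q i}.
     measure (pspace (S N)) (jiq_run.late Q N (S N) L T i)) \<le> 1 / real N" by blast
  from choice[OF this] show ?thesis by blast
qed

theorem theorem3p15:
  fixes Q :: load_model and R :: regime and S :: "nat \<Rightarrow> 'a lb_system"
    and K :: nat and \<mu> :: "nat \<Rightarrow> real" and T :: real
  assumes "f_sequence Q"
    and "standing_assumptions Q"
    and "subcritical Q R"
    and "\<And>N. 1 \<le> N \<Longrightarrow> jiq_system Q R N (S N)"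
    and "bij_betw \<mu> {1..K} ((\<lambda>(h, m). mu_star Q R h m) ` ({1..numH R} \<times> {1..numM R}))"
    and "0 \<le> T"
  shows "(\<forall>m\<in>{1..numM R}.
            (\<lambda>N. \<P>(\<omega> in pspace (S N).
               (SUP t\<in>{0..T}. ennreal (busy_fraction Q R N (S N) m t \<omega>)) \<le>
                 (\<Sum>k\<in>{1..K}. x_p Q R m (\<mu> k)))) \<longlonglongrightarrow> 1) \<and>
         (\<lambda>N. \<P>(\<omega> in pspace (S N).
            \<exists>k\<in>tasks Q N. arrival (S N) k \<omega> \<le> T \<and> assigned_to_busy Q N (S N) k \<omega>))
           \<longlonglongrightarrow> 0"
proof -
  note fs = assms(1) and sa = assms(2) and sub = assms(3) and T = assms(6)
  have run: "\<forall>N\<ge>1. jiq_run Q R N (S N)"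
    using assms(4) fs sub by (simp add: jiq_run_def)
  \<comment> \<open>The thresholds as counts of servers: \<open>c N m / N\<close> is exactly the
    claimed bound.\<close>
  define c where "c N m = real N * x_total Q R m" for N :: nat and m
  have evn: "eventually (\<lambda>n. \<forall>m\<in>{1..numM R}. \<exists>u. u \<longlonglongrightarrow> 0 \<and>
      eventually (\<lambda>N. \<forall>(S :: 'a lb_system) L r. jiq_run Q R N S \<longrightarrow> r < n \<longrightarrow>
        measure (pspace S) (jiq_run.crowded Q R N S m L T n (c N m) r) \<le> u N) sequentially) sequentially"
    unfolding c_def by (intro eventually_ball_finite ballI prob_crowded_limit[OF fs sa sub _ T]) auto
  \<comment> \<open>One mesh serves all classes, as they are finitely many; it stays fixed while
    \<open>N\<close> grows.\<close>
  obtain n where n: "0 < n" and exu: "\<forall>m\<in>{1..numM R}. \<exists>u. u \<longlonglongrightarrow> 0 \<and>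
      eventually (\<lambda>N. \<forall>(S :: 'a lb_system) L r. jiq_run Q R N S \<longrightarrow> r < n \<longrightarrow>
        measure (pspace S) (jiq_run.crowded Q R N S m L T n (c N m) r) \<le> u N) sequentially"
    using eventually_happens'[OF sequentially_bot eventually_conj[OF evn eventually_gt_at_top[of 0]]] by blast
  obtain u where u: "\<And>m. m \<in> {1..numM R} \<Longrightarrow> u m \<longlonglongrightarrow> 0" and
      uev: "\<And>m. m \<in> {1..numM R} \<Longrightarrow> eventually (\<lambda>N. \<forall>(S :: 'a lb_system) L r. jiq_run Q R N S \<longrightarrow> r < n \<longrightarrow>
        measure (pspace S) (jiq_run.crowded Q R N S m L T n (c N m) r) \<le> u m N) sequentially"
    using bchoice[OF exu] by blast
  obtain L where L: "\<And>N. 1 \<le> N \<Longrightarrow> (\<Sum>i\<in>{i\<in>{1..num_disp Q N}. 0 < arr_rate Q i}.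
     measure (pspace (S N)) (jiq_run.late Q N (S N) (L N) T i)) \<le> 1 / real N"
    using prob_late_limit[OF fs sa T run] by blast
  \<comment> \<open>The union bound: a fixed number of classes and windows, each with a null
    sequence, plus the truncation error.\<close>
  define v where "v N = (\<Sum>m\<in>{1..numM R}. \<Sum>r<n. u m N) + 1 / real N" for N
  have v: "v \<longlonglongrightarrow> 0"
  proof -
    have "v \<longlonglongrightarrow> (\<Sum>m\<in>{1..numM R}. \<Sum>r<n. 0) + 0"
      unfolding v_def using u by (intro tendsto_intros lim_const_over_n)
    then show ?thesis by simp
  qed
  define g where "g N m = measure (pspace (S N)) {\<omega>\<in>space (pspace (S N)).
      (SUP t\<in>{0..T}. ennreal (busy_fraction Q R N (S N) m t \<omega>)) \<le> (\<Sum>k\<in>{1..K}. x_p Q R m (\<mu> k))}" for N m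
  define b where "b N = measure (pspace (S N)) {\<omega>\<in>space (pspace (S N)).
      \<exists>k\<in>tasks Q N. arrival (S N) k \<omega> \<le> T \<and> assigned_to_busy Q N (S N) k \<omega>}" for N
  have "eventually (\<lambda>N. \<forall>m\<in>{1..numM R}. c N m < card (serv_class Q R N m)) sequentially"
    unfolding c_def using class_size_limit[OF fs sa sub] by (intro eventually_ball_finite) auto
  moreover have "eventually (\<lambda>N. \<forall>m\<in>{1..numM R}. \<forall>(S :: 'a lb_system) L r. jiq_run Q R N S \<longrightarrow> r < n \<longrightarrow>
        measure (pspace S) (jiq_run.crowded Q R N S m L T n (c N m) r) \<le> u m N) sequentially"
    using uev by (intro eventually_ball_finite) auto
  ultimately have ev: "eventually (\<lambda>N. (\<forall>m\<in>{1..numM R}. 1 - v N \<le> g N m \<and> g N m \<le> 1) \<and> 0 \<le> b N \<and> b N \<le> v N) sequentially"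
    using eventually_ge_at_top[of 1]
  proof eventually_elim
    case (elim N)
    interpret jiq_run Q R N "S N" using run elim(3) by blast
    have "prob (bad (L N) T n (c N)) \<le> (\<Sum>m\<in>{1..numM R}. \<Sum>r<n. u m N) + 1 / real N"
      using prob_bad_le[OF T, of "L N" n "c N"] L[OF elim(3)] elim(2) jiq_run_axioms
      by (intro order_trans[OF prob_bad_le[OF T]] add_mono sum_mono) auto
    then have bv: "prob (bad (L N) T n (c N)) \<le> v N" by (simp add: v_def)
    have cN: "\<forall>m\<in>{1..numM R}. 0 \<le> c N m \<and> c N m < card (serv_class Q R N m)"
      using elim(1) x_total_bounds(1)[OF fs sub] by (simp add: c_def)
    have x: "(\<Sum>k\<in>{1..K}. x_p Q R m (\<mu> k)) = ennreal (c N m / N)" if "m \<in> {1..numM R}" for m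
      using sum_x_p[OF fs sub that assms(5)] elim(3) by (simp add: c_def)
    have "1 - v N \<le> g N m \<and> g N m \<le> 1" if m: "m \<in> {1..numM R}" for m
      using prob_good(1)[OF T n cN m, of "L N"] bv unfolding g_def x[OF m] by auto
    moreover have "0 \<le> b N \<and> b N \<le> v N"
      using prob_good(2)[OF T n cN, of "L N"] bv unfolding b_def by auto
    ultimately show ?case by blast
  qed
  have "(\<lambda>N. g N m) \<longlonglongrightarrow> 1" if m: "m \<in> {1..numM R}" for m
  proof (rule tendsto_sandwich)
    show "(\<lambda>N. 1 - v N) \<longlonglongrightarrow> 1" using tendsto_diff[OF tendsto_const v] by simp
    show "eventually (\<lambda>N. 1 - v N \<le> g N m) sequentially" "eventually (\<lambda>N. g N m \<le> 1) sequentially"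
      using ev m by (auto elim!: eventually_mono)
  qed simp
  moreover have "b \<longlonglongrightarrow> 0"
  proof (rule tendsto_sandwich[OF _ _ tendsto_const v])
    show "eventually (\<lambda>N. 0 \<le> b N) sequentially" "eventually (\<lambda>N. b N \<le> v N) sequentially"
      using ev by (auto elim!: eventually_mono)
  qed
  ultimately show ?thesis unfolding g_def b_def by blast
qed

end
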